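(* Let $\Bbbk$ be a field of characteristic $p>0$, let $V$ be an $n$-dimensional $\Bbbk$-vector space, and let $G\subseteq \mathrm{GL}(V)$ be a finite $p$-group that is a generalised Nakajima group with generalised Nakajima basis $\mathcal{B}=\{x_1,\ldots,x_n\}$ of $V^*$. Let $S=\mathrm{Sym}\,V^*=\Bbbk[x_1,\ldots,x_n]$. Then the Hilbert ideal $\mathfrak{h}_{G,S}$ is a complete intersection. Moreover, $\mathfrak{h}_{G,S}$ can be generated by a set of homogeneous generators $\{f_1,\ldots,f_n\}$ such that, for each $j=1,\ldots,n$: $f_j\in\Bbbk[x_1,\ldots,x_j]$, $\deg(f_j)\leq |G|$, and $x_j^{\deg(f_j)}$ is a term of $f_j$ (i.e. occurs in $f_j$ with nonzero coefficient).
   Context: $G$ acts on $V^*$ by $(gx)(v)=x(g^{-1}v)$, and this extends to an action on $S=\mathrm{Sym}\,V^*$ by graded $\Bbbk$-algebra automorphisms; $S^G$ is the ring of invariants. The Hilbert ideal is $\mathfrak{h}_{G,S}=(S^G)_+S$, the $S$-ideal generated by all invariants of positive degree. A homogeneous $S$-ideal $I$ is a complete intersection if it is minimally generated by $\mathrm{ht}(I)$ elements. Given an ordered basis $x_1,\ldots,x_n$ of $V^*$ and $g\in G$, put $\beta_g=\max\{j\mid x_j \text{ appears (with nonzero coefficient) in } gx_i-x_i\text{ for some } i\}$ (with $\beta_g=0$ if $g$ is the identity). $G$ is a generalised Nakajima group if there exist an ordered basis $\mathcal{B}=\{x_1,\ldots,x_n\}$ of $V^*$ and a sequence of integers $1\leq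 i_0<i_1<\cdots<i_r\leq n$ ($r<n$) such that: (a) $gx_i-x_i\in\Bbbk\langle x_1,\ldots,x_{i-1}\rangle$ for all $g\in G$ and all $i=1,\ldots,n$; (b) $G$ is generated as a group by $P_1\cup P_2\cup\cdots\cup P_r$, where, for $k=1,\ldots,r$, $P_k$ is the subgroup of $G$ generated by $\{g\in G\mid \text{if } gx_i\neq x_i \text{ then } i_{k-1}<i\leq i_k \text{ and } \beta_g\leq i_{k-1}\}$. Such a $\mathcal{B}$ is called a generalised Nakajima basis, and $(i_0,\ldots,i_r)$ a generalised Nakajima sequence with respect to $\mathcal{B}$. *)

theory Defs
  imports
    "HOL-Library.Poly_Mapping"
    "HOL-Library.Function_Algebras"
    "HOL-Library.Extended_Nat"
    "HOL-Algebra.Ideal"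
    "HOL-Algebra.Generated_Groups"
begin

section \<open>Polynomial rings\<close>

text \<open>
  Monomials are finitely supported exponent functions, and the variable \<open>x\<^sub>j\<close> has index \<open>j\<close>.
  The polynomial ring in \<open>x\<^sub>1, \<dots>, x\<^sub>n\<close> is the subring of the polynomials that involve
  no other variables.
\<close>

type_synonym 'k mpol = "(nat \<Rightarrow>\<^sub>0 nat) \<Rightarrow>\<^sub>0 'k"

definition polys_upto :: "nat \<Rightarrow> 'k::field mpol set" where
  "polys_upto n = {f. \<forall>m \<in> Poly_Mapping.keys f. Poly_Mapping.keys m \<subseteq> {1..n}}"

definition mpol_ring :: "nat \<Rightarrow> 'k::field mpol ring" where
  "mpol_ring n = \<lparr>carrier = polys_upto n, monoid.mult = (*), one = 1, zero = 0, add = (+)\<rparr>"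

definition mpol_const :: "'k::field \<Rightarrow> 'k mpol" where
  "mpol_const c = Poly_Mapping.single 0 c"

definition mpol_var :: "nat \<Rightarrow> 'k::field mpol" where
  "mpol_var j = Poly_Mapping.single (Poly_Mapping.single j 1) 1"

definition mon_degree :: "(nat \<Rightarrow>\<^sub>0 nat) \<Rightarrow> nat" where
  "mon_degree m = (\<Sum>j \<in> Poly_Mapping.keys m. Poly_Mapping.lookup m j)"

definition total_degree :: "'k::field mpol \<Rightarrow> nat" where
  "total_degree f = Max (insert 0 (mon_degree ` Poly_Mapping.keys f))"

definition homogeneous_of_degree :: "nat \<Rightarrow> 'k::field mpol \<Rightarrow> bool" where
  "homogeneous_of_degree d f \<longleftrightarrow> (\<forall>m \<in> Poly_Mapping.keys f. mon_degree m = d)"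

definition homogeneous :: "'k::field mpol \<Rightarrow> bool" where
  "homogeneous f \<longleftrightarrow> (\<exists>d. homogeneous_of_degree d f)"


section \<open>Height and complete intersections\<close>

definition prime_height :: "('a, 'b) ring_scheme \<Rightarrow> 'a set \<Rightarrow> enat" where
  "prime_height R P =
     (SUP k \<in> {k. \<exists>c :: nat \<Rightarrow> 'a set. (\<forall>i \<le> k. primeideal (c i) R) \<and>
                    (\<forall>i < k. c i \<subset> c (Suc i)) \<and> c k = P}. enat k)"

definition ideal_height :: "('a, 'b) ring_scheme \<Rightarrow> 'a set \<Rightarrow> enat" where
  "ideal_height R I = (INF P \<in> {P. primeideal P R \<and> I \<subseteq> P}. prime_height R P)"

definition minimally_generates :: "('a, 'b) ring_scheme \<Rightarrow> 'a set \<Rightarrow> 'a set \<Rightarrow> bool" where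
  "minimally_generates R F I \<longleftrightarrow>
     F \<subseteq> carrier R \<and> genideal R F = I \<and> (\<forall>F'. F' \<subset> F \<longrightarrow> genideal R F' \<noteq> I)"

definition homogeneous_ideal :: "nat \<Rightarrow> 'k::field mpol set \<Rightarrow> bool" where
  "homogeneous_ideal n I \<longleftrightarrow>
     (\<exists>H \<subseteq> polys_upto n. (\<forall>h \<in> H. homogeneous h) \<and> I = genideal (mpol_ring n) H)"

definition complete_intersection :: "nat \<Rightarrow> 'k::field mpol set \<Rightarrow> bool" where
  "complete_intersection n I \<longleftrightarrow> homogeneous_ideal n I \<and>
     (\<exists>F. finite F \<and> minimally_generates (mpol_ring n) F I \<and>
          enat (card F) = ideal_height (mpol_ring n) I)"


section \<open>The general linear group and the dual space\<close>

definition GL :: "('k::field \<Rightarrow> 'v::ab_group_add \<Rightarrow> 'v) \<Rightarrow> ('v \<Rightarrow> 'v) monoid" where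
  "GL scale = \<lparr>carrier = {g. Vector_Spaces.linear scale scale g \<and> bij g}, monoid.mult = (\<circ>), one = id\<rparr>"

definition dual_space :: "('k::field \<Rightarrow> 'v::ab_group_add \<Rightarrow> 'v) \<Rightarrow> ('v \<Rightarrow> 'k) set" where
  "dual_space scale = {\<phi>. Vector_Spaces.linear scale (*) \<phi>}"

definition dual_scale :: "'k::field \<Rightarrow> ('v \<Rightarrow> 'k) \<Rightarrow> ('v \<Rightarrow> 'k)" where
  "dual_scale c \<phi> = (\<lambda>v. c * \<phi> v)"

definition dual_act :: "('v \<Rightarrow> 'v) \<Rightarrow> ('v \<Rightarrow> 'k) \<Rightarrow> ('v \<Rightarrow> 'k)" where
  "dual_act g \<phi> = (\<lambda>v. \<phi> (inv_into UNIV g v))"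

definition ordered_dual_basis ::
    "('k::field \<Rightarrow> 'v::ab_group_add \<Rightarrow> 'v) \<Rightarrow> nat \<Rightarrow> (nat \<Rightarrow> 'v \<Rightarrow> 'k) \<Rightarrow> bool" where
  "ordered_dual_basis scale n x \<longleftrightarrow>
     inj_on x {1..n} \<and> \<not> Modules.module.dependent dual_scale (x ` {1..n}) \<and>
     Modules.module.span dual_scale (x ` {1..n}) = dual_space scale"

definition dual_coeff :: "nat \<Rightarrow> (nat \<Rightarrow> 'v \<Rightarrow> 'k::field) \<Rightarrow> ('v \<Rightarrow> 'k) \<Rightarrow> nat \<Rightarrow> 'k" where
  "dual_coeff n x \<phi> j = Modules.module.representation dual_scale (x ` {1..n}) \<phi> (x j)"


section \<open>The action on the symmetric algebra and the Hilbert ideal\<close>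

text \<open>
  Given an ordered basis \<open>x\<close> of the dual space, the symmetric algebra is identified with the
  polynomial ring in \<open>x\<^sub>1, \<dots>, x\<^sub>n\<close>: \<open>linear_form\<close> embeds the dual space as the
  degree one part, and \<open>sym_act\<close> is the extension of the action to an algebra endomorphism.
\<close>

definition linear_form :: "nat \<Rightarrow> (nat \<Rightarrow> 'v \<Rightarrow> 'k::field) \<Rightarrow> ('v \<Rightarrow> 'k) \<Rightarrow> 'k mpol" where
  "linear_form n x \<phi> = (\<Sum>j = 1..n. mpol_const (dual_coeff n x \<phi> j) * mpol_var j)"

definition sym_act :: "nat \<Rightarrow> (nat \<Rightarrow> 'v \<Rightarrow> 'k::field) \<Rightarrow> ('v \<Rightarrow> 'v) \<Rightarrow> 'k mpol \<Rightarrow> 'k mpol" where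
  "sym_act n x g f =
     (\<Sum>m \<in> Poly_Mapping.keys f. mpol_const (Poly_Mapping.lookup f m) *
        (\<Prod>j \<in> Poly_Mapping.keys m. linear_form n x (dual_act g (x j)) ^ Poly_Mapping.lookup m j))"

definition invariants :: "nat \<Rightarrow> (nat \<Rightarrow> 'v \<Rightarrow> 'k::field) \<Rightarrow> ('v \<Rightarrow> 'v) set \<Rightarrow> 'k mpol set" where
  "invariants n x G = {f \<in> polys_upto n. \<forall>g \<in> G. sym_act n x g f = f}"

definition hilbert_ideal :: "nat \<Rightarrow> (nat \<Rightarrow> 'v \<Rightarrow> 'k::field) \<Rightarrow> ('v \<Rightarrow> 'v) set \<Rightarrow> 'k mpol set" where
  "hilbert_ideal n x G =
     genideal (mpol_ring n) {f \<in> invariants n x G. \<exists>d > 0. homogeneous_of_degree d f}"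


section \<open>Generalised Nakajima bases\<close>

definition beta :: "nat \<Rightarrow> (nat \<Rightarrow> 'v \<Rightarrow> 'k::field) \<Rightarrow> ('v \<Rightarrow> 'v) \<Rightarrow> nat" where
  "beta n x g =
     (if g = id then 0
      else Max {j \<in> {1..n}. \<exists>i \<in> {1..n}. dual_coeff n x (dual_act g (x i) - x i) j \<noteq> 0})"

definition nakajima_part ::
    "('k::field \<Rightarrow> 'v::ab_group_add \<Rightarrow> 'v) \<Rightarrow> nat \<Rightarrow> ('v \<Rightarrow> 'v) set \<Rightarrow> (nat \<Rightarrow> 'v \<Rightarrow> 'k)
      \<Rightarrow> (nat \<Rightarrow> nat) \<Rightarrow> nat \<Rightarrow> ('v \<Rightarrow> 'v) set" where
  "nakajima_part scale n G x s k =
     generate (GL scale)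
       {g \<in> G. \<forall>i \<in> {1..n}. dual_act g (x i) \<noteq> x i \<longrightarrow>
                 s (k - 1) < i \<and> i \<le> s k \<and> beta n x g \<le> s (k - 1)}"

text \<open>The entries of the sequence are \<open>s 0, \<dots>, s r\<close>; other values of \<open>s\<close> are irrelevant.\<close>

definition gen_nakajima_sequence ::
    "('k::field \<Rightarrow> 'v::ab_group_add \<Rightarrow> 'v) \<Rightarrow> nat \<Rightarrow> ('v \<Rightarrow> 'v) set \<Rightarrow> (nat \<Rightarrow> 'v \<Rightarrow> 'k)
      \<Rightarrow> nat \<Rightarrow> (nat \<Rightarrow> nat) \<Rightarrow> bool" where
  "gen_nakajima_sequence scale n G x r s \<longleftrightarrow>
     r < n \<and> 1 \<le> s 0 \<and> (\<forall>k < r. s k < s (Suc k)) \<and> s r \<le> n \<and>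
     (\<forall>g \<in> G. \<forall>i \<in> {1..n}.
        dual_act g (x i) - x i \<in> Modules.module.span dual_scale (x ` {1..<i})) \<and>
     G = generate (GL scale) (\<Union>k \<in> {1..r}. nakajima_part scale n G x s k)"

definition gen_nakajima_basis ::
    "('k::field \<Rightarrow> 'v::ab_group_add \<Rightarrow> 'v) \<Rightarrow> nat \<Rightarrow> ('v \<Rightarrow> 'v) set \<Rightarrow> (nat \<Rightarrow> 'v \<Rightarrow> 'k) \<Rightarrow> bool" where
  "gen_nakajima_basis scale n G x \<longleftrightarrow>
     ordered_dual_basis scale n x \<and> (\<exists>r s. gen_nakajima_sequence scale n G x r s)"

end

theory Submission
  imports Defs "HOL-Algebra.Exponent" "HOL-Algebra.Algebraic_Closure_Type"
begin

text \<open>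
  Cut the variables into the blocks given by the generalised Nakajima sequence. For one block with
  variables \<open>y\<close>, let \<open>A\<close> be the polynomial ring in the variables of the lower blocks. Every
  element of \<open>G\<close> translates each \<open>y\<close> by a linear form of \<open>A\<close>, so the Hasse derivatives with respect
  to \<open>y\<close> commute with \<open>G\<close>. The parts of \<open>G\<close> belonging to lower blocks fix \<open>y\<close> and the other parts fix
  \<open>A\<close>; hence the coefficients in \<open>A\<close> of an invariant \<open>\<Sum> a\<^sub>\<alpha> y\<^sup>\<alpha>\<close> of \<open>A[y]\<close> are again invariants,
  and modulo the Hilbert ideal the invariant equals its image in \<open>k[y]\<close>.

  The image \<open>B\<close> of the invariants in \<open>k[y]\<close> is a subalgebra closed under Hasse derivatives, and it contains
  \<open>y\<^sub>j\<close> to the power \<open>|G|\<close>, the image of a norm. In characteristic \<open>p\<close> such an algebra is generated by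
  elements \<open>f\<^sub>j\<close> whose leading monomial is \<open>y\<^sub>j\<close> to a power of \<open>p\<close>, and these powers divide \<open>|G|\<close>.

  The resulting generators are triangular, so the homogeneous maximal ideal is the only prime ideal above
  the Hilbert ideal; it has height \<open>n\<close>. No generator is redundant, because the others have a
  common zero over the algebraic closure at which it does not vanish.
\<close>

section \<open>Evaluation of polynomials\<close>

text \<open>Ordinary derivatives annihilate p-th powers, so the coefficients of an expansion in y
  cannot be recovered from them. Hasse derivatives have the factorials divided out: deriving to
  order \<alpha> and then setting y to 0 gives exactly the coefficient of y to the \<alpha>. The
  second half of this operation is not equivariant under an arbitrary group element, since a product
  of generators may move several blocks at once. Invariance of a coefficient is therefore tested on
  generators only, each of which moves a single block. Generation is also what sharpens
  triangularity to blocks: a generator displaces a variable by forms in lower blocks, and this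
  property survives products and inverses.

  The upper bound on the height rests on counting: a chain of n+2 primes would provide n+1 elements,
  one from each gap, and these are algebraically dependent. The algebraic closure enters because the
  common zero is built one coordinate at a time, and over k itself the equation for the next
  coordinate need not have a root.\<close>

definition monom_eval :: "(nat \<Rightarrow> 'r::comm_monoid_mult) \<Rightarrow> (nat \<Rightarrow>\<^sub>0 nat) \<Rightarrow> 'r" where
  "monom_eval \<phi> m = (\<Prod>j \<in> Poly_Mapping.keys m. \<phi> j ^ Poly_Mapping.lookup m j)"

text \<open>The coefficient map is a parameter because several targets occur: the polynomial ring
  itself, polynomials in a shift variable over it, an algebraic closure of the field, and univariate
  polynomials over that closure.\<close>

definition mpol_eval :: "('k::field \<Rightarrow> 'r::comm_ring_1) \<Rightarrow> (nat \<Rightarrow> 'r) \<Rightarrow> 'k mpol \<Rightarrow> 'r" where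
  "mpol_eval \<iota> \<phi> f = (\<Sum>m \<in> Poly_Mapping.keys f. \<iota> (Poly_Mapping.lookup f m) * monom_eval \<phi> m)"

lemma monom_eval_superset:
  assumes "finite A" "Poly_Mapping.keys m \<subseteq> A"
  shows "monom_eval \<phi> m = (\<Prod>j \<in> A. \<phi> j ^ Poly_Mapping.lookup m j)"
  unfolding monom_eval_def
  by (rule prod.mono_neutral_left) (use assms in \<open>auto simp: in_keys_iff\<close>)

lemma monom_eval_0 [simp]: "monom_eval \<phi> 0 = 1"
  by (simp add: monom_eval_def)

lemma monom_eval_single [simp]: "monom_eval \<phi> (Poly_Mapping.single j a) = \<phi> j ^ a"
  by (cases "a = 0") (simp_all add: monom_eval_def)

lemma monom_eval_add: "monom_eval \<phi> (m + m') = monom_eval \<phi> m * monom_eval \<phi> m'"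
proof -
  let ?A = "Poly_Mapping.keys m \<union> Poly_Mapping.keys m'"
  have "Poly_Mapping.keys (m + m') \<subseteq> ?A" by (rule keys_add)
  then show ?thesis
    by (simp add: monom_eval_superset[of ?A] lookup_add power_add prod.distrib)
qed

lemma poly_mapping_sum_single:
  "f = (\<Sum>m \<in> Poly_Mapping.keys f. Poly_Mapping.single m (Poly_Mapping.lookup f m))"
  by (rule poly_mapping_eqI) (simp add: lookup_sum lookup_single when_def in_keys_iff)

lemma mpol_const_0 [simp]: "mpol_const 0 = 0" and mpol_const_1 [simp]: "mpol_const 1 = 1"
  by (simp_all add: mpol_const_def)

lemma mpol_const_add: "mpol_const (a + b) = mpol_const a + mpol_const b"
  by (simp add: mpol_const_def single_add)

lemma mpol_const_mult: "mpol_const (a * b) = mpol_const a * mpol_const b"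
  by (simp add: mpol_const_def mult_single)

lemma mpol_const_mult_single:
  "mpol_const c * Poly_Mapping.single m d = Poly_Mapping.single m (c * d)"
  by (simp add: mpol_const_def mult_single)

lemma mpol_var_power: "mpol_var j ^ a = Poly_Mapping.single (Poly_Mapping.single j a) 1"
  by (induction a) (simp_all add: mpol_var_def mult_single single_add[symmetric])

lemma monom_eval_var: "monom_eval mpol_var m = Poly_Mapping.single m (1 :: 'k::field)"
proof -
  have "(\<Prod>j\<in>A. mpol_var j ^ Poly_Mapping.lookup m j) =
      Poly_Mapping.single (\<Sum>j\<in>A. Poly_Mapping.single j (Poly_Mapping.lookup m j)) (1 :: 'k)"
    if "finite A" for A
    using that by (induction A) (simp_all add: mpol_var_power mult_single)
  then show ?thesis
    unfolding monom_eval_def by (simp flip: poly_mapping_sum_single)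
qed

lemma lookup_const_mult: "Poly_Mapping.lookup (mpol_const c * f) m = c * Poly_Mapping.lookup f m"
  by (simp add: mpol_const_def mult_map_scale_conv_mult[symmetric] Poly_Mapping.map.rep_eq when_def)

lemma lookup_mult_single_add:
  fixes f :: "'k::field mpol"
  shows "Poly_Mapping.lookup (f * Poly_Mapping.single m c) (m' + m) = Poly_Mapping.lookup f m' * c"
proof -
  have "f * Poly_Mapping.single m c =
     (\<Sum>k\<in>Poly_Mapping.keys f. Poly_Mapping.single (k + m) (Poly_Mapping.lookup f k * c))"
    by (subst poly_mapping_sum_single[of f]) (simp add: sum_distrib_right mult_single)
  then show ?thesis
    by (simp add: lookup_sum lookup_single when_def in_keys_iff)
qed

locale coeff_hom =
  fixes \<iota> :: "'k::field \<Rightarrow> 'r::comm_ring_1"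
  assumes hom_0 [simp]: "\<iota> 0 = 0" and hom_1 [simp]: "\<iota> 1 = 1"
    and hom_add: "\<iota> (a + b) = \<iota> a + \<iota> b"
    and hom_mult: "\<iota> (a * b) = \<iota> a * \<iota> b"
begin

lemma eval_superset:
  assumes "finite A" "Poly_Mapping.keys f \<subseteq> A"
  shows "mpol_eval \<iota> \<phi> f = (\<Sum>m \<in> A. \<iota> (Poly_Mapping.lookup f m) * monom_eval \<phi> m)"
  unfolding mpol_eval_def
  by (rule sum.mono_neutral_left) (use assms in \<open>auto simp: in_keys_iff\<close>)

lemma eval_0 [simp]: "mpol_eval \<iota> \<phi> 0 = 0"
  by (simp add: mpol_eval_def)

lemma eval_single [simp]: "mpol_eval \<iota> \<phi> (Poly_Mapping.single m c) = \<iota> c * monom_eval \<phi> m"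
  by (cases "c = 0") (simp_all add: mpol_eval_def)

lemma eval_add: "mpol_eval \<iota> \<phi> (f + g) = mpol_eval \<iota> \<phi> f + mpol_eval \<iota> \<phi> g"
proof -
  let ?A = "Poly_Mapping.keys f \<union> Poly_Mapping.keys g"
  have "Poly_Mapping.keys (f + g) \<subseteq> ?A" by (rule keys_add)
  then show ?thesis
    by (simp add: eval_superset[of ?A] lookup_add hom_add distrib_right sum.distrib)
qed

lemma eval_uminus: "mpol_eval \<iota> \<phi> (- f) = - mpol_eval \<iota> \<phi> f"
  using eval_add[of \<phi> f "- f"] by (simp add: eq_neg_iff_add_eq_0 add.commute)

lemma eval_diff: "mpol_eval \<iota> \<phi> (f - g) = mpol_eval \<iota> \<phi> f - mpol_eval \<iota> \<phi> g"
  using eval_add[of \<phi> f "- g"] by (simp add: eval_uminus)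

lemma eval_sum: "mpol_eval \<iota> \<phi> (sum F A) = (\<Sum>a\<in>A. mpol_eval \<iota> \<phi> (F a))"
  by (induction A rule: infinite_finite_induct) (simp_all add: eval_add)

lemma eval_mult: "mpol_eval \<iota> \<phi> (f * g) = mpol_eval \<iota> \<phi> f * mpol_eval \<iota> \<phi> g"
proof -
  have "f * g = (\<Sum>m\<in>Poly_Mapping.keys f. \<Sum>m'\<in>Poly_Mapping.keys g.
      Poly_Mapping.single (m + m') (Poly_Mapping.lookup f m * Poly_Mapping.lookup g m'))"
    by (subst (1) poly_mapping_sum_single[of f], subst (1) poly_mapping_sum_single[of g])
       (simp add: sum_product mult_single)
  then show ?thesis
    by (simp add: eval_sum mpol_eval_def[of _ _ f] mpol_eval_def[of _ _ g] sum_product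
        hom_mult monom_eval_add mult_ac)
qed

lemma eval_const [simp]: "mpol_eval \<iota> \<phi> (mpol_const c) = \<iota> c"
  by (simp add: mpol_const_def)

lemma eval_1 [simp]: "mpol_eval \<iota> \<phi> 1 = 1"
  using eval_const[of \<phi> 1] by simp

lemma eval_var [simp]: "mpol_eval \<iota> \<phi> (mpol_var j) = \<phi> j"
  by (simp add: mpol_var_def)

lemma eval_power: "mpol_eval \<iota> \<phi> (f ^ a) = mpol_eval \<iota> \<phi> f ^ a"
  by (induction a) (simp_all add: eval_mult)

lemma eval_prod: "mpol_eval \<iota> \<phi> (prod F A) = (\<Prod>a\<in>A. mpol_eval \<iota> \<phi> (F a))"
  by (induction A rule: infinite_finite_induct) (simp_all add: eval_mult)

end

text \<open>Universal property of the polynomial ring: constants and variables generate it, so their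
  images determine a ring homomorphism.\<close>

lemma hom_eq_mpol_eval:
  fixes h :: "'k::field mpol \<Rightarrow> 'r::comm_ring_1"
  assumes add: "\<And>f g. h (f + g) = h f + h g" and mult: "\<And>f g. h (f * g) = h f * h g"
    and one: "h 1 = 1"
  shows "h f = mpol_eval (\<lambda>c. h (mpol_const c)) (\<lambda>j. h (mpol_var j)) f"
proof -
  have zero: "h 0 = 0" using add[of 0 0] by simp
  have sum: "h (sum F A) = (\<Sum>a\<in>A. h (F a))" for F and A :: "'b set"
    by (induction A rule: infinite_finite_induct) (simp_all add: zero add)
  have power: "h (g ^ a) = h g ^ a" for g a by (induction a) (simp_all add: one mult)
  have prod: "h (prod F A) = (\<Prod>a\<in>A. h (F a))" for F and A :: "nat set"
    by (induction A rule: infinite_finite_induct) (simp_all add: one mult)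
  have "f = (\<Sum>m\<in>Poly_Mapping.keys f. mpol_const (Poly_Mapping.lookup f m) * monom_eval mpol_var m)"
    by (subst poly_mapping_sum_single) (simp add: monom_eval_var mpol_const_mult_single)
  then have "h f = h (\<Sum>m\<in>Poly_Mapping.keys f. mpol_const (Poly_Mapping.lookup f m) * monom_eval mpol_var m)"
    by simp
  also have "\<dots> = mpol_eval (\<lambda>c. h (mpol_const c)) (\<lambda>j. h (mpol_var j)) f"
    by (simp add: sum mult mpol_eval_def monom_eval_def prod power)
  finally show ?thesis .
qed

section \<open>Polynomials in a prescribed set of variables\<close>

definition polys_in :: "nat set \<Rightarrow> 'k::field mpol set" where
  "polys_in V = {f. \<forall>m \<in> Poly_Mapping.keys f. Poly_Mapping.keys m \<subseteq> V}"

lemma polys_upto_eq: "polys_upto n = polys_in {1..n}"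
  by (simp add: polys_upto_def polys_in_def)

lemma mpol_eval_cong:
  assumes "f \<in> polys_in V" "\<And>j. j \<in> V \<Longrightarrow> \<phi> j = \<psi> j"
  shows "mpol_eval \<iota> \<phi> f = mpol_eval \<iota> \<psi> f"
  unfolding mpol_eval_def
proof (rule sum.cong[OF refl])
  fix m assume "m \<in> Poly_Mapping.keys f"
  then have "Poly_Mapping.keys m \<subseteq> V" using assms by (auto simp: polys_in_def)
  then have "monom_eval \<phi> m = monom_eval \<psi> m"
    unfolding monom_eval_def using assms(2) by (intro prod.cong) auto
  then show "\<iota> (Poly_Mapping.lookup f m) * monom_eval \<phi> m = \<iota> (Poly_Mapping.lookup f m) * monom_eval \<psi> m"
    by simp
qed

text \<open>Reduces an identity between composite substitutions to the variables. Agreement is asked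
  only on \<open>V\<close>, because the group action is controlled only at the indices of actual
  variables.\<close>

lemma hom_eqI:
  fixes h h' :: "'k::field mpol \<Rightarrow> 'r::comm_ring_1"
  assumes "\<And>f g. h (f + g) = h f + h g" "\<And>f g. h (f * g) = h f * h g" "h 1 = 1"
    and "\<And>f g. h' (f + g) = h' f + h' g" "\<And>f g. h' (f * g) = h' f * h' g" "h' 1 = 1"
    and "\<And>c. h (mpol_const c) = h' (mpol_const c)"
    and "\<And>j. j \<in> V \<Longrightarrow> h (mpol_var j) = h' (mpol_var j)"
    and "f \<in> polys_in V"
  shows "h f = h' f"
proof -
  have "h f = mpol_eval (\<lambda>c. h (mpol_const c)) (\<lambda>j. h (mpol_var j)) f"
    by (rule hom_eq_mpol_eval) fact+
  also have "\<dots> = mpol_eval (\<lambda>c. h' (mpol_const c)) (\<lambda>j. h' (mpol_var j)) f"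
    using assms(7,8) by (auto intro!: mpol_eval_cong[OF assms(9)])
  also have "\<dots> = h' f"
    by (rule hom_eq_mpol_eval[symmetric]) fact+
  finally show ?thesis .
qed

lemma polys_in_mono: "f \<in> polys_in V \<Longrightarrow> V \<subseteq> W \<Longrightarrow> f \<in> polys_in W"
  by (auto simp: polys_in_def)

lemma polys_in_0 [simp]: "0 \<in> polys_in V" and polys_in_1 [simp]: "1 \<in> polys_in V"
  by (simp_all add: polys_in_def)

lemma polys_in_const [simp]: "mpol_const c \<in> polys_in V"
  by (simp add: polys_in_def mpol_const_def)

lemma polys_in_single: "Poly_Mapping.keys m \<subseteq> V \<Longrightarrow> Poly_Mapping.single m c \<in> polys_in V"
  by (simp add: polys_in_def)

lemma polys_in_var [simp]: "j \<in> V \<Longrightarrow> mpol_var j \<in> polys_in V"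
  by (simp add: polys_in_def mpol_var_def)

lemma polys_in_add: "f \<in> polys_in V \<Longrightarrow> g \<in> polys_in V \<Longrightarrow> f + g \<in> polys_in V"
  using keys_add[of f g] by (auto simp: polys_in_def)

lemma polys_in_uminus: "f \<in> polys_in V \<Longrightarrow> - f \<in> polys_in V"
  by (simp add: polys_in_def in_keys_iff)

lemma polys_in_diff: "f \<in> polys_in V \<Longrightarrow> g \<in> polys_in V \<Longrightarrow> f - g \<in> polys_in V"
  using polys_in_add[of f V "- g"] polys_in_uminus by fastforce

lemma polys_in_mult:
  assumes "f \<in> polys_in V" "g \<in> polys_in V"
  shows "f * g \<in> polys_in V"
  unfolding polys_in_def
proof (intro CollectI ballI)
  fix m assume "m \<in> Poly_Mapping.keys (f * g)"
  then obtain a b where ab: "m = a + b" "a \<in> Poly_Mapping.keys f" "b \<in> Poly_Mapping.keys g"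
    using keys_mult[of f g] by blast
  then have "Poly_Mapping.keys a \<subseteq> V" "Poly_Mapping.keys b \<subseteq> V"
    using assms by (auto simp: polys_in_def)
  then show "Poly_Mapping.keys m \<subseteq> V"
    using keys_add[of a b] ab(1) by blast
qed

lemma polys_in_sum: "(\<And>a. a \<in> A \<Longrightarrow> F a \<in> polys_in V) \<Longrightarrow> sum F A \<in> polys_in V"
  by (induction A rule: infinite_finite_induct) (auto intro: polys_in_add)

lemma polys_in_prod: "(\<And>a. a \<in> A \<Longrightarrow> F a \<in> polys_in V) \<Longrightarrow> prod F A \<in> polys_in V"
  by (induction A rule: infinite_finite_induct) (auto intro: polys_in_mult)

lemma polys_in_power: "f \<in> polys_in V \<Longrightarrow> f ^ a \<in> polys_in V"
  by (induction a) (auto intro: polys_in_mult)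

section \<open>Degrees of monomials and homogeneous polynomials\<close>

lemma mon_degree_superset:
  assumes "finite A" "Poly_Mapping.keys m \<subseteq> A"
  shows "mon_degree m = (\<Sum>j \<in> A. Poly_Mapping.lookup m j)"
  unfolding mon_degree_def
  by (rule sum.mono_neutral_left) (use assms in \<open>auto simp: in_keys_iff\<close>)

lemma mon_degree_0 [simp]: "mon_degree 0 = 0"
  by (simp add: mon_degree_def)

lemma mon_degree_single [simp]: "mon_degree (Poly_Mapping.single j a) = a"
  by (cases "a = 0") (simp_all add: mon_degree_def)

lemma mon_degree_add: "mon_degree (m + m') = mon_degree m + mon_degree m'"
proof -
  let ?A = "Poly_Mapping.keys m \<union> Poly_Mapping.keys m'"
  have "Poly_Mapping.keys (m + m') \<subseteq> ?A" by (rule keys_add)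
  then show ?thesis
    by (simp add: mon_degree_superset[of ?A] lookup_add sum.distrib)
qed

lemma lookup_le_mon_degree: "Poly_Mapping.lookup m j \<le> mon_degree m"
  unfolding mon_degree_def
  by (cases "j \<in> Poly_Mapping.keys m") (auto intro: member_le_sum simp: in_keys_iff)

lemma mon_degree_eq_0_iff: "mon_degree m = 0 \<longleftrightarrow> m = 0"
  by (auto simp: mon_degree_def in_keys_iff) (metis keys_eq_empty ex_in_conv in_keys_iff)

lemma homogeneous_0 [simp]: "homogeneous_of_degree d 0"
  by (simp add: homogeneous_of_degree_def)

lemma homogeneous_1: "homogeneous_of_degree 0 1"
  by (simp add: homogeneous_of_degree_def)

lemma homogeneous_const: "homogeneous_of_degree 0 (mpol_const c)"
  by (simp add: homogeneous_of_degree_def mpol_const_def)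

lemma homogeneous_single: "homogeneous_of_degree (mon_degree m) (Poly_Mapping.single m c)"
  by (simp add: homogeneous_of_degree_def)

lemma homogeneous_var: "homogeneous_of_degree 1 (mpol_var j)"
  by (simp add: homogeneous_of_degree_def mpol_var_def)

lemma homogeneous_add:
  "homogeneous_of_degree d f \<Longrightarrow> homogeneous_of_degree d g \<Longrightarrow> homogeneous_of_degree d (f + g)"
  using keys_add[of f g] by (auto simp: homogeneous_of_degree_def)

lemma homogeneous_uminus: "homogeneous_of_degree d f \<Longrightarrow> homogeneous_of_degree d (- f)"
  by (simp add: homogeneous_of_degree_def in_keys_iff)

lemma homogeneous_diff:
  "homogeneous_of_degree d f \<Longrightarrow> homogeneous_of_degree d g \<Longrightarrow> homogeneous_of_degree d (f - g)"
  using homogeneous_add[of d f "- g"] homogeneous_uminus by fastforce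

lemma homogeneous_mult:
  assumes "homogeneous_of_degree d f" "homogeneous_of_degree d' g"
  shows "homogeneous_of_degree (d + d') (f * g)"
  unfolding homogeneous_of_degree_def
proof
  fix m assume "m \<in> Poly_Mapping.keys (f * g)"
  then obtain a b where "m = a + b" "a \<in> Poly_Mapping.keys f" "b \<in> Poly_Mapping.keys g"
    using keys_mult[of f g] by blast
  then show "mon_degree m = d + d'"
    using assms by (simp add: homogeneous_of_degree_def mon_degree_add)
qed

lemma homogeneous_sum:
  "(\<And>a. a \<in> A \<Longrightarrow> homogeneous_of_degree d (F a)) \<Longrightarrow> homogeneous_of_degree d (sum F A)"
  by (induction A rule: infinite_finite_induct) (auto intro: homogeneous_add)

lemma homogeneous_prod:
  "(\<And>a. a \<in> A \<Longrightarrow> homogeneous_of_degree (d a) (F a)) \<Longrightarrow> homogeneous_of_degree (sum d A) (prod F A)"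
  by (induction A rule: infinite_finite_induct) (auto intro: homogeneous_mult homogeneous_1)

lemma homogeneous_power:
  "homogeneous_of_degree d f \<Longrightarrow> homogeneous_of_degree (a * d) (f ^ a)"
  by (induction a) (auto intro: homogeneous_mult homogeneous_1)

section \<open>Substitution endomorphisms\<close>

interpretation mpol_const_hom: coeff_hom mpol_const
  by standard (simp_all add: mpol_const_add mpol_const_mult)

abbreviation mpol_subst :: "(nat \<Rightarrow> 'k::field mpol) \<Rightarrow> 'k mpol \<Rightarrow> 'k mpol" where
  "mpol_subst \<equiv> mpol_eval mpol_const"

lemma mpol_subst_var: "mpol_subst mpol_var f = f"
  unfolding mpol_eval_def monom_eval_var mpol_const_mult_single
  by (simp flip: poly_mapping_sum_single)

lemma mpol_subst_fixes:
  assumes "f \<in> polys_in V" "\<And>j. j \<in> V \<Longrightarrow> \<phi> j = mpol_var j"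
  shows "mpol_subst \<phi> f = f"
  using mpol_eval_cong[OF assms(1), of \<phi> mpol_var mpol_const] assms(2) by (simp add: mpol_subst_var)

lemma polys_in_subst:
  assumes "f \<in> polys_in V" "\<And>j. j \<in> V \<Longrightarrow> \<phi> j \<in> polys_in W"
  shows "mpol_subst \<phi> f \<in> polys_in W"
  unfolding mpol_eval_def monom_eval_def
  by (intro polys_in_sum polys_in_mult polys_in_prod polys_in_power polys_in_const assms(2))
    (use assms(1) in \<open>auto simp: polys_in_def\<close>)

lemma homogeneous_subst:
  assumes "f \<in> polys_in V" "\<And>j. j \<in> V \<Longrightarrow> homogeneous_of_degree 1 (\<phi> j)"
    and "homogeneous_of_degree d f"
  shows "homogeneous_of_degree d (mpol_subst \<phi> f)"
  unfolding mpol_eval_def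
proof (rule homogeneous_sum)
  fix m assume m: "m \<in> Poly_Mapping.keys f"
  have "homogeneous_of_degree (\<Sum>j\<in>Poly_Mapping.keys m. Poly_Mapping.lookup m j * 1) (monom_eval \<phi> m)"
    unfolding monom_eval_def
    using assms m by (intro homogeneous_prod homogeneous_power) (auto simp: polys_in_def)
  moreover have "(\<Sum>j\<in>Poly_Mapping.keys m. Poly_Mapping.lookup m j * 1) = d"
    using assms(3) m by (simp add: homogeneous_of_degree_def mon_degree_def)
  ultimately show "homogeneous_of_degree d (mpol_const (Poly_Mapping.lookup f m) * monom_eval \<phi> m)"
    using homogeneous_mult[OF homogeneous_const] by (metis add_0)
qed

section \<open>Setting variables to zero and Hasse derivatives\<close>

definition restrict_vars :: "nat set \<Rightarrow> 'k::field mpol \<Rightarrow> 'k mpol" where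
  "restrict_vars L = mpol_subst (\<lambda>j. if j \<in> L then mpol_var j else 0)"

lemma restrict_vars_single:
  "restrict_vars L (Poly_Mapping.single m c) =
     (if Poly_Mapping.keys m \<subseteq> L then Poly_Mapping.single m c else 0)"
proof (cases "Poly_Mapping.keys m \<subseteq> L")
  case True
  then show ?thesis
    unfolding restrict_vars_def using mpol_subst_fixes[OF polys_in_single[of m L c]] by simp
next
  case False
  then have "monom_eval (\<lambda>j. if j \<in> L then mpol_var j else 0 :: 'a mpol) m = 0"
    unfolding monom_eval_def by (auto simp: in_keys_iff prod_zero_iff)
  then show ?thesis using False by (simp add: restrict_vars_def)
qed

text \<open>Complements the description as a substitution: that one gives multiplicativity, while
  deleting monomials makes degrees and coefficients easy to follow.\<close>

lemma lookup_restrict_vars: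
  "Poly_Mapping.lookup (restrict_vars L f) m =
     (if Poly_Mapping.keys m \<subseteq> L then Poly_Mapping.lookup f m else 0)"
proof -
  have "restrict_vars L f =
      (\<Sum>k\<in>Poly_Mapping.keys f. restrict_vars L (Poly_Mapping.single k (Poly_Mapping.lookup f k)))"
    unfolding restrict_vars_def mpol_const_hom.eval_sum[symmetric] poly_mapping_sum_single[symmetric] ..
  also have "Poly_Mapping.lookup \<dots> m = (\<Sum>k\<in>Poly_Mapping.keys f.
      if k = m then (if Poly_Mapping.keys m \<subseteq> L then Poly_Mapping.lookup f m else 0) else 0)"
    unfolding lookup_sum by (rule sum.cong) (auto simp: restrict_vars_single lookup_single when_def)
  finally show ?thesis by (simp add: in_keys_iff)
qed

lemma polys_in_restrict_vars: "f \<in> polys_in V \<Longrightarrow> restrict_vars L f \<in> polys_in (V \<inter> L)"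
  by (auto simp: polys_in_def in_keys_iff[of _ "restrict_vars L f"] in_keys_iff[of _ f]
      lookup_restrict_vars split: if_splits)

lemma homogeneous_restrict_vars:
  "homogeneous_of_degree d f \<Longrightarrow> homogeneous_of_degree d (restrict_vars L f)"
  by (auto simp: homogeneous_of_degree_def in_keys_iff lookup_restrict_vars split: if_splits)

text \<open>The substitution \<open>x\<^sub>j \<mapsto> x\<^sub>j + t\<close>, whose coefficient at \<open>t\<^sup>b\<close> is the
  \<open>b\<close>-th Hasse derivative with respect to \<open>x\<^sub>j\<close>.\<close>

definition taylor_shift :: "nat \<Rightarrow> 'k::field mpol \<Rightarrow> 'k mpol poly" where
  "taylor_shift j = mpol_eval (\<lambda>c. [:mpol_const c:])
     (\<lambda>i. if i = j then [:mpol_var j, 1:] else [:mpol_var i:])"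

definition hasse :: "nat \<Rightarrow> nat \<Rightarrow> 'k::field mpol \<Rightarrow> 'k mpol" where
  "hasse j b f = Polynomial.coeff (taylor_shift j f) b"

interpretation const_poly_hom: coeff_hom "\<lambda>c. [:mpol_const c:]"
  by standard (simp_all add: mpol_const_add mpol_const_mult one_pCons)

lemma taylor_shift_const_poly:
  assumes "f \<in> polys_in V" "j \<notin> V"
  shows "taylor_shift j f = [:f:]"
proof (rule hom_eqI[OF _ _ _ _ _ _ _ _ assms(1)])
  fix i assume "i \<in> V"
  then show "taylor_shift j (mpol_var i) = [:mpol_var i:]"
    using assms(2) by (auto simp: taylor_shift_def)
qed (simp_all add: taylor_shift_def const_poly_hom.eval_add const_poly_hom.eval_mult one_pCons)

text \<open>Once the full power of x_j is split off, the rest of the monomial is unaffected by the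
  shift, and the binomial theorem expands the remaining power.\<close>

lemma hasse_single:
  "hasse j b (Poly_Mapping.single m (c::'k::field)) =
    (if b \<le> Poly_Mapping.lookup m j
     then Poly_Mapping.single (m - Poly_Mapping.single j b) (of_nat (Poly_Mapping.lookup m j choose b) * c)
     else 0)"
proof -
  define a where "a = Poly_Mapping.lookup m j"
  define m' where "m' = m - Poly_Mapping.single j a"
  have m: "m = m' + Poly_Mapping.single j a"
    by (rule poly_mapping_eqI) (auto simp: m'_def a_def lookup_add lookup_minus lookup_single when_def)
  have j: "j \<notin> Poly_Mapping.keys m'"
    by (simp add: m'_def a_def in_keys_iff lookup_minus)
  have "taylor_shift j (Poly_Mapping.single m c) =
      taylor_shift j (Poly_Mapping.single m' c) * taylor_shift j (mpol_var j ^ a)"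
    unfolding m by (simp add: taylor_shift_def mpol_var_power monom_eval_add)
  also have "taylor_shift j (Poly_Mapping.single m' c) = [:Poly_Mapping.single m' c:]"
    by (rule taylor_shift_const_poly[OF polys_in_single[OF order_refl] j])
  also have "taylor_shift j (mpol_var j ^ a) = [:mpol_var j, 1 :: 'k mpol:] ^ a"
    by (simp add: taylor_shift_def const_poly_hom.eval_power)
  finally have eq: "hasse j b (Poly_Mapping.single m c) =
      Poly_Mapping.single m' c * Polynomial.coeff ([:mpol_var j, 1 :: 'k mpol:] ^ a) b"
    by (simp add: hasse_def)
  show ?thesis
  proof (cases "b \<le> a")
    case True
    have "m' + Poly_Mapping.single j (a - b) = m - Poly_Mapping.single j b"
      by (rule poly_mapping_eqI) (use True in \<open>auto simp: m lookup_add lookup_minus lookup_single when_def\<close>)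
    moreover have "Polynomial.coeff ([:mpol_var j, 1 :: 'k mpol:] ^ a) b =
        mpol_const (of_nat (a choose b)) * mpol_var j ^ (a - b)"
      using True by (simp add: coeff_linear_poly_power mpol_const_def)
    ultimately show ?thesis
      using True unfolding eq
      by (simp add: mpol_var_power mpol_const_mult_single mult_single a_def[symmetric] mult.commute)
  next
    case False
    have "degree ([:mpol_var j, 1 :: 'k mpol:] ^ a) \<le> degree [:mpol_var j, 1 :: 'k mpol:] * a"
      by (rule degree_power_le)
    then have "Polynomial.coeff ([:mpol_var j, 1 :: 'k mpol:] ^ a) b = 0"
      using False by (intro coeff_eq_0) simp
    then show ?thesis using False by (simp add: eq a_def)
  qed
qed

lemma hasse_sum: "hasse j b (sum F A) = (\<Sum>a\<in>A. hasse j b (F a))"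
  by (simp add: hasse_def taylor_shift_def const_poly_hom.eval_sum coeff_sum)

text \<open>Read at the target monomial, the formula is free of truncated subtraction. The binomial
  equals 1 whenever x_j does not occur in \<open>m\<close>, so these coefficients survive in every
  characteristic.\<close>

lemma lookup_hasse:
  "Poly_Mapping.lookup (hasse j b f) m =
     of_nat (Poly_Mapping.lookup m j + b choose b) * Poly_Mapping.lookup f (m + Poly_Mapping.single j b)"
proof -
  let ?m = "m + Poly_Mapping.single j b"
  have eq: "b \<le> Poly_Mapping.lookup k j \<and> k - Poly_Mapping.single j b = m \<longleftrightarrow> k = ?m" for k
  proof
    assume k: "b \<le> Poly_Mapping.lookup k j \<and> k - Poly_Mapping.single j b = m"
    show "k = ?m"
      by (rule poly_mapping_eqI) (use k in \<open>auto simp: lookup_add lookup_minus lookup_single when_def\<close>)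
  qed (simp add: lookup_add)
  have "hasse j b f = (\<Sum>k\<in>Poly_Mapping.keys f. hasse j b (Poly_Mapping.single k (Poly_Mapping.lookup f k)))"
    by (subst poly_mapping_sum_single[of f]) (rule hasse_sum)
  then have "Poly_Mapping.lookup (hasse j b f) m = (\<Sum>k\<in>Poly_Mapping.keys f.
      if k = ?m then of_nat (Poly_Mapping.lookup k j choose b) * Poly_Mapping.lookup f k else 0)"
    unfolding lookup_sum
    by (auto simp: hasse_single lookup_single when_def lookup_sum eq[symmetric] intro!: sum.cong)
  then show ?thesis by (auto simp: in_keys_iff lookup_add)
qed

section \<open>Subalgebras closed under Hasse derivatives\<close>

text \<open>For \<open>N\<close> above the degrees involved, comparing weights means comparing exponents
  lexicographically, starting from the variable of highest index.\<close>

definition mon_weight :: "nat \<Rightarrow> (nat \<Rightarrow>\<^sub>0 nat) \<Rightarrow> nat" where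
  "mon_weight N m = (\<Sum>j \<in> Poly_Mapping.keys m. Poly_Mapping.lookup m j * N ^ j)"

lemma mon_weight_superset:
  assumes "finite A" "Poly_Mapping.keys m \<subseteq> A"
  shows "mon_weight N m = (\<Sum>j \<in> A. Poly_Mapping.lookup m j * N ^ j)"
  unfolding mon_weight_def
  by (rule sum.mono_neutral_left) (use assms in \<open>auto simp: in_keys_iff\<close>)

lemma mon_weight_add: "mon_weight N (m + m') = mon_weight N m + mon_weight N m'"
proof -
  let ?A = "Poly_Mapping.keys m \<union> Poly_Mapping.keys m'"
  have "Poly_Mapping.keys (m + m') \<subseteq> ?A" by (rule keys_add)
  then show ?thesis
    by (simp add: mon_weight_superset[of ?A] lookup_add sum.distrib algebra_simps)
qed

text \<open>Place-value comparison in base \<open>N\<close>: the exponents of \<open>m\<close> below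
  j add up to less than \<open>N\<close> and hence contribute less than one unit of
  \<open>N ^ j\<close>, whereas \<open>m'\<close> has at least one such unit more.\<close>

lemma mon_weight_less:
  assumes deg: "mon_degree m < N"
    and j: "Poly_Mapping.lookup m j < Poly_Mapping.lookup m' j"
    and above: "\<And>i. i > j \<Longrightarrow> Poly_Mapping.lookup m i = Poly_Mapping.lookup m' i"
  shows "mon_weight N m < mon_weight N m'"
proof -
  let ?A = "Poly_Mapping.keys m \<union> Poly_Mapping.keys m'"
  let ?Lo = "{i \<in> ?A. i < j}" and ?Hi = "{i \<in> ?A. i > j}"
  let ?s = "\<lambda>m C. (\<Sum>i\<in>C. Poly_Mapping.lookup m i * N ^ i)"
  have jA: "j \<in> ?A" using j by (auto simp: in_keys_iff)
  have split: "?s k ?A = ?s k ?Lo + Poly_Mapping.lookup k j * N ^ j + ?s k ?Hi" for k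
  proof -
    have "?A = ?Lo \<union> ({j} \<union> ?Hi)" using jA by auto
    then have "?s k ?A = ?s k (?Lo \<union> ({j} \<union> ?Hi))" by (rule arg_cong)
    also have "\<dots> = ?s k ?Lo + ?s k ({j} \<union> ?Hi)" by (rule sum.union_disjoint) auto
    also have "?s k ({j} \<union> ?Hi) = Poly_Mapping.lookup k j * N ^ j + ?s k ?Hi"
      by (subst sum.union_disjoint) auto
    finally show ?thesis by simp
  qed
  \<comment> \<open>The extra factor \<open>N\<close> stands in for a bound by the power j - 1,
    which would be truncated at j = 0.\<close>
  have "?s m ?Lo * N \<le> (\<Sum>i\<in>?Lo. Poly_Mapping.lookup m i * N ^ j)"
    unfolding sum_distrib_right
  proof (rule sum_mono)
    fix i assume "i \<in> ?Lo"
    then have "N ^ Suc i \<le> N ^ j" using deg by (intro power_increasing) auto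
    then show "Poly_Mapping.lookup m i * N ^ i * N \<le> Poly_Mapping.lookup m i * N ^ j"
      by (simp add: mult.commute mult.left_commute)
  qed
  also have "\<dots> \<le> mon_degree m * N ^ j"
    unfolding sum_distrib_right[symmetric] mon_degree_superset[of ?A m, simplified]
    by (intro mult_right_mono sum_mono2) auto
  also have "\<dots> < N ^ j * N" using deg by simp
  finally have "?s m ?Lo < N ^ j" by simp
  then have "?s m ?Lo + Poly_Mapping.lookup m j * N ^ j < (Poly_Mapping.lookup m j + 1) * N ^ j"
    by simp
  also have "\<dots> \<le> Poly_Mapping.lookup m' j * N ^ j"
    by (rule mult_right_mono) (use j in auto)
  finally have "?s m ?A < ?s m' ?A"
    using above unfolding split by simp
  then show ?thesis by (simp add: mon_weight_superset[of ?A])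
qed

text \<open>The largest index at which the exponents differ decides which weight is larger.\<close>

lemma mon_weight_inj:
  assumes "mon_degree m < N" "mon_degree m' < N" "mon_weight N m = mon_weight N m'"
  shows "m = m'"
proof (rule ccontr)
  assume "m \<noteq> m'"
  let ?D = "{i. Poly_Mapping.lookup m i \<noteq> Poly_Mapping.lookup m' i}"
  have fin: "finite ?D"
    by (rule finite_subset[of _ "Poly_Mapping.keys m \<union> Poly_Mapping.keys m'"]) (auto simp: in_keys_iff)
  have "?D \<noteq> {}" using \<open>m \<noteq> m'\<close> by (auto intro: poly_mapping_eqI)
  with fin have "Max ?D \<in> ?D" by (rule Max_in)
  moreover have "Poly_Mapping.lookup m i = Poly_Mapping.lookup m' i" if "i > Max ?D" for i
    using fin that by (metis (mono_tags, lifting) Max_ge leD mem_Collect_eq)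
  ultimately show False
    using mon_weight_less[of m N "Max ?D" m'] mon_weight_less[of m' N "Max ?D" m] assms
    by (metis (mono_tags, lifting) mem_Collect_eq nat_neq_iff)
qed

section \<open>Leading monomials with respect to the weight\<close>

definition below :: "nat \<Rightarrow> nat \<Rightarrow> 'k::field mpol \<Rightarrow> bool" where
  "below N w f \<longleftrightarrow> (\<forall>m \<in> Poly_Mapping.keys f. mon_weight N m < w)"

text \<open>A decomposition with a strictly lighter remainder replaces a monomial order, since the
  weight separates monomials only up to a degree bound.\<close>

definition leads :: "nat \<Rightarrow> (nat \<Rightarrow>\<^sub>0 nat) \<Rightarrow> 'k::field mpol \<Rightarrow> bool" where
  "leads N m f \<longleftrightarrow> (\<exists>c f'. c \<noteq> 0 \<and> f = Poly_Mapping.single m c + f' \<and> below N (mon_weight N m) f')"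

lemma below_add: "below N w f \<Longrightarrow> below N w g \<Longrightarrow> below N w (f + g)"
  using keys_add[of f g] by (auto simp: below_def)

lemma below_mult:
  assumes "\<And>a b. a \<in> Poly_Mapping.keys f \<Longrightarrow> b \<in> Poly_Mapping.keys g \<Longrightarrow> mon_weight N a + mon_weight N b < w"
  shows "below N w (f * g)"
  unfolding below_def
proof
  fix m assume "m \<in> Poly_Mapping.keys (f * g)"
  then obtain a b where "m = a + b" "a \<in> Poly_Mapping.keys f" "b \<in> Poly_Mapping.keys g"
    using keys_mult[of f g] by blast
  then show "mon_weight N m < w" using assms by (simp add: mon_weight_add)
qed

lemma leads_1: "leads N 0 1"
  unfolding leads_def by (rule exI[of _ 1], rule exI[of _ 0]) (simp add: below_def)

lemma leads_mult:
  assumes "leads N m f" "leads N m' g"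
  shows "leads N (m + m') (f * g)"
proof -
  obtain c f' where f: "c \<noteq> 0" "f = Poly_Mapping.single m c + f'" "below N (mon_weight N m) f'"
    using assms(1) unfolding leads_def by blast
  obtain d g' where g: "d \<noteq> 0" "g = Poly_Mapping.single m' d + g'" "below N (mon_weight N m') g'"
    using assms(2) unfolding leads_def by blast
  have "mon_weight N b \<le> mon_weight N m'" if "b \<in> Poly_Mapping.keys g" for b
    using that keys_add[of "Poly_Mapping.single m' d" g'] g by (fastforce simp: below_def)
  then have 1: "below N (mon_weight N (m + m')) (f' * g)"
    using f(3) by (intro below_mult) (auto simp: below_def mon_weight_add intro: add_less_le_mono)
  have 2: "below N (mon_weight N (m + m')) (Poly_Mapping.single m c * g')"
    using f g by (intro below_mult) (auto simp: below_def mon_weight_add)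
  have "f * g = Poly_Mapping.single (m + m') (c * d) + (Poly_Mapping.single m c * g' + f' * g)"
    by (simp add: f(2) g(2) mult_single algebra_simps)
  then show ?thesis
    unfolding leads_def using below_add[OF 2 1] f(1) g(1)
    by (intro exI[of _ "c * d"] exI[of _ "Poly_Mapping.single m c * g' + f' * g"]) simp
qed

lemma leads_power: "leads N (Poly_Mapping.single j q) f \<Longrightarrow> leads N (Poly_Mapping.single j (a * q)) (f ^ a)"
  by (induction a) (auto simp: leads_1 single_add intro: leads_mult)

lemma leads_prod:
  "(\<And>a. a \<in> A \<Longrightarrow> leads N (M a) (F a)) \<Longrightarrow> leads N (\<Sum>a\<in>A. M a) (\<Prod>a\<in>A. F a)"
  by (induction A rule: infinite_finite_induct) (auto simp: leads_1 intro: leads_mult)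

lemma leadsI:
  assumes "Poly_Mapping.lookup f m \<noteq> 0"
    and "\<And>m'. m' \<in> Poly_Mapping.keys f \<Longrightarrow> m' \<noteq> m \<Longrightarrow> mon_weight N m' < mon_weight N m"
  shows "leads N m f"
proof -
  let ?c = "Poly_Mapping.lookup f m" let ?g = "f - Poly_Mapping.single m ?c"
  have "below N (mon_weight N m) ?g"
    unfolding below_def
  proof
    fix m' assume m': "m' \<in> Poly_Mapping.keys ?g"
    then have "m' \<noteq> m" by (auto simp: in_keys_iff lookup_minus)
    with m' have "m' \<in> Poly_Mapping.keys f" by (auto simp: in_keys_iff lookup_minus lookup_single when_def)
    with \<open>m' \<noteq> m\<close> show "mon_weight N m' < mon_weight N m" by (rule assms(2)[rotated])
  qed
  moreover have "f = Poly_Mapping.single m ?c + ?g" by simp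
  ultimately show ?thesis unfolding leads_def using assms(1) by blast
qed

text \<open>By Lucas, this binomial is congruent to the lowest nonzero base-p digit of
  \<open>a\<close>. The proof instead uses the multiplicity computation known from Sylow's theorem:
  writing \<open>a\<close> as its p-part times u, the binomial has the multiplicity of u, which is
  0.\<close>

lemma of_nat_choose_prime_power_part_nonzero:
  assumes "Factorial_Ring.prime p" "CHAR('k::field) = p" "a > 0"
  shows "(of_nat (a choose p ^ multiplicity p a) :: 'k) \<noteq> 0"
proof -
  let ?b = "multiplicity p a"
  obtain u where u: "a = p ^ ?b * u" "\<not> p dvd u"
    using assms by (metis multiplicity_decompose' not_prime_unit not_gr0)
  then have "u > 0" by (metis dvd_0_right not_gr0)
  then have "multiplicity p (p ^ ?b * u choose p ^ ?b) = multiplicity p u"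
    using const_p_fac assms(1) by blast
  also have "\<dots> = 0" using u(2) by (rule not_dvd_imp_multiplicity_0)
  finally have "multiplicity p (a choose p ^ ?b) = 0" using u(1) by simp
  moreover have "a choose p ^ ?b > 0"
    using assms(3) multiplicity_dvd[of p a] by (simp add: dvd_imp_le)
  ultimately have "\<not> p dvd (a choose p ^ ?b)"
    using assms(1) by (simp add: prime_elem_multiplicity_eq_zero_iff)
  then show ?thesis using assms(2) by (simp add: of_nat_eq_0_iff_char_dvd)
qed

text \<open>A derivative in one variable leaves the exponents of the others alone, so the binomial
  factors of successive derivatives simply multiply.\<close>

lemma iterated_hasse:
  assumes "finite J" "J \<subseteq> L" "f \<in> B" and hasse: "\<And>f j b. f \<in> B \<Longrightarrow> j \<in> L \<Longrightarrow> hasse j b f \<in> B"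
  shows "\<exists>h\<in>B. \<forall>m. Poly_Mapping.lookup h m =
    of_nat (\<Prod>i\<in>J. Poly_Mapping.lookup m i + \<beta> i choose \<beta> i) *
    Poly_Mapping.lookup f (m + (\<Sum>i\<in>J. Poly_Mapping.single i (\<beta> i)))"
  using assms(1,2)
proof (induction J)
  case empty
  then show ?case using assms(3) by (intro bexI[of _ f]) simp_all
next
  case (insert i J)
  then obtain h where h: "h \<in> B" "\<And>m. Poly_Mapping.lookup h m =
    of_nat (\<Prod>i\<in>J. Poly_Mapping.lookup m i + \<beta> i choose \<beta> i) *
    Poly_Mapping.lookup f (m + (\<Sum>i\<in>J. Poly_Mapping.single i (\<beta> i)))" by auto
  have "Poly_Mapping.lookup (hasse i (\<beta> i) h) m =
    of_nat (\<Prod>i\<in>insert i J. Poly_Mapping.lookup m i + \<beta> i choose \<beta> i) *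
    Poly_Mapping.lookup f (m + (\<Sum>i\<in>insert i J. Poly_Mapping.single i (\<beta> i)))" for m
  proof -
    have "(\<Prod>k\<in>J. Poly_Mapping.lookup (m + Poly_Mapping.single i (\<beta> i)) k + \<beta> k choose \<beta> k) =
        (\<Prod>k\<in>J. Poly_Mapping.lookup m k + \<beta> k choose \<beta> k)"
      by (rule prod.cong) (use insert in \<open>auto simp: lookup_add lookup_single when_def\<close>)
    then show ?thesis
      unfolding lookup_hasse h(2) using insert by (simp add: algebra_simps)
  qed
  then show ?case using hasse[OF h(1)] insert.prems by blast
qed

lemma sum_single_lookup:
  assumes "finite L" "Poly_Mapping.keys m \<subseteq> L"
  shows "(\<Sum>i\<in>L. Poly_Mapping.single i (Poly_Mapping.lookup m i)) = m"
proof -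
  have "(\<Sum>i\<in>L. Poly_Mapping.single i (Poly_Mapping.lookup m i)) =
      (\<Sum>i\<in>Poly_Mapping.keys m. Poly_Mapping.single i (Poly_Mapping.lookup m i))"
    by (rule sum.mono_neutral_right) (use assms in \<open>auto simp: in_keys_iff\<close>)
  then show ?thesis by (simp flip: poly_mapping_sum_single)
qed

lemma multi_hasse:
  assumes "finite L" "f \<in> B" "\<And>f j b. f \<in> B \<Longrightarrow> j \<in> L \<Longrightarrow> hasse j b f \<in> B"
    and "Poly_Mapping.keys \<beta> \<subseteq> L"
  obtains h where "h \<in> B" "\<And>m. Poly_Mapping.lookup h m =
    of_nat (\<Prod>i\<in>L. Poly_Mapping.lookup m i + Poly_Mapping.lookup \<beta> i choose Poly_Mapping.lookup \<beta> i) *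
    Poly_Mapping.lookup f (m + \<beta>)"
  using iterated_hasse[OF assms(1) order_refl assms(2,3), of "Poly_Mapping.lookup \<beta>"]
  unfolding sum_single_lookup[OF assms(1,4)] by blast

text \<open>The leading exponents of \<open>B\<close> are forced to be divisible by \<open>p\<^sup>a\<close> for the least
  \<open>a\<close> such that \<open>x\<^sub>j\<close> to the power \<open>p\<^sup>a\<close> is a leading monomial: a suitable Hasse
  derivative isolates the lowest nonzero base-\<open>p\<close> digit of each exponent. Hence the
  chosen elements generate \<open>B\<close> by subduction.\<close>

lemma hasse_closed_subalgebra_generators:
  fixes B :: "'k::field mpol set"
  assumes p: "Factorial_Ring.prime p" "CHAR('k) = p" and fin: "finite L"
    and sub: "B \<subseteq> polys_in L"
    and add: "\<And>f g. f \<in> B \<Longrightarrow> g \<in> B \<Longrightarrow> f + g \<in> B"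
    and mult: "\<And>f g. f \<in> B \<Longrightarrow> g \<in> B \<Longrightarrow> f * g \<in> B"
    and const: "\<And>c. mpol_const c \<in> B"
    and hasse: "\<And>f j b. f \<in> B \<Longrightarrow> j \<in> L \<Longrightarrow> hasse j b f \<in> B"
    and pow: "\<And>j. j \<in> L \<Longrightarrow> mpol_var j ^ (p ^ e) \<in> B"
  shows "\<exists>f a. (\<forall>j\<in>L. f j \<in> B \<and> a j \<le> e \<and> homogeneous_of_degree (p ^ a j) (f j) \<and>
             f j \<in> polys_in {..j} \<and> Poly_Mapping.lookup (f j) (Poly_Mapping.single j (p ^ a j)) \<noteq> 0) \<and>
           (\<forall>I b d. (\<forall>u\<in>I. \<forall>v\<in>I. u + v \<in> I) \<longrightarrow> (\<forall>u\<in>I. \<forall>c\<in>polys_in L. c * u \<in> I) \<longrightarrow> 0 \<in> I \<longrightarrow>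
              f ` L \<subseteq> I \<longrightarrow> b \<in> B \<longrightarrow> homogeneous_of_degree d b \<longrightarrow> d > 0 \<longrightarrow> b \<in> I)"
proof -
  define P where "P j a f \<longleftrightarrow> f \<in> B \<and> homogeneous_of_degree (p ^ a) f \<and> f \<in> polys_in {..j} \<and>
    Poly_Mapping.lookup f (Poly_Mapping.single j (p ^ a)) \<noteq> 0" for j a f
  define a where "a j = (LEAST a. \<exists>f. P j a f)" for j
  \<comment> \<open>The given power of x_j is a witness, so the least exponent exists and is at most
    \<open>e\<close>.\<close>
  have Pe: "P j e (mpol_var j ^ (p ^ e))" if "j \<in> L" for j
    using pow[OF that] homogeneous_power[OF homogeneous_var, of "p ^ e" j]
    by (auto simp: P_def mpol_var_power intro!: polys_in_single split: if_splits)
  have "\<exists>f. P j (a j) f" if "j \<in> L" for j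
    unfolding a_def by (rule LeastI[of "\<lambda>a. \<exists>f. P j a f" e]) (use Pe[OF that] in blast)
  then obtain f where f: "\<And>j. j \<in> L \<Longrightarrow> P j (a j) (f j)" by metis
  have ae: "a j \<le> e" if "j \<in> L" for j
    unfolding a_def by (rule Least_le) (use Pe[OF that] in blast)
  have p0: "p > 0" using p(1) by (simp add: prime_gt_0_nat)
  \<comment> \<open>\<open>I\<close> is only asked to absorb polynomials in the variables of
    \<open>L\<close>; ideals of a polynomial ring in more variables therefore qualify.\<close>
  have "b \<in> I"
    if I: "\<forall>u\<in>I. \<forall>v\<in>I. u + v \<in> I" "\<forall>u\<in>I. \<forall>c\<in>polys_in L. c * u \<in> I" "0 \<in> I" "f ` L \<subseteq> I"
      and b: "b \<in> B" "homogeneous_of_degree d b" and d: "d > 0" for I b d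
  proof -
    \<comment> \<open>All monomials of a homogeneous element of degree \<open>d\<close> then have
      degree below \<open>N\<close>, so distinct ones have distinct weights and the heaviest is
      unique.\<close>
    define N where "N = Suc d"
    have "b \<in> I" if "b \<in> B" "homogeneous_of_degree d b" "below N w b" for w b
      using that
    proof (induction w arbitrary: b)
      case 0
      then have "b = 0" by (auto simp: below_def simp flip: keys_eq_empty)
      then show ?case using I by simp
    next
      case (Suc w)
      show ?case
      proof (cases "\<exists>\<alpha>\<in>Poly_Mapping.keys b. mon_weight N \<alpha> = w")
        case False
        then have "below N w b" using Suc.prems(3) by (auto simp: below_def less_Suc_eq)
        then show ?thesis using Suc by blast
      next
        case True
        then obtain \<alpha> where \<alpha>: "\<alpha> \<in> Poly_Mapping.keys b" "mon_weight N \<alpha> = w" by blast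
        have deg\<alpha>: "mon_degree \<alpha> = d"
          using \<alpha> Suc.prems(2) by (auto simp: homogeneous_of_degree_def)
        have keys\<alpha>: "Poly_Mapping.keys \<alpha> \<subseteq> L"
          using \<alpha> Suc.prems(1) sub by (auto simp: polys_in_def)
        have other: "mon_weight N m < w" if "m \<in> Poly_Mapping.keys b" "m \<noteq> \<alpha>" for m
        proof -
          have "mon_degree m = d" using that Suc.prems(2) by (auto simp: homogeneous_of_degree_def)
          then have "mon_weight N m \<noteq> w"
            using mon_weight_inj[of m N \<alpha>] that(2) deg\<alpha> \<alpha>(2) by (auto simp: N_def)
          then show ?thesis using Suc.prems(3) that(1) by (auto simp: below_def less_Suc_eq)
        qed
        have dvd: "p ^ a j dvd Poly_Mapping.lookup \<alpha> j" if j: "j \<in> L" for j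
        proof (cases "Poly_Mapping.lookup \<alpha> j = 0")
          case False
          let ?n = "Poly_Mapping.lookup \<alpha> j"
          define c where "c = multiplicity p ?n"
          define q where "q = p ^ c"
          have q: "q dvd ?n" unfolding q_def c_def by (rule multiplicity_dvd)
          then have qle: "q \<le> ?n" using False by (simp add: dvd_imp_le)
          \<comment> \<open>Deriving to order \<beta> turns \<alpha> into x_j to the power
            \<open>q\<close>, where \<open>q\<close> is the p-part of the exponent of x_j. The
            result is homogeneous of degree \<open>q\<close> and still lies in \<open>B\<close>, so
            it competes in the definition of \<open>a j\<close>.\<close>
          define \<beta> where "\<beta> = \<alpha> - Poly_Mapping.single j q"
          have \<alpha>eq: "\<alpha> = \<beta> + Poly_Mapping.single j q"
            by (rule poly_mapping_eqI)
               (use qle in \<open>auto simp: \<beta>_def lookup_add lookup_minus lookup_single when_def\<close>)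
          have keys\<beta>: "Poly_Mapping.keys \<beta> \<subseteq> L"
            using keys\<alpha> by (auto simp: \<beta>_def in_keys_iff lookup_minus)
          obtain h where h: "h \<in> B" "\<And>m. Poly_Mapping.lookup h m =
              of_nat (\<Prod>i\<in>L. Poly_Mapping.lookup m i + Poly_Mapping.lookup \<beta> i choose Poly_Mapping.lookup \<beta> i) *
              Poly_Mapping.lookup b (m + \<beta>)"
            using multi_hasse[OF fin Suc.prems(1) hasse keys\<beta>] by blast
          have hkeys: "m + \<beta> \<in> Poly_Mapping.keys b" if "m \<in> Poly_Mapping.keys h" for m
            using that h(2)[of m] by (auto simp: in_keys_iff)
          have hom: "homogeneous_of_degree q h"
            unfolding homogeneous_of_degree_def
          proof
            fix m assume "m \<in> Poly_Mapping.keys h"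
            then have "mon_degree (m + \<beta>) = d"
              using hkeys Suc.prems(2) by (auto simp: homogeneous_of_degree_def)
            then show "mon_degree m = q"
              using deg\<alpha> by (simp add: \<alpha>eq mon_degree_add)
          qed
          have "q \<le> d" using deg\<alpha> by (simp add: \<alpha>eq mon_degree_add)
          have upto: "h \<in> polys_in {..j}"
            unfolding polys_in_def
          proof (intro CollectI ballI)
            fix m assume m: "m \<in> Poly_Mapping.keys h"
            \<comment> \<open>Monomials of \<open>h\<close> come from monomials of \<open>b\<close>
              by removing \<beta>, so none outweighs x_j to the power \<open>q\<close>; a variable
              above j would already do so.\<close>
            have "mon_weight N (m + \<beta>) \<le> mon_weight N \<alpha>"
              using hkeys[OF m] other \<alpha>(2) by (cases "m + \<beta> = \<alpha>") (auto simp: less_imp_le)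
            then have le: "mon_weight N m \<le> mon_weight N (Poly_Mapping.single j q)"
              by (simp add: \<alpha>eq mon_weight_add)
            show "Poly_Mapping.keys m \<subseteq> {..j}"
            proof (rule ccontr)
              assume "\<not> Poly_Mapping.keys m \<subseteq> {..j}"
              then obtain i where i: "i \<in> Poly_Mapping.keys m" "i > j" by force
              define k where "k = Max (Poly_Mapping.keys m)"
              have k: "k \<in> Poly_Mapping.keys m" unfolding k_def using i by (intro Max_in) auto
              have ki: "k \<ge> i" unfolding k_def using i by simp
              have "Poly_Mapping.lookup m l = 0" if "l > k" for l
                using that unfolding k_def by (metis Max_ge finite_keys in_keys_iff leD)
              then have "mon_weight N (Poly_Mapping.single j q) < mon_weight N m"
                using k ki i(2) \<open>q \<le> d\<close>
                by (intro mon_weight_less[of _ _ k]) (auto simp: N_def lookup_single in_keys_iff)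
              with le show False by simp
            qed
          qed
          have "Poly_Mapping.lookup h (Poly_Mapping.single j q) \<noteq> 0"
          proof -
            \<comment> \<open>Only the factor at j differs from 1. By symmetry of binomials it is
              \<open>?n choose q\<close>, which is nonzero in the field because \<open>q\<close> is
              the p-part of \<open>?n\<close>.\<close>
            have "(\<Prod>i\<in>L. Poly_Mapping.lookup (Poly_Mapping.single j q) i + Poly_Mapping.lookup \<beta> i
                choose Poly_Mapping.lookup \<beta> i) = (\<Prod>i\<in>L. if i = j then ?n choose q else 1)"
              by (rule prod.cong)
                 (use qle in \<open>auto simp: \<beta>_def lookup_minus lookup_single when_def intro: binomial_symmetric[symmetric]\<close>)
            also have "\<dots> = ?n choose q" using fin j by simp
            finally have "Poly_Mapping.lookup h (Poly_Mapping.single j q) =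
                of_nat (?n choose q) * Poly_Mapping.lookup b \<alpha>"
              by (simp add: h(2) \<alpha>eq add.commute)
            then show ?thesis
              using of_nat_choose_prime_power_part_nonzero[OF p, of ?n] False \<alpha>(1)
              by (simp add: q_def c_def in_keys_iff)
          qed
          with h(1) hom upto have "P j c h" by (simp add: P_def q_def)
          then have "a j \<le> c" unfolding a_def by (intro Least_le) blast
          then have "p ^ a j dvd q" unfolding q_def by (rule le_imp_power_dvd)
          then show ?thesis using q by (rule dvd_trans)
        qed simp
        define ex where "ex j = Poly_Mapping.lookup \<alpha> j div p ^ a j" for j
        have ex: "ex j * p ^ a j = Poly_Mapping.lookup \<alpha> j" if "j \<in> L" for j
          using dvd[OF that] by (simp add: ex_def)
        define M where "M = (\<Prod>j\<in>L. f j ^ ex j)"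
        have "leads N (Poly_Mapping.single j (ex j * p ^ a j)) (f j ^ ex j)" if j: "j \<in> L" for j
        \<comment> \<open>If the exponent is 0, the degree of \<open>f j\<close> may reach
          \<open>N\<close> or more, where weights no longer determine the order; the factor is then
          1. Otherwise its degree is at most that of \<alpha>.\<close>
        proof (cases "ex j = 0")
          case False
          have fj: "f j \<in> B" "homogeneous_of_degree (p ^ a j) (f j)" "f j \<in> polys_in {..j}"
            "Poly_Mapping.lookup (f j) (Poly_Mapping.single j (p ^ a j)) \<noteq> 0"
            using f[OF j] by (auto simp: P_def)
          have "p ^ a j \<le> Poly_Mapping.lookup \<alpha> j" using ex[OF j] False by (metis le_add1 mult_eq_if)
          then have pd: "p ^ a j < N" using lookup_le_mon_degree[of \<alpha> j] deg\<alpha> by (simp add: N_def)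
          have "leads N (Poly_Mapping.single j (p ^ a j)) (f j)"
          proof (rule leadsI[OF fj(4)])
            fix m assume m: "m \<in> Poly_Mapping.keys (f j)" "m \<noteq> Poly_Mapping.single j (p ^ a j)"
            have deg: "mon_degree m = p ^ a j" using fj(2) m(1) by (auto simp: homogeneous_of_degree_def)
            have up: "Poly_Mapping.keys m \<subseteq> {..j}" using fj(3) m(1) by (auto simp: polys_in_def)
            have "Poly_Mapping.lookup m j \<noteq> p ^ a j"
            proof
              assume eq: "Poly_Mapping.lookup m j = p ^ a j"
              let ?r = "m - Poly_Mapping.single j (p ^ a j)"
              have "m = ?r + Poly_Mapping.single j (p ^ a j)"
                by (rule poly_mapping_eqI) (use eq in \<open>auto simp: lookup_add lookup_minus lookup_single when_def\<close>)
              moreover from this have "mon_degree m = mon_degree ?r + p ^ a j"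
                using mon_degree_add[of ?r "Poly_Mapping.single j (p ^ a j)"] by simp
              ultimately show False using deg m(2) by (metis add_0 add_eq_self_zero mon_degree_eq_0_iff add.commute)
            qed
            then have "Poly_Mapping.lookup m j < p ^ a j"
              using lookup_le_mon_degree[of m j] deg by simp
            then show "mon_weight N m < mon_weight N (Poly_Mapping.single j (p ^ a j))"
              using up pd deg by (intro mon_weight_less[of _ _ j]) (force simp: lookup_single in_keys_iff)+
          qed
          then show ?thesis by (rule leads_power)
        qed (simp add: leads_1)
        then have "leads N (\<Sum>j\<in>L. Poly_Mapping.single j (ex j * p ^ a j)) M"
          unfolding M_def by (rule leads_prod)
        also have "(\<Sum>j\<in>L. Poly_Mapping.single j (ex j * p ^ a j)) = \<alpha>"
          using ex sum_single_lookup[OF fin keys\<alpha>] by simp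
        finally obtain c M' where M': "c \<noteq> 0" "M = Poly_Mapping.single \<alpha> c + M'" "below N w M'"
          unfolding leads_def \<alpha>(2) by blast
        let ?s = "Poly_Mapping.lookup b \<alpha> / c"
        \<comment> \<open>One subduction step: \<open>M\<close> has the same leading monomial as
          \<open>b\<close>, so this combination stays in \<open>B\<close>, stays homogeneous and has
          a smaller weight bound.\<close>
        define b' where "b' = b + mpol_const (- ?s) * M"
        have MB: "M \<in> B"
        proof -
          have one: "1 \<in> B" using const[of 1] by simp
          have fB: "f j ^ k \<in> B" if "j \<in> L" for j k
            using f[OF that] by (induction k) (auto simp: P_def one mult)
          have "(\<Prod>j\<in>J. f j ^ ex j) \<in> B" if "J \<subseteq> L" for J
            using finite_subset[OF that fin] that by (induction J rule: finite_induct) (auto simp: one mult fB)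
          then show ?thesis unfolding M_def by blast
        qed
        have "homogeneous_of_degree (\<Sum>j\<in>L. ex j * p ^ a j) M"
          unfolding M_def using f by (intro homogeneous_prod homogeneous_power) (auto simp: P_def)
        moreover have "(\<Sum>j\<in>L. ex j * p ^ a j) = d"
          using ex deg\<alpha> mon_degree_superset[OF fin keys\<alpha>] by simp
        ultimately have Mhom: "homogeneous_of_degree d M" by simp
        have "b' \<in> B" unfolding b'_def using Suc.prems(1) MB by (intro add mult const)
        moreover have "homogeneous_of_degree d b'"
          unfolding b'_def using homogeneous_mult[OF homogeneous_const Mhom] Suc.prems(2)
          by (intro homogeneous_add) simp_all
        moreover have "below N w b'"
          unfolding below_def
        proof
          fix m assume m: "m \<in> Poly_Mapping.keys b'"
          have "\<alpha> \<notin> Poly_Mapping.keys M'" using M'(3) \<alpha>(2) by (auto simp: below_def)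
          then have "Poly_Mapping.lookup b' \<alpha> = 0"
            using M'(1) by (simp add: b'_def lookup_add lookup_const_mult M'(2) in_keys_iff)
          with m have "m \<noteq> \<alpha>" by (auto simp: in_keys_iff)
          with m have "m \<in> Poly_Mapping.keys b \<or> m \<in> Poly_Mapping.keys M'"
            by (auto simp: b'_def lookup_add lookup_const_mult M'(2) in_keys_iff lookup_single when_def)
          then show "mon_weight N m < w" using other \<open>m \<noteq> \<alpha>\<close> M'(3) by (auto simp: below_def)
        qed
        ultimately have b': "b' \<in> I" by (rule Suc.IH)
        \<comment> \<open>Positivity of \<open>d\<close> is used here: \<alpha> involves some
          variable x_j, so \<open>M\<close> contains the factor \<open>f j\<close> and lies in
          \<open>I\<close>.\<close>
        obtain j where j: "j \<in> Poly_Mapping.keys \<alpha>"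
          using deg\<alpha> d by (metis mon_degree_0 keys_eq_empty ex_in_conv less_not_refl)
        then have jL: "j \<in> L" using keys\<alpha> by blast
        then have "ex j \<noteq> 0" using ex[OF jL] j by (metis in_keys_iff mult_0)
        then have "M = (f j ^ (ex j - 1) * (\<Prod>j\<in>L - {j}. f j ^ ex j)) * f j"
          unfolding M_def prod.remove[OF fin jL] by (cases "ex j") (simp_all add: mult_ac)
        moreover have "f j ^ (ex j - 1) * (\<Prod>j\<in>L - {j}. f j ^ ex j) \<in> polys_in L"
          using f sub jL by (intro polys_in_mult polys_in_prod polys_in_power) (auto simp: P_def)
        ultimately have "M \<in> I" using I(2,4) jL by auto
        then have "b' + mpol_const ?s * M \<in> I" using b' I(1,2) by auto
        also have "b' + mpol_const ?s * M = b"
          using mpol_const_add[of "- ?s" ?s] by (simp add: b'_def distrib_right[symmetric] add.assoc)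
        finally show ?thesis .
      qed
    qed
    moreover have "below N (Suc (Max (insert 0 (mon_weight N ` Poly_Mapping.keys b)))) b"
      by (auto simp: below_def less_Suc_eq_le)
    ultimately show ?thesis using b by blast
  qed
  then show ?thesis
    using f ae unfolding P_def by (intro exI[of _ f] exI[of _ a]) blast
qed

section \<open>Ideals of the polynomial ring\<close>

lemma mpol_ring_simps [simp]:
  "carrier (mpol_ring n) = polys_in {1..n}" "monoid.mult (mpol_ring n) = (*)"
  "one (mpol_ring n) = 1" "zero (mpol_ring n) = 0" "add (mpol_ring n) = (+)"
  by (simp_all add: mpol_ring_def polys_upto_eq)

lemma cring_mpol_ring: "cring (mpol_ring n)"
proof (rule cringI)
  show "abelian_group (mpol_ring n)"
    by (rule abelian_groupI)
       (auto simp: polys_in_add algebra_simps intro: bexI[of _ "- x" for x] polys_in_uminus)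
  show "comm_monoid (mpol_ring n)"
    by (rule comm_monoidI) (auto simp: polys_in_mult algebra_simps)
qed (auto simp: algebra_simps)

lemma mpol_ring_a_inv: "f \<in> polys_in {1..n} \<Longrightarrow> a_inv (mpol_ring n) f = - f"
proof -
  assume f: "f \<in> polys_in {1..n}"
  interpret cring "mpol_ring n" by (rule cring_mpol_ring)
  show ?thesis using f minus_equality[of "- f" f] by (simp add: polys_in_uminus)
qed

lemma ideal_mpol_ringI:
  fixes I :: "'k::field mpol set"
  assumes "I \<subseteq> polys_in {1..n}" "0 \<in> I" "\<And>f g. f \<in> I \<Longrightarrow> g \<in> I \<Longrightarrow> f + g \<in> I"
    and mult: "\<And>c f. c \<in> polys_in {1..n} \<Longrightarrow> f \<in> I \<Longrightarrow> c * f \<in> I"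
  shows "ideal I (mpol_ring n)"
proof (rule idealI)
  interpret cring "mpol_ring n" by (rule cring_mpol_ring)
  show "ring (mpol_ring n)" by (rule ring_axioms)
  have "- f \<in> I" if "f \<in> I" for f
    using mult[of "- 1" f] that by (simp add: polys_in_uminus)
  then have "inv\<^bsub>add_monoid (mpol_ring n)\<^esub> f \<in> I" if "f \<in> I" for f
    using assms(1) that mpol_ring_a_inv[of f n] by (auto simp: a_inv_def)
  then show "subgroup I (add_monoid (mpol_ring n))"
    using assms(1-3) by (intro subgroup.intro) (auto simp: subsetD)
  fix c f :: "'k mpol" assume "f \<in> I" "c \<in> carrier (mpol_ring n)"
  then show "c \<otimes>\<^bsub>mpol_ring n\<^esub> f \<in> I" "f \<otimes>\<^bsub>mpol_ring n\<^esub> c \<in> I"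
    using mult[of c f] by (simp_all add: mult.commute)
qed

lemma
  assumes "ideal I (mpol_ring n)"
  shows ideal_mpol_subset: "I \<subseteq> polys_in {1..n}"
    and ideal_mpol_0: "0 \<in> I"
    and ideal_mpol_add: "f \<in> I \<Longrightarrow> g \<in> I \<Longrightarrow> f + g \<in> I"
    and ideal_mpol_mult: "c \<in> polys_in {1..n} \<Longrightarrow> f \<in> I \<Longrightarrow> c * f \<in> I"
    and ideal_mpol_diff: "f \<in> I \<Longrightarrow> g \<in> I \<Longrightarrow> f - g \<in> I"
    and ideal_mpol_sum: "(\<And>a. a \<in> A \<Longrightarrow> F a \<in> I) \<Longrightarrow> sum F A \<in> I"
proof -
  interpret ideal I "mpol_ring n" by fact
  show sub: "I \<subseteq> polys_in {1..n}" using a_subset by simp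
  show 0: "0 \<in> I" using additive_subgroup.zero_closed[OF additive_subgroup_axioms] by simp
  show add: "f \<in> I \<Longrightarrow> g \<in> I \<Longrightarrow> f + g \<in> I" for f g using additive_subgroup.a_closed[OF additive_subgroup_axioms, of f g] by simp
  show mult: "c \<in> polys_in {1..n} \<Longrightarrow> f \<in> I \<Longrightarrow> c * f \<in> I" for c f using I_l_closed[of f c] by simp
  show "f \<in> I \<Longrightarrow> g \<in> I \<Longrightarrow> f - g \<in> I"
    using add[of f "- g"] mult[of "- 1" g] by (simp add: polys_in_uminus)
  show "(\<And>a. a \<in> A \<Longrightarrow> F a \<in> I) \<Longrightarrow> sum F A \<in> I"
    by (induction A rule: infinite_finite_induct) (auto intro: 0 add)
qed

lemma genideal_mpol:
  assumes "F \<subseteq> polys_in {1..n}"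
  shows "ideal (genideal (mpol_ring n) F) (mpol_ring n)" "F \<subseteq> genideal (mpol_ring n) F"
    "ideal I (mpol_ring n) \<Longrightarrow> F \<subseteq> I \<Longrightarrow> genideal (mpol_ring n) F \<subseteq> I"
proof -
  interpret cring "mpol_ring n" by (rule cring_mpol_ring)
  show "ideal (genideal (mpol_ring n) F) (mpol_ring n)" "F \<subseteq> genideal (mpol_ring n) F"
    "ideal I (mpol_ring n) \<Longrightarrow> F \<subseteq> I \<Longrightarrow> genideal (mpol_ring n) F \<subseteq> I"
    using assms genideal_ideal[of F] genideal_self[of F] genideal_minimal[of I F] by simp_all
qed

lemma keys_add_nat: "Poly_Mapping.keys (m + m' :: nat \<Rightarrow>\<^sub>0 nat) = Poly_Mapping.keys m \<union> Poly_Mapping.keys m'"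
  by (auto simp: in_keys_iff lookup_add)

lemma polys_in_hasse: "f \<in> polys_in V \<Longrightarrow> hasse j b f \<in> polys_in V"
  unfolding polys_in_def
proof (intro CollectI ballI)
  fix m assume f: "f \<in> {f. \<forall>m\<in>Poly_Mapping.keys f. Poly_Mapping.keys m \<subseteq> V}"
    and m: "m \<in> Poly_Mapping.keys (hasse j b f)"
  then have "m + Poly_Mapping.single j b \<in> Poly_Mapping.keys f"
    by (auto simp: in_keys_iff lookup_hasse)
  with f have "Poly_Mapping.keys (m + Poly_Mapping.single j b) \<subseteq> V" by blast
  then show "Poly_Mapping.keys m \<subseteq> V" by (simp add: keys_add_nat)
qed

lemma hasse_restrict_vars: "j \<in> L \<Longrightarrow> hasse j b (restrict_vars L f) = restrict_vars L (hasse j b f)"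
  by (rule poly_mapping_eqI) (auto simp: lookup_hasse lookup_restrict_vars keys_add_nat split: if_splits)

text \<open>The only monomial with variables both in \<open>V\<close> and in \<open>L\<close> is 1,
  and a homogeneous polynomial of positive degree has no constant term.\<close>

lemma restrict_vars_eq_0:
  assumes "f \<in> polys_in V" "V \<inter> L = {}" "homogeneous_of_degree d f" "d > 0"
  shows "restrict_vars L f = 0"
proof (rule poly_mapping_eqI)
  fix m
  have "m = 0" if "Poly_Mapping.keys m \<subseteq> L" "Poly_Mapping.lookup f m \<noteq> 0"
  proof -
    have "Poly_Mapping.keys m \<subseteq> V" using assms(1) that(2) by (auto simp: polys_in_def in_keys_iff)
    then show ?thesis using that(1) assms(2) by (simp flip: keys_eq_empty) blast
  qed
  moreover have "Poly_Mapping.lookup f 0 = 0"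
    using assms(3,4) by (metis homogeneous_of_degree_def in_keys_iff less_irrefl mon_degree_0)
  ultimately show "Poly_Mapping.lookup (restrict_vars L f) m = Poly_Mapping.lookup 0 m"
    by (auto simp: lookup_restrict_vars)
qed

section \<open>Invariants of a block triangular action\<close>

lift_definition hom_component :: "nat \<Rightarrow> 'k::field mpol \<Rightarrow> 'k mpol" is
  "\<lambda>d f m. if mon_degree m = d then f m else 0"
  by (rule finite_subset) auto

lemma homogeneous_hom_component: "homogeneous_of_degree d (hom_component d f)"
  by (auto simp: homogeneous_of_degree_def in_keys_iff hom_component.rep_eq split: if_splits)

lemma hom_component_homogeneous:
  "homogeneous_of_degree d' f \<Longrightarrow> hom_component d f = (if d = d' then f else 0)"
  by (intro poly_mapping_eqI)
     (auto simp: homogeneous_of_degree_def hom_component.rep_eq in_keys_iff)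

lemma hom_component_sum: "hom_component d (sum F A) = (\<Sum>a\<in>A. hom_component d (F a))"
  by (rule poly_mapping_eqI) (auto simp: hom_component.rep_eq lookup_sum)

text \<open>A linear substitution sends each monomial to a form of the same degree. Consequently the
  homogeneous components of an invariant are invariants.\<close>

lemma hom_component_subst:
  assumes "f \<in> polys_in V" "\<And>j. j \<in> V \<Longrightarrow> homogeneous_of_degree 1 (\<phi> j)"
  shows "mpol_subst \<phi> (hom_component d f) = hom_component d (mpol_subst \<phi> f)"
proof -
  let ?s = "\<lambda>m. Poly_Mapping.single m (Poly_Mapping.lookup f m)"
  let ?K = "Poly_Mapping.keys f"
  have "mpol_subst \<phi> (hom_component d (?s m)) = hom_component d (mpol_subst \<phi> (?s m))"
    if "m \<in> ?K" for m
  proof -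
    have s: "?s m \<in> polys_in V" using assms(1) that by (auto simp: polys_in_def)
    have "homogeneous_of_degree (mon_degree m) (mpol_subst \<phi> (?s m))"
      by (rule homogeneous_subst[OF s assms(2) homogeneous_single])
    then show ?thesis
      using hom_component_homogeneous[OF homogeneous_single[of m "Poly_Mapping.lookup f m"], of d]
        hom_component_homogeneous[of "mon_degree m" "mpol_subst \<phi> (?s m)" d]
      by (simp del: mpol_const_hom.eval_single)
  qed
  then have "mpol_subst \<phi> (hom_component d (\<Sum>m\<in>?K. ?s m)) = hom_component d (mpol_subst \<phi> (\<Sum>m\<in>?K. ?s m))"
    by (simp add: hom_component_sum mpol_const_hom.eval_sum del: mpol_const_hom.eval_single)
  then show ?thesis by (simp flip: poly_mapping_sum_single)
qed

lemma polys_in_hom_component: "f \<in> polys_in V \<Longrightarrow> hom_component d f \<in> polys_in V"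
  by (auto simp: polys_in_def in_keys_iff[of _ "hom_component d f"] in_keys_iff[of _ f] hom_component.rep_eq split: if_splits)

lemma hom_component_restrict_vars:
  "hom_component d (restrict_vars L f) = restrict_vars L (hom_component d f)"
  by (rule poly_mapping_eqI) (simp add: hom_component.rep_eq lookup_restrict_vars)

lemma map_poly_mult_hom:
  fixes h :: "'a::comm_ring_1 \<Rightarrow> 'b::comm_ring_1"
  assumes "\<And>f g. h (f + g) = h f + h g" "\<And>f g. h (f * g) = h f * h g"
  shows "map_poly h (P * Q) = map_poly h P * map_poly h Q"
proof -
  have 0: "h 0 = 0" using assms(1)[of 0 0] by simp
  have sum: "h (sum F A) = (\<Sum>a\<in>A. h (F a))" for F and A :: "nat set"
    by (induction A rule: infinite_finite_induct) (simp_all add: 0 assms)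
  show ?thesis by (rule poly_eqI) (simp add: coeff_map_poly 0 coeff_mult sum assms)
qed

text \<open>The reason why Hasse derivatives commute with the action. Both sides are ring
  homomorphisms, so variables suffice: the image of x_i for i other than j is free of x_j and
  unaffected by the shift, while x_j goes to \<open>\<phi> j\<close> plus the shift variable either
  way.\<close>

lemma taylor_shift_subst:
  assumes f: "f \<in> polys_in V"
    and \<phi>: "\<And>i. i \<in> V \<Longrightarrow> i \<noteq> j \<Longrightarrow> \<phi> i \<in> polys_in (V - {j})"
      "j \<in> V \<Longrightarrow> \<phi> j - mpol_var j \<in> polys_in (V - {j})"
  shows "map_poly (mpol_subst \<phi>) (taylor_shift j f) = taylor_shift j (mpol_subst \<phi> f)"
proof (rule hom_eqI[OF _ _ _ _ _ _ _ _ f])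
  let ?g = "mpol_subst \<phi>" and ?T = "taylor_shift j :: 'a mpol \<Rightarrow> _"
  have T_add: "?T (u + v) = ?T u + ?T v" for u v
    by (simp add: taylor_shift_def const_poly_hom.eval_add)
  have T_mult: "?T (u * v) = ?T u * ?T v" for u v
    by (simp add: taylor_shift_def const_poly_hom.eval_mult)
  show "map_poly ?g (?T (u + v)) = map_poly ?g (?T u) + map_poly ?g (?T v)" for u v
    unfolding T_add by (rule poly_eqI) (simp add: coeff_map_poly mpol_const_hom.eval_add)
  show "map_poly ?g (?T (u * v)) = map_poly ?g (?T u) * map_poly ?g (?T v)" for u v
    unfolding T_mult by (rule map_poly_mult_hom) (simp_all add: mpol_const_hom.eval_add mpol_const_hom.eval_mult)
  show "?T (?g (u + v)) = ?T (?g u) + ?T (?g v)" "?T (?g (u * v)) = ?T (?g u) * ?T (?g v)" for u v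
    by (simp_all add: mpol_const_hom.eval_add mpol_const_hom.eval_mult T_add T_mult)
  show "map_poly ?g (?T 1) = 1" "?T (?g 1) = 1"
    by (simp_all add: taylor_shift_def map_poly_pCons one_pCons)
  show "map_poly ?g (?T (mpol_const c)) = ?T (?g (mpol_const c))" for c
    by (simp add: taylor_shift_def map_poly_pCons)
  show "map_poly ?g (?T (mpol_var i)) = ?T (?g (mpol_var i))" if i: "i \<in> V" for i
  proof (cases "i = j")
    case True
    have "?T (\<phi> j) = ?T (\<phi> j - mpol_var j) + ?T (mpol_var j)" by (simp flip: T_add)
    also have "\<dots> = [:\<phi> j - mpol_var j:] + [:mpol_var j, 1:]"
      using taylor_shift_const_poly[OF \<phi>(2), of j] i True by (simp add: taylor_shift_def)
    finally show ?thesis using True by (simp add: taylor_shift_def map_poly_pCons)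
  next
    case False
    then show ?thesis
      using taylor_shift_const_poly[OF \<phi>(1)[OF i]] by (simp add: taylor_shift_def map_poly_pCons)
  qed
qed

text \<open>The linear action of \<open>G\<close> on the variables, with \<open>{1..n}\<close> cut into the consecutive blocks
  \<open>{t k<..t (Suc k)}\<close>: every element moves a variable by a linear form in the variables of
  lower blocks, and \<open>G\<close> has the same invariants as a subset \<open>E\<close> whose members move variables of
  one block only.\<close>

locale block_action =
  fixes n K :: nat and t :: "nat \<Rightarrow> nat" and G E :: "'g set"
    and act :: "'g \<Rightarrow> nat \<Rightarrow> 'k::field mpol" and p e :: nat
  assumes p_prime: "Factorial_Ring.prime p" and char: "CHAR('k) = p"
    and t_0: "t 0 = 0" and t_K: "t K = n" and t_mono: "k \<le> k' \<Longrightarrow> k' \<le> K \<Longrightarrow> t k \<le> t k'"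
    and card_G: "card G = p ^ e"
    and act_lower: "g \<in> G \<Longrightarrow> k < K \<Longrightarrow> i \<in> {t k<..t (Suc k)} \<Longrightarrow> act g i - mpol_var i \<in> polys_in {1..t k}"
    and act_linear: "g \<in> G \<Longrightarrow> i \<in> {1..n} \<Longrightarrow> homogeneous_of_degree 1 (act g i)"
    and act_translate: "h \<in> G \<Longrightarrow> \<exists>\<sigma>. bij_betw \<sigma> G G \<and>
          (\<forall>g\<in>G. \<forall>i\<in>{1..n}. mpol_subst (act h) (act g i) = act (\<sigma> g) i)"
    and E_subset: "E \<subseteq> G"
    and E_generates: "f \<in> polys_in {1..n} \<Longrightarrow> (\<And>g. g \<in> E \<Longrightarrow> mpol_subst (act g) f = f) \<Longrightarrow>
          g \<in> G \<Longrightarrow> mpol_subst (act g) f = f"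
    and E_block: "g \<in> E \<Longrightarrow> \<exists>l<K. \<forall>i\<in>{1..n}. act g i \<noteq> mpol_var i \<longrightarrow> i \<in> {t l<..t (Suc l)}"
begin

definition invs :: "nat \<Rightarrow> 'k mpol set" where
  "invs m = {f \<in> polys_in {1..m}. \<forall>g\<in>G. mpol_subst (act g) f = f}"

definition hilb :: "'k mpol set" where
  "hilb = genideal (mpol_ring n) {f \<in> invs n. \<exists>d>0. homogeneous_of_degree d f}"

abbreviation block :: "nat \<Rightarrow> nat set" where
  "block k \<equiv> {t k<..t (Suc k)}"

lemma t_le: "k \<le> K \<Longrightarrow> t k \<le> n"
  using t_mono[of k K] t_K by simp

lemma block_exists:
  assumes "1 \<le> i" "i \<le> t k" "k \<le> K"
  shows "\<exists>l<k. i \<in> block l"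
  using assms
proof (induction k)
  case 0
  then show ?case using t_0 by simp
next
  case (Suc k)
  then show ?case by (cases "i \<le> t k") (auto intro: less_SucI)
qed

lemma block_unique: "i \<in> block k \<Longrightarrow> i \<in> block l \<Longrightarrow> k < K \<Longrightarrow> l < K \<Longrightarrow> k = l"
  using t_mono[of "Suc k" l] t_mono[of "Suc l" k] by (cases k l rule: linorder_cases) auto

lemma act_in_block:
  assumes "g \<in> G" "k < K" "i \<in> block k"
  shows "act g i \<in> polys_in (insert i {1..t k})"
  using polys_in_add[of "act g i - mpol_var i" "insert i {1..t k}" "mpol_var i"]
    polys_in_mono[OF act_lower[OF assms]] by auto

lemma act_in:
  assumes "g \<in> G" "k \<le> K" "i \<in> {1..t k}"
  shows "act g i \<in> polys_in {1..t k}"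
proof -
  obtain l where l: "l < k" "i \<in> block l" using block_exists[of i k] assms by auto
  have "insert i {1..t l} \<subseteq> {1..t k}"
    using assms l t_mono[of l k] by auto
  moreover have "act g i \<in> polys_in (insert i {1..t l})"
    using l assms by (intro act_in_block) auto
  ultimately show ?thesis using polys_in_mono by blast
qed

lemma invs_mono: "f \<in> invs m \<Longrightarrow> m \<le> m' \<Longrightarrow> f \<in> invs m'"
  by (auto simp: invs_def intro: polys_in_mono)

text \<open>The variable has to come from the top block: a lower variable may occur in the images of
  higher ones, and then shifting it does not commute with the action.\<close>

lemma invs_hasse:
  assumes "k < K" "j \<in> block k" "f \<in> invs (t (Suc k))"
  shows "hasse j b f \<in> invs (t (Suc k))"
proof -
  have "mpol_subst (act g) (hasse j b f) = hasse j b f" if g: "g \<in> G" for g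
  proof -
    have "map_poly (mpol_subst (act g)) (taylor_shift j f) = taylor_shift j (mpol_subst (act g) f)"
    proof (rule taylor_shift_subst[of f "{1..t (Suc k)}"])
      show "f \<in> polys_in {1..t (Suc k)}" using assms by (simp add: invs_def)
      show "act g i \<in> polys_in ({1..t (Suc k)} - {j})" if i: "i \<in> {1..t (Suc k)}" "i \<noteq> j" for i
      proof (cases "i \<le> t k")
        case True
        then have "act g i \<in> polys_in {1..t k}" using g i assms by (intro act_in) auto
        then show ?thesis using assms t_mono[of k "Suc k"] by (elim polys_in_mono) auto
      next
        case False
        then have "act g i \<in> polys_in (insert i {1..t k})" using g i assms by (intro act_in_block) auto
        then show ?thesis using assms i t_mono[of k "Suc k"] by (elim polys_in_mono) auto
      qed
      show "act g j - mpol_var j \<in> polys_in ({1..t (Suc k)} - {j})"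
        using act_lower[OF g assms(1,2)] assms t_mono[of k "Suc k"] by (elim polys_in_mono) auto
    qed
    then have "Polynomial.coeff (map_poly (mpol_subst (act g)) (taylor_shift j f)) b = hasse j b f"
      using assms(3) g by (simp add: invs_def hasse_def)
    then show ?thesis by (simp add: coeff_map_poly hasse_def)
  qed
  then show ?thesis using assms(3) by (auto simp: invs_def intro: polys_in_hasse)
qed

text \<open>Invariance is checked on \<open>E\<close>. A generator of a lower block fixes the
  variables of block \<open>k\<close> and preserves the lower polynomial ring, so it commutes with
  setting the former to 0. Every other generator fixes the lower variables altogether.\<close>

lemma invs_restrict_lower:
  assumes k: "k < K" and f: "f \<in> invs (t (Suc k))"
  shows "restrict_vars {1..t k} f \<in> invs (t k)"
proof -
  let ?\<rho> = "restrict_vars {1..t k} :: 'k mpol \<Rightarrow> _"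
  have f': "f \<in> polys_in {1..t (Suc k)}" using f by (simp add: invs_def)
  have in_low: "?\<rho> f \<in> polys_in {1..t k}"
    using polys_in_restrict_vars[OF f', of "{1..t k}"] by (rule polys_in_mono) auto
  have id: "?\<rho> u = u" if "u \<in> polys_in {1..t k}" for u
    unfolding restrict_vars_def using that by (rule mpol_subst_fixes) simp
  have "mpol_subst (act g) (?\<rho> f) = ?\<rho> f" if gE: "g \<in> E" for g
  proof -
    have g: "g \<in> G" using gE E_subset by blast
    obtain l where l: "l < K" "\<And>i. i \<in> {1..n} \<Longrightarrow> act g i \<noteq> mpol_var i \<Longrightarrow> i \<in> block l"
      using E_block[OF gE] by blast
    show ?thesis
    proof (cases "l < k")
      case True
      have "mpol_subst (act g) (?\<rho> f) = ?\<rho> (mpol_subst (act g) f)"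
      proof (rule hom_eqI[OF _ _ _ _ _ _ _ _ f'])
        fix i assume i: "i \<in> {1..t (Suc k)}"
        show "mpol_subst (act g) (?\<rho> (mpol_var i)) = ?\<rho> (mpol_subst (act g) (mpol_var i))"
        proof (cases "i \<le> t k")
          case True
          then have "act g i \<in> polys_in {1..t k}" using g i k by (intro act_in) auto
          then have "?\<rho> (act g i) = act g i" by (rule id)
          moreover have "?\<rho> (mpol_var i) = mpol_var i" by (rule id) (use True i in simp)
          ultimately show ?thesis by simp
        next
          case False
          then have ib: "i \<in> block k" using i by simp
          have "act g i = mpol_var i"
            using l block_unique[OF ib _ k] True i t_le[of "Suc k"] k by fastforce
          then show ?thesis using False by (simp add: restrict_vars_def)
        qed
      qed (simp_all add: restrict_vars_def mpol_const_hom.eval_add mpol_const_hom.eval_mult)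
      then show ?thesis using f g by (simp add: invs_def)
    next
      case False
      then have "act g i = mpol_var i" if "i \<in> {1..t k}" for i
        using l(2)[of i] l(1) that t_mono[of k l] t_le[of k] k by force
      then show ?thesis by (rule mpol_subst_fixes[OF in_low])
    qed
  qed
  then have "mpol_subst (act g) (?\<rho> f) = ?\<rho> f" if "g \<in> G" for g
    using E_generates[of "?\<rho> f" g] that polys_in_mono[OF in_low] t_le[of k] k by auto
  then show ?thesis using in_low by (simp add: invs_def)
qed

lemma invs_hom_component:
  assumes "m \<le> n" "f \<in> invs m"
  shows "hom_component d f \<in> invs m"
proof -
  have "mpol_subst (act g) (hom_component d f) = hom_component d f" if "g \<in> G" for g
  proof -
    have "mpol_subst (act g) (hom_component d f) = hom_component d (mpol_subst (act g) f)"
      using assms that by (intro hom_component_subst[of _ "{1..m}"] act_linear) (auto simp: invs_def)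
    then show ?thesis using assms that by (simp add: invs_def)
  qed
  then show ?thesis using assms by (simp add: invs_def polys_in_hom_component)
qed

text \<open>Acting on the orbit product permutes its factors. Each factor is x_j plus a linear form
  in lower blocks, and this form vanishes on restriction to the block.\<close>

lemma norm_invs:
  assumes k: "k < K" and j: "j \<in> block k"
  shows "(\<Prod>g\<in>G. act g j) \<in> invs (t (Suc k))"
    and "restrict_vars (block k) (\<Prod>g\<in>G. act g j) = mpol_var j ^ (p ^ e)"
proof -
  have jn: "j \<in> {1..n}" using j k t_le[of "Suc k"] by auto
  have "mpol_subst (act h) (\<Prod>g\<in>G. act g j) = (\<Prod>g\<in>G. act g j)" if h: "h \<in> G" for h
  proof -
    obtain \<sigma> where \<sigma>: "bij_betw \<sigma> G G" "\<And>g. g \<in> G \<Longrightarrow> mpol_subst (act h) (act g j) = act (\<sigma> g) j"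
      using act_translate[OF h] jn by blast
    have "mpol_subst (act h) (\<Prod>g\<in>G. act g j) = (\<Prod>g\<in>G. act (\<sigma> g) j)"
      using \<sigma>(2) by (simp add: mpol_const_hom.eval_prod)
    also have "\<dots> = (\<Prod>g\<in>G. act g j)" using \<sigma>(1) by (rule prod.reindex_bij_betw)
    finally show ?thesis .
  qed
  moreover have "(\<Prod>g\<in>G. act g j) \<in> polys_in {1..t (Suc k)}"
    using j k act_in[of _ "Suc k" j] by (intro polys_in_prod) auto
  ultimately show "(\<Prod>g\<in>G. act g j) \<in> invs (t (Suc k))" by (simp add: invs_def)
  have "restrict_vars (block k) (act g j) = mpol_var j" if g: "g \<in> G" for g
  proof -
    have "restrict_vars (block k) (act g j - mpol_var j) = 0"
      using act_lower[OF g k j]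
      by (rule restrict_vars_eq_0[where d = 1])
         (use homogeneous_diff[OF act_linear[OF g jn] homogeneous_var] in auto)
    then show ?thesis using j by (simp add: restrict_vars_def mpol_const_hom.eval_diff)
  qed
  then show "restrict_vars (block k) (\<Prod>g\<in>G. act g j) = mpol_var j ^ (p ^ e)"
    by (simp add: restrict_vars_def mpol_const_hom.eval_prod card_G)
qed

text \<open>Expanding an invariant in the variables of its top block, the coefficients are again
  invariants, as lowest terms of Hasse derivatives.\<close>

lemma invs_diff_restrict_block:
  assumes k: "k < K" and f: "f \<in> invs (t (Suc k))" and hom: "homogeneous_of_degree d f"
    and I: "ideal I (mpol_ring n)"
    and low: "\<And>a d'. a \<in> invs (t k) \<Longrightarrow> homogeneous_of_degree d' a \<Longrightarrow> d' > 0 \<Longrightarrow> a \<in> I"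
  shows "f - restrict_vars (block k) f \<in> I"
proof -
  let ?L = "block k"
  \<comment> \<open>The part of a monomial in the block variables; it plays the role of the exponent
    of y, and what remains is a monomial of the coefficient.\<close>
  define blk where "blk m = (\<Sum>i\<in>?L. Poly_Mapping.single i (Poly_Mapping.lookup m i))"
    for m :: "nat \<Rightarrow>\<^sub>0 nat"
  have lookup_blk: "Poly_Mapping.lookup (blk m) i = (if i \<in> ?L then Poly_Mapping.lookup m i else 0)" for m i
    by (simp add: blk_def lookup_sum lookup_single when_def)
  have keys_blk: "Poly_Mapping.keys (blk m) \<subseteq> ?L" for m
    by (auto simp: in_keys_iff lookup_blk split: if_splits)
  have fp: "f \<in> polys_in {1..t (Suc k)}" using f by (simp add: invs_def)
  \<comment> \<open>Restriction to the block keeps exactly the monomials in block variables, so the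
    difference consists of the monomials in \<open>S\<close>. These are collected by their block
    part.\<close>
  define S where "S = {m \<in> Poly_Mapping.keys f. \<not> Poly_Mapping.keys m \<subseteq> ?L}"
  let ?s = "\<lambda>m. Poly_Mapping.single m (Poly_Mapping.lookup f m)"
  have fS: "finite S" by (simp add: S_def)
  have "f - restrict_vars ?L f = (\<Sum>m\<in>S. ?s m)"
    by (rule poly_mapping_eqI)
       (auto simp: lookup_minus lookup_restrict_vars lookup_sum lookup_single when_def S_def in_keys_iff)
  also have "\<dots> = (\<Sum>\<beta>\<in>blk ` S. \<Sum>m\<in>{m\<in>S. blk m = \<beta>}. ?s m)"
    by (rule sum.group[symmetric]) (use fS in auto)
  also have "\<dots> \<in> I"
  proof (rule ideal_mpol_sum[OF I])
    fix \<beta> assume "\<beta> \<in> blk ` S"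
    then obtain m0 where m0: "m0 \<in> S" "blk m0 = \<beta>" by blast
    have keys\<beta>: "Poly_Mapping.keys \<beta> \<subseteq> ?L" using keys_blk m0(2) by blast
    have dec: "m = (m - blk m) + blk m" for m
      by (rule poly_mapping_eqI) (simp add: lookup_add lookup_minus lookup_blk)
    \<comment> \<open>A monomial in \<open>S\<close> has a variable outside the block. Hence the
      coefficient belonging to \<beta> has positive degree, as the hypothesis on lower invariants
      requires.\<close>
    have deg\<beta>: "mon_degree \<beta> < d"
    proof -
      have "mon_degree m0 = d" using hom m0(1) by (auto simp: homogeneous_of_degree_def S_def)
      moreover have "mon_degree m0 = mon_degree (m0 - \<beta>) + mon_degree \<beta>"
        using dec[of m0] m0(2) by (metis mon_degree_add)
      moreover have "m0 - \<beta> \<noteq> 0"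
        using dec[of m0] m0 keys\<beta> by (auto simp: S_def)
      ultimately show ?thesis using mon_degree_eq_0_iff[of "m0 - \<beta>"] by linarith
    qed
    obtain h where h: "h \<in> invs (t (Suc k))" "\<And>m. Poly_Mapping.lookup h m =
        of_nat (\<Prod>i\<in>?L. Poly_Mapping.lookup m i + Poly_Mapping.lookup \<beta> i choose Poly_Mapping.lookup \<beta> i) *
        Poly_Mapping.lookup f (m + \<beta>)"
      using multi_hasse[of ?L f "invs (t (Suc k))" \<beta>] f invs_hasse[OF k] keys\<beta> by auto
    \<comment> \<open>On monomials free of block variables every binomial factor of the derivative
      is \<open>\<beta>_i choose \<beta>_i\<close> = 1, so \<open>a\<close> is exactly the
      coefficient of \<beta> in \<open>f\<close>.\<close>
    define a where "a = restrict_vars {1..t k} h"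
    have a: "Poly_Mapping.lookup a m = (if Poly_Mapping.keys m \<subseteq> {1..t k} then Poly_Mapping.lookup f (m + \<beta>) else 0)" for m
    proof (cases "Poly_Mapping.keys m \<subseteq> {1..t k}")
      case True
      then have "Poly_Mapping.lookup m i = 0" if "i \<in> ?L" for i
        using that by (auto simp: in_keys_iff)
      then have "(\<Prod>i\<in>?L. Poly_Mapping.lookup m i + Poly_Mapping.lookup \<beta> i choose Poly_Mapping.lookup \<beta> i) = 1"
        by (intro prod.neutral) simp
      then show ?thesis using True h(2)[of m] by (simp add: a_def lookup_restrict_vars)
    qed (simp add: a_def lookup_restrict_vars)
    have "homogeneous_of_degree (d - mon_degree \<beta>) a"
      unfolding homogeneous_of_degree_def
    proof
      fix m assume "m \<in> Poly_Mapping.keys a"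
      then have "m + \<beta> \<in> Poly_Mapping.keys f" using a[of m] by (auto simp: in_keys_iff split: if_splits)
      then have "mon_degree m + mon_degree \<beta> = d"
        using hom by (auto simp: homogeneous_of_degree_def mon_degree_add)
      then show "mon_degree m = d - mon_degree \<beta>" by simp
    qed
    moreover have "a \<in> invs (t k)" unfolding a_def by (rule invs_restrict_lower[OF k h(1)])
    ultimately have aI: "a \<in> I" using low deg\<beta> by auto
    have "(\<Sum>m\<in>{m\<in>S. blk m = \<beta>}. ?s m) =
        (\<Sum>m\<in>Poly_Mapping.keys a. Poly_Mapping.single (m + \<beta>) (Poly_Mapping.lookup a m))"
    proof (rule sum.reindex_bij_witness[of _ "\<lambda>m. m + \<beta>" "\<lambda>m. m - \<beta>"])
      fix m assume m: "m \<in> {m\<in>S. blk m = \<beta>}"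
      show md: "m - \<beta> + \<beta> = m" using dec[of m] m by simp
      have mk: "Poly_Mapping.keys m \<subseteq> {1..t (Suc k)}" using m fp by (auto simp: S_def polys_in_def)
      have kl: "Poly_Mapping.keys (m - \<beta>) \<subseteq> {1..t k}"
      proof
        fix i assume "i \<in> Poly_Mapping.keys (m - \<beta>)"
        then have "Poly_Mapping.lookup m i - Poly_Mapping.lookup (blk m) i \<noteq> 0"
          using m by (simp add: in_keys_iff lookup_minus)
        then have "i \<notin> ?L" "i \<in> Poly_Mapping.keys m"
          by (auto simp: lookup_blk in_keys_iff split: if_splits)
        then show "i \<in> {1..t k}" using mk by auto
      qed
      then show "m - \<beta> \<in> Poly_Mapping.keys a"
        using m a[of "m - \<beta>"] md by (simp add: S_def in_keys_iff)
      show "Poly_Mapping.single (m - \<beta> + \<beta>) (Poly_Mapping.lookup a (m - \<beta>)) = ?s m"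
        using a[of "m - \<beta>"] kl md by simp
    next
      fix m assume "m \<in> Poly_Mapping.keys a"
      then have m: "Poly_Mapping.keys m \<subseteq> {1..t k}" "m + \<beta> \<in> Poly_Mapping.keys f"
        using a[of m] by (auto simp: in_keys_iff split: if_splits)
      show "m + \<beta> - \<beta> = m" by simp
      have blk: "blk (m + \<beta>) = \<beta>"
      proof (rule poly_mapping_eqI)
        fix i
        have "Poly_Mapping.lookup m i = 0" if "i \<in> ?L" using m(1) that by (auto simp: in_keys_iff)
        moreover have "Poly_Mapping.lookup \<beta> i = 0" if "i \<notin> ?L" using keys\<beta> that by (auto simp: in_keys_iff)
        ultimately show "Poly_Mapping.lookup (blk (m + \<beta>)) i = Poly_Mapping.lookup \<beta> i"
          by (auto simp: lookup_blk lookup_add)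
      qed
      have "\<not> Poly_Mapping.keys (m + \<beta>) \<subseteq> ?L"
      proof
        assume "Poly_Mapping.keys (m + \<beta>) \<subseteq> ?L"
        then have "blk (m + \<beta>) = m + \<beta>" unfolding blk_def by (intro sum_single_lookup) auto
        then have "m + \<beta> = \<beta>" using blk by simp
        then have "mon_degree \<beta> = d" using m(2) hom by (auto simp: homogeneous_of_degree_def)
        with deg\<beta> show False by simp
      qed
      then show "m + \<beta> \<in> {m\<in>S. blk m = \<beta>}" using m blk by (simp add: S_def)
    qed
    also have "\<dots> = Poly_Mapping.single \<beta> 1 * a"
    proof -
      have "Poly_Mapping.single \<beta> 1 * (\<Sum>m\<in>Poly_Mapping.keys a. Poly_Mapping.single m (Poly_Mapping.lookup a m)) =
          (\<Sum>m\<in>Poly_Mapping.keys a. Poly_Mapping.single (m + \<beta>) (Poly_Mapping.lookup a m))"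
        by (simp add: sum_distrib_left mult_single add.commute)
      then show ?thesis by (simp flip: poly_mapping_sum_single)
    qed
    also have "\<dots> \<in> I"
    proof (rule ideal_mpol_mult[OF I _ aI])
      show "Poly_Mapping.single \<beta> 1 \<in> polys_in {1..n}"
        using keys\<beta> t_le[of "Suc k"] k by (intro polys_in_single) auto
    qed
    finally show "(\<Sum>m\<in>{m\<in>S. blk m = \<beta>}. ?s m) \<in> I" .
  qed
  finally show ?thesis .
qed

end

context block_action
begin

lemma block_generators:
  assumes k: "k < K"
  shows "\<exists>f a. (\<forall>j\<in>block k. f j \<in> restrict_vars (block k) ` invs (t (Suc k)) \<and> a j \<le> e \<and>
             homogeneous_of_degree (p ^ a j) (f j) \<and> f j \<in> polys_in {1..j} \<and>
             Poly_Mapping.lookup (f j) (Poly_Mapping.single j (p ^ a j)) \<noteq> 0) \<and>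
           (\<forall>I b d. ideal I (mpol_ring n) \<longrightarrow> f ` block k \<subseteq> I \<longrightarrow> b \<in> restrict_vars (block k) ` invs (t (Suc k)) \<longrightarrow>
              homogeneous_of_degree d b \<longrightarrow> d > 0 \<longrightarrow> b \<in> I)"
proof -
  let ?L = "block k" let ?B = "restrict_vars ?L ` invs (t (Suc k))"
  have L: "?L \<subseteq> {1..n}" using t_le[of "Suc k"] k by auto
  have sub: "?B \<subseteq> polys_in ?L"
    using polys_in_restrict_vars[of _ "{1..t (Suc k)}" ?L] by (auto simp: invs_def intro: polys_in_mono)
  have "\<exists>f a. (\<forall>j\<in>?L. f j \<in> ?B \<and> a j \<le> e \<and> homogeneous_of_degree (p ^ a j) (f j) \<and>
             f j \<in> polys_in {..j} \<and> Poly_Mapping.lookup (f j) (Poly_Mapping.single j (p ^ a j)) \<noteq> 0) \<and>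
           (\<forall>I b d. (\<forall>u\<in>I. \<forall>v\<in>I. u + v \<in> I) \<longrightarrow> (\<forall>u\<in>I. \<forall>c\<in>polys_in ?L. c * u \<in> I) \<longrightarrow> 0 \<in> I \<longrightarrow>
              f ` ?L \<subseteq> I \<longrightarrow> b \<in> ?B \<longrightarrow> homogeneous_of_degree d b \<longrightarrow> d > 0 \<longrightarrow> b \<in> I)"
  proof (rule hasse_closed_subalgebra_generators[OF p_prime char _ sub])
    show "finite ?L" by simp
    fix u v assume "u \<in> ?B" "v \<in> ?B"
    then obtain u' v' where *: "u' \<in> invs (t (Suc k))" "v' \<in> invs (t (Suc k))"
      "u = restrict_vars ?L u'" "v = restrict_vars ?L v'" by blast
    have "u' + v' \<in> invs (t (Suc k))" "u' * v' \<in> invs (t (Suc k))"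
      using * by (auto simp: invs_def mpol_const_hom.eval_add mpol_const_hom.eval_mult polys_in_add polys_in_mult)
    then show "u + v \<in> ?B" "u * v \<in> ?B"
      using * by (auto simp: restrict_vars_def simp flip: mpol_const_hom.eval_add mpol_const_hom.eval_mult)
  next
    fix c
    have "mpol_const c \<in> invs (t (Suc k))" by (simp add: invs_def)
    moreover have "mpol_const c = restrict_vars ?L (mpol_const c)" by (simp add: restrict_vars_def)
    ultimately show "mpol_const c \<in> ?B" by blast
  next
    fix u j b assume "u \<in> ?B" "j \<in> ?L"
    then obtain u' where "u' \<in> invs (t (Suc k))" "u = restrict_vars ?L u'" by blast
    then show "hasse j b u \<in> ?B"
      using hasse_restrict_vars[OF \<open>j \<in> ?L\<close>, of b u'] invs_hasse[OF k \<open>j \<in> ?L\<close>, of u' b] by simp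
  next
    fix j assume "j \<in> ?L"
    then show "mpol_var j ^ p ^ e \<in> ?B" using norm_invs[OF k] by (metis image_eqI)
  qed
  then obtain f a where
    1: "\<forall>j\<in>?L. f j \<in> ?B \<and> a j \<le> e \<and> homogeneous_of_degree (p ^ a j) (f j) \<and>
             f j \<in> polys_in {..j} \<and> Poly_Mapping.lookup (f j) (Poly_Mapping.single j (p ^ a j)) \<noteq> 0" and
    2: "\<forall>I b d. (\<forall>u\<in>I. \<forall>v\<in>I. u + v \<in> I) \<longrightarrow> (\<forall>u\<in>I. \<forall>c\<in>polys_in ?L. c * u \<in> I) \<longrightarrow> 0 \<in> I \<longrightarrow>
              f ` ?L \<subseteq> I \<longrightarrow> b \<in> ?B \<longrightarrow> homogeneous_of_degree d b \<longrightarrow> d > 0 \<longrightarrow> b \<in> I"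
    by (elim exE conjE)
  \<comment> \<open>The block excludes index 0, and subduction bounds the variables by j from
    above.\<close>
  have "f j \<in> polys_in {1..j}" if "j \<in> ?L" for j
  proof -
    have "f j \<in> polys_in ?L" "f j \<in> polys_in {..j}" using 1 that sub by auto
    then have "f j \<in> polys_in (?L \<inter> {..j})" by (auto simp: polys_in_def)
    then show ?thesis by (rule polys_in_mono) auto
  qed
  moreover have "b \<in> I" if "ideal I (mpol_ring n)" "f ` ?L \<subseteq> I" "b \<in> ?B" "homogeneous_of_degree d b" "d > 0"
    for I b d
  proof -
    have "\<forall>u\<in>I. \<forall>c\<in>polys_in ?L. c * u \<in> I"
      using ideal_mpol_mult[OF that(1)] polys_in_mono[OF _ L] by blast
    moreover have "\<forall>u\<in>I. \<forall>v\<in>I. u + v \<in> I" using ideal_mpol_add[OF that(1)] by blast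
    ultimately show ?thesis using 2 ideal_mpol_0[OF that(1)] that(2-5) by blast
  qed
  ultimately show ?thesis using 1 by (intro exI[of _ f] exI[of _ a]) blast
qed

theorem hilb_generators:
  "\<exists>f a. hilb = genideal (mpol_ring n) (f ` {1..n}) \<and>
     (\<forall>j\<in>{1..n}. a j \<le> e \<and> homogeneous_of_degree (p ^ a j) (f j) \<and> f j \<in> polys_in {1..j} \<and>
        Poly_Mapping.lookup (f j) (Poly_Mapping.single j (p ^ a j)) \<noteq> 0)"
proof -
  let ?B = "\<lambda>k. restrict_vars (block k) ` invs (t (Suc k))"
  let ?gen = "\<lambda>k f a j. f j \<in> ?B k \<and> a j \<le> e \<and>
             homogeneous_of_degree (p ^ a j) (f j) \<and> f j \<in> polys_in {1..j} \<and>
             Poly_Mapping.lookup (f j) (Poly_Mapping.single j (p ^ a j)) \<noteq> 0"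
  let ?red = "\<lambda>k f. \<forall>I b d. ideal I (mpol_ring n) \<longrightarrow> f ` block k \<subseteq> I \<longrightarrow> b \<in> ?B k \<longrightarrow>
              homogeneous_of_degree d b \<longrightarrow> d > 0 \<longrightarrow> b \<in> I"
  have "\<forall>k. \<exists>f a. k < K \<longrightarrow> (\<forall>j\<in>block k. ?gen k f a j) \<and> ?red k f"
    using block_generators by blast
  then obtain F A where FA: "\<And>k. k < K \<Longrightarrow> (\<forall>j\<in>block k. ?gen k (F k) (A k) j) \<and> ?red k (F k)"
    by metis
  \<comment> \<open>The families are chosen block by block; the unique block containing j glues them
    into one.\<close>
  define kk where "kk j = (SOME k. k < K \<and> j \<in> block k)" for j
  have kk: "kk j = k" if "k < K" "j \<in> block k" for j k
    unfolding kk_def by (rule some_equality) (use that block_unique in blast)+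
  define f where "f j = F (kk j) j" for j
  define a where "a j = A (kk j) j" for j
  have ex: "\<exists>k<K. j \<in> block k" if "j \<in> {1..n}" for j
    using block_exists[of j K] that t_K by auto
  have gen: "?gen k f a j" if "k < K" "j \<in> block k" for k j
    using FA[OF that(1)] that kk[OF that] unfolding f_def a_def by auto
  have red: "?red k f" if "k < K" for k
  proof -
    have "f ` block k = F k ` block k"
      using kk[OF that] unfolding f_def by (intro image_cong) auto
    then show ?thesis using FA[OF that] by simp
  qed
  define J where "J = genideal (mpol_ring n) (f ` {1..n})"
  have fin: "f ` {1..n} \<subseteq> polys_in {1..n}"
  proof
    fix u assume "u \<in> f ` {1..n}"
    then obtain j where j: "j \<in> {1..n}" "u = f j" by blast
    then obtain k where "k < K" "j \<in> block k" using ex by blast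
    then have "f j \<in> polys_in {1..j}" using gen by blast
    then show "u \<in> polys_in {1..n}" using j by (auto intro: polys_in_mono)
  qed
  have J: "ideal J (mpol_ring n)" "f ` {1..n} \<subseteq> J"
    using genideal_mpol[OF fin] by (simp_all add: J_def)
  let ?S = "{f \<in> invs n. \<exists>d>0. homogeneous_of_degree d f}"
  have S: "?S \<subseteq> polys_in {1..n}" by (auto simp: invs_def)
  have H: "ideal hilb (mpol_ring n)" "?S \<subseteq> hilb"
    using genideal_mpol[OF S] by (simp_all add: hilb_def)
  \<comment> \<open>Induction over the number of blocks: the coefficients of u are lower invariants
    and are covered by the induction hypothesis, while the restriction of u to its top block is
    handled by subduction.\<close>
  have "u \<in> J" if "k \<le> K" "u \<in> invs (t k)" "homogeneous_of_degree d u" "d > 0" for k u d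
    using that
  proof (induction k arbitrary: u d)
    case 0
    then have "restrict_vars {} u = 0"
      by (intro restrict_vars_eq_0[of u "{1..0}" _ d]) (auto simp: invs_def t_0)
    moreover have "restrict_vars {1..0} u = u"
      unfolding restrict_vars_def using 0 by (intro mpol_subst_fixes) (auto simp: invs_def t_0)
    ultimately show ?case using ideal_mpol_0[OF J(1)] by simp
  next
    case (Suc k)
    then have k: "k < K" by simp
    let ?\<pi> = "restrict_vars (block k) u"
    have "u - ?\<pi> \<in> J"
    proof (rule invs_diff_restrict_block[OF k Suc.prems(2,3) J(1)])
      show "w \<in> J" if "w \<in> invs (t k)" "homogeneous_of_degree d' w" "d' > 0" for w d'
        using Suc.IH[OF _ that] k by simp
    qed
    moreover have "?\<pi> \<in> J"
    proof -
      have "f ` block k \<subseteq> J" using J(2) t_le[of "Suc k"] k by fastforce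
      then show ?thesis using red[OF k] J(1) Suc.prems homogeneous_restrict_vars by blast
    qed
    ultimately show ?case using ideal_mpol_add[OF J(1)] by fastforce
  qed
  then have "?S \<subseteq> J" using t_K by blast
  then have "hilb \<subseteq> J" unfolding hilb_def by (rule genideal_mpol(3)[OF S J(1)])
  moreover have "f j \<in> hilb" if "j \<in> {1..n}" for j
  proof -
    obtain k where k: "k < K" "j \<in> block k" using ex \<open>j \<in> {1..n}\<close> by blast
    then obtain u where u: "u \<in> invs (t (Suc k))" "f j = restrict_vars (block k) u" using gen by blast
    \<comment> \<open>The invariant lifting \<open>f j\<close> may be inhomogeneous. Its component
      of degree \<open>?d\<close> still restricts to \<open>f j\<close>, and being of positive
      degree it lies in the Hilbert ideal, as does its difference from \<open>f j\<close>.\<close>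
    let ?d = "p ^ a j" let ?v = "hom_component ?d u"
    have d: "?d > 0" using p_prime by (simp add: prime_gt_0_nat)
    have v: "?v \<in> invs (t (Suc k))" using u t_le[of "Suc k"] k by (intro invs_hom_component) auto
    have "f j = hom_component ?d (f j)" using gen[OF k] hom_component_homogeneous by metis
    also have "\<dots> = restrict_vars (block k) ?v" unfolding u(2) by (rule hom_component_restrict_vars)
    finally have fj: "f j = restrict_vars (block k) ?v" .
    have low: "w \<in> hilb" if "w \<in> invs m" "m \<le> n" "homogeneous_of_degree d' w" "d' > 0" for w m d'
      using H(2) invs_mono that by blast
    have "?v \<in> hilb"
      using low[OF v _ homogeneous_hom_component d] t_le[of "Suc k"] k by auto
    moreover have "?v - f j \<in> hilb"
      unfolding fj by (rule invs_diff_restrict_block[OF k(1) v homogeneous_hom_component H(1)])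
        (use low t_le[of k] k in auto)
    ultimately have "?v - (?v - f j) \<in> hilb" by (rule ideal_mpol_diff[OF H(1)])
    then show ?thesis by simp
  qed
  then have "J \<subseteq> hilb" unfolding J_def by (intro genideal_mpol(3)[OF fin H(1)]) auto
  ultimately have "hilb = J" by blast
  then show ?thesis unfolding J_def using gen ex by (intro exI[of _ f] exI[of _ a]) blast
qed

end

section \<open>Chains of prime ideals\<close>

lemma bounded_monomials:
  fixes A :: "nat set"
  assumes "finite A"
  shows "finite {m :: nat \<Rightarrow>\<^sub>0 nat. Poly_Mapping.keys m \<subseteq> A \<and> (\<forall>i. Poly_Mapping.lookup m i \<le> N)}" (is "finite ?M")
    and "card {m :: nat \<Rightarrow>\<^sub>0 nat. Poly_Mapping.keys m \<subseteq> A \<and> (\<forall>i. Poly_Mapping.lookup m i \<le> N)} = Suc N ^ card A"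
proof -
  have "bij_betw (\<lambda>m. restrict (Poly_Mapping.lookup m) A) ?M (A \<rightarrow>\<^sub>E {..N})"
  proof (rule bij_betw_byWitness[where f' = "\<lambda>h. \<Sum>i\<in>A. Poly_Mapping.single i (h i)"])
    show "\<forall>m\<in>?M. (\<Sum>i\<in>A. Poly_Mapping.single i (restrict (Poly_Mapping.lookup m) A i)) = m"
      by (simp add: sum_single_lookup[OF assms])
    show "\<forall>h\<in>A \<rightarrow>\<^sub>E {..N}. restrict (Poly_Mapping.lookup (\<Sum>i\<in>A. Poly_Mapping.single i (h i))) A = h"
      using assms by (auto simp: lookup_sum lookup_single when_def PiE_def extensional_def fun_eq_iff)
    show "(\<lambda>m. restrict (Poly_Mapping.lookup m) A) ` ?M \<subseteq> A \<rightarrow>\<^sub>E {..N}" by auto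
    show "(\<lambda>h. \<Sum>i\<in>A. Poly_Mapping.single i (h i)) ` (A \<rightarrow>\<^sub>E {..N}) \<subseteq> ?M"
      using assms by (auto simp: lookup_sum lookup_single when_def in_keys_iff PiE_def Pi_def split: if_splits)
  qed
  then show "finite ?M" "card ?M = Suc N ^ card A"
    using assms bij_betw_finite[of _ ?M "A \<rightarrow>\<^sub>E {..N}"] bij_betw_same_card[of _ ?M "A \<rightarrow>\<^sub>E {..N}"]
    by (auto simp: finite_PiE card_PiE)
qed

interpretation mpol_vs: vector_space "\<lambda>c f. mpol_const c * f :: 'k::field mpol"
  by standard (simp_all add: algebra_simps mpol_const_add mpol_const_mult)

definition degree_le :: "nat \<Rightarrow> 'k::field mpol \<Rightarrow> bool" where
  "degree_le D f \<longleftrightarrow> (\<forall>m\<in>Poly_Mapping.keys f. mon_degree m \<le> D)"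

lemma degree_le_mult: "degree_le D f \<Longrightarrow> degree_le D' g \<Longrightarrow> degree_le (D + D') (f * g)"
  unfolding degree_le_def
proof
  fix m assume f: "\<forall>m\<in>Poly_Mapping.keys f. mon_degree m \<le> D"
    and g: "\<forall>m\<in>Poly_Mapping.keys g. mon_degree m \<le> D'" and "m \<in> Poly_Mapping.keys (f * g)"
  then obtain a b where "m = a + b" "a \<in> Poly_Mapping.keys f" "b \<in> Poly_Mapping.keys g"
    using keys_mult[of f g] by blast
  then show "mon_degree m \<le> D + D'" using f g by (simp add: mon_degree_add add_mono)
qed

lemma degree_le_1: "degree_le D 1"
  by (simp add: degree_le_def)

lemma degree_le_power: "degree_le D f \<Longrightarrow> degree_le (a * D) (f ^ a)"
  by (induction a) (auto simp: degree_le_1 intro: degree_le_mult)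

lemma degree_le_prod:
  "(\<And>i. i \<in> A \<Longrightarrow> degree_le (D i) (F i)) \<Longrightarrow> degree_le (sum D A) (prod F A)"
  by (induction A rule: infinite_finite_induct) (auto simp: degree_le_1 intro: degree_le_mult)

text \<open>The monomials in \<open>a 0\<close>, ..., \<open>a n\<close> with exponents up to
  \<open>N\<close> grow in number like the power n+1 of \<open>N\<close>, but their values lie in a
  space whose dimension grows only like the power n.\<close>

lemma algebraically_dependent:
  fixes a :: "nat \<Rightarrow> 'k::field mpol"
  assumes a: "\<And>i. i \<le> n \<Longrightarrow> a i \<in> polys_in {1..n}"
  shows "\<exists>Q. Q \<noteq> 0 \<and> Q \<in> polys_in {..n} \<and> mpol_subst a Q = 0"
proof -
  define D where "D = Max (insert 0 (\<Union>i\<in>{..n}. mon_degree ` Poly_Mapping.keys (a i)))"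
  have D: "degree_le D (a i)" if "i \<le> n" for i
    unfolding degree_le_def D_def using that by (auto intro!: Max_ge)
  \<comment> \<open>Chosen so that \<open>Suc ((n + 1) * N * D)\<close> is at most
    \<open>Suc N * C\<close>; taking \<open>N = C ^ n\<close> then bounds \<open>card T\<close> by
    \<open>Suc N ^ n * N\<close>, just below \<open>Suc N ^ (n + 1)\<close>.\<close>
  define C where "C = Suc ((n + 1) * D)"
  define N where "N = C ^ n"
  \<comment> \<open>Bounding each exponent separately makes both cardinalities exact powers.\<close>
  define S where "S = {m :: nat \<Rightarrow>\<^sub>0 nat. Poly_Mapping.keys m \<subseteq> {..n} \<and> (\<forall>i. Poly_Mapping.lookup m i \<le> N)}"
  define T where "T = {m :: nat \<Rightarrow>\<^sub>0 nat. Poly_Mapping.keys m \<subseteq> {1..n} \<and> (\<forall>i. Poly_Mapping.lookup m i \<le> (n + 1) * N * D)}"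
  have fS: "finite S" and cS: "card S = Suc N ^ (n + 1)"
    unfolding S_def using bounded_monomials[of "{..n}" N] by auto
  have fT: "finite T" and cT: "card T = Suc ((n + 1) * N * D) ^ n"
    unfolding T_def using bounded_monomials[of "{1..n}" "(n + 1) * N * D"] by auto
  have "Suc ((n + 1) * N * D) \<le> Suc N * C"
    by (simp add: C_def algebra_simps)
  then have "card T \<le> (Suc N * C) ^ n" unfolding cT by (rule power_mono) simp
  also have "\<dots> = Suc N ^ n * N" unfolding power_mult_distrib N_def ..
  also have "\<dots> < card S" by (simp add: cS)
  finally have card: "card T < card S" .
  let ?v = "monom_eval a"
  let ?T = "(\<lambda>m. Poly_Mapping.single m (1::'k)) ` T"
  have span: "?v m \<in> mpol_vs.span ?T" if m: "m \<in> S" for m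
  proof -
    have keysm: "Poly_Mapping.keys m \<subseteq> {..n}" using m by (simp add: S_def)
    have eq: "?v m = (\<Prod>i\<le>n. a i ^ Poly_Mapping.lookup m i)"
      using keysm by (intro monom_eval_superset) auto
    have "degree_le (\<Sum>i\<le>n. Poly_Mapping.lookup m i * D) (?v m)"
      unfolding eq using D by (intro degree_le_prod degree_le_power) auto
    moreover have "(\<Sum>i\<le>n. Poly_Mapping.lookup m i * D) \<le> (\<Sum>i\<le>n. N * D)"
      using m by (intro sum_mono mult_right_mono) (auto simp: S_def)
    ultimately have deg: "mon_degree k \<le> (n + 1) * N * D" if "k \<in> Poly_Mapping.keys (?v m)" for k
      using that by (fastforce simp: degree_le_def algebra_simps)
    have pin: "?v m \<in> polys_in {1..n}"
      unfolding eq using a by (intro polys_in_prod polys_in_power) auto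
    have "k \<in> T" if "k \<in> Poly_Mapping.keys (?v m)" for k
      using that pin deg[OF that] lookup_le_mon_degree[of k] by (auto simp: T_def polys_in_def intro: le_trans)
    then have "(\<Sum>k\<in>Poly_Mapping.keys (?v m). mpol_const (Poly_Mapping.lookup (?v m) k) * Poly_Mapping.single k 1)
        \<in> mpol_vs.span ?T"
      by (intro mpol_vs.span_sum mpol_vs.span_scale mpol_vs.span_base) auto
    then show ?thesis
      by (simp add: mpol_const_mult_single flip: poly_mapping_sum_single)
  qed
  \<comment> \<open>Linear dependence of the set of values does not see repeated values; two
    monomials with the same value give a relation directly.\<close>
  show ?thesis
  proof (cases "inj_on ?v S")
    case False
    then obtain m m' where m: "m \<in> S" "m' \<in> S" "m \<noteq> m'" "?v m = ?v m'" by (auto simp: inj_on_def)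
    let ?Q = "Poly_Mapping.single m 1 - Poly_Mapping.single m' 1 :: 'k mpol"
    have "Poly_Mapping.lookup ?Q m = 1" using m(3) by (simp add: lookup_minus lookup_single)
    then have "?Q \<noteq> 0" by auto
    moreover have "?Q \<in> polys_in {..n}"
      using m by (intro polys_in_diff polys_in_single) (auto simp: S_def)
    moreover have "mpol_subst a ?Q = 0" using m(4) by (simp add: mpol_const_hom.eval_diff)
    ultimately show ?thesis by blast
  next
    case True
    then have "card (?v ` S) = card S" by (rule card_image)
    moreover have "card ?T \<le> card T" by (rule card_image_le[OF fT])
    ultimately have "mpol_vs.dependent (?v ` S)"
      using mpol_vs.independent_span_bound[of ?T "?v ` S"] span fT card by fastforce
    then obtain u where u: "\<exists>w\<in>?v ` S. u w \<noteq> 0" "(\<Sum>w\<in>?v ` S. mpol_const (u w) * w) = 0"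
      using mpol_vs.dependent_finite[of "?v ` S"] fS by auto
    let ?Q = "\<Sum>m\<in>S. Poly_Mapping.single m (u (?v m))"
    obtain m where m: "m \<in> S" "u (?v m) \<noteq> 0" using u(1) by blast
    have "Poly_Mapping.lookup ?Q m = u (?v m)"
      using m(1) fS by (simp add: lookup_sum lookup_single when_def)
    then have "?Q \<noteq> 0" using m(2) by (metis lookup_zero)
    moreover have "?Q \<in> polys_in {..n}"
      by (intro polys_in_sum polys_in_single) (auto simp: S_def)
    moreover have "mpol_subst a ?Q = 0"
      using u(2) by (simp add: mpol_const_hom.eval_sum sum.reindex[OF True])
    ultimately show ?thesis by blast
  qed
qed

section \<open>Relations along a chain of primes\<close>

lemma split_variable:
  fixes Q :: "'k::field mpol"
  assumes "Q \<in> polys_in V"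
  obtains R where "Q = restrict_vars (V - {l}) Q + mpol_var l * R" "R \<in> polys_in V"
proof -
  let ?K = "{m \<in> Poly_Mapping.keys Q. l \<in> Poly_Mapping.keys m}"
  let ?R = "\<Sum>m\<in>?K. Poly_Mapping.single (m - Poly_Mapping.single l 1) (Poly_Mapping.lookup Q m)"
  have m: "Poly_Mapping.single l 1 + (m - Poly_Mapping.single l 1) = m"
    if "l \<in> Poly_Mapping.keys m" for m :: "nat \<Rightarrow>\<^sub>0 nat"
    by (rule poly_mapping_eqI)
       (use that in \<open>auto simp: lookup_add lookup_minus lookup_single when_def in_keys_iff\<close>)
  have "mpol_var l * ?R = (\<Sum>m\<in>?K. Poly_Mapping.single m (Poly_Mapping.lookup Q m))"
    unfolding sum_distrib_left
    by (rule sum.cong) (use m in \<open>auto simp: mpol_var_def mult_single\<close>)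
  also have "\<dots> = Q - restrict_vars (V - {l}) Q"
  proof (rule poly_mapping_eqI)
    fix m
    have "Poly_Mapping.keys m \<subseteq> V" if "Poly_Mapping.lookup Q m \<noteq> 0"
      using assms that by (auto simp: polys_in_def in_keys_iff)
    then show "Poly_Mapping.lookup (\<Sum>m\<in>?K. Poly_Mapping.single m (Poly_Mapping.lookup Q m)) m =
        Poly_Mapping.lookup (Q - restrict_vars (V - {l}) Q) m"
      by (cases "Poly_Mapping.lookup Q m = 0")
         (auto simp: lookup_sum lookup_single when_def lookup_minus lookup_restrict_vars in_keys_iff)
  qed
  finally have "Q = restrict_vars (V - {l}) Q + mpol_var l * ?R" by simp
  moreover have "?R \<in> polys_in V"
  proof (intro polys_in_sum polys_in_single)
    fix m assume "m \<in> ?K"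
    then have "Poly_Mapping.keys m \<subseteq> V" using assms by (auto simp: polys_in_def)
    then show "Poly_Mapping.keys (m - Poly_Mapping.single l 1) \<subseteq> V"
      by (auto simp: in_keys_iff lookup_minus)
  qed
  ultimately show ?thesis by (rule that)
qed

lemma primeideal_mpol_power:
  assumes "primeideal P (mpol_ring n)" "f \<in> polys_in {1..n}" "f ^ a \<in> P"
  shows "f \<in> P"
  using assms(3)
proof (induction a)
  interpret primeideal P "mpol_ring n" by fact
  case 0
  then show ?case using one_imp_carrier I_notcarr by simp
next
  interpret primeideal P "mpol_ring n" by fact
  case (Suc a)
  then show ?case using I_prime[of f "f ^ a"] assms(2) by (auto simp: polys_in_power)
qed

text \<open>Split \<open>Q\<close> into a part free of x_l and a multiple x_l R. If the first part
  is nonzero, it is the new relation, because \<open>a l\<close> lies in \<open>P'\<close>.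
  Otherwise x_l divides \<open>Q\<close>, and since \<open>a l\<close> is outside the prime
  \<open>P\<close>, R is a relation modulo \<open>P\<close> of smaller degree in x_l.\<close>

lemma prime_chain_step:
  assumes P: "primeideal P (mpol_ring n)" and P': "ideal P' (mpol_ring n)" and "P \<subseteq> P'"
    and a: "\<And>i. i \<le> n \<Longrightarrow> a i \<in> polys_in {1..n}" and al: "a l \<in> P'" "a l \<notin> P" and l: "l \<le> n"
    and Q: "Q \<noteq> 0" "Q \<in> polys_in {l..n}" "mpol_subst a Q \<in> P"
  shows "\<exists>Q'. Q' \<noteq> 0 \<and> Q' \<in> polys_in {Suc l..n} \<and> mpol_subst a Q' \<in> P'"
proof -
  interpret primeideal P "mpol_ring n" by fact
  have ain: "mpol_subst a R \<in> polys_in {1..n}" if "R \<in> polys_in {l..n}" for R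
    using that a by (intro polys_in_subst[of R "{l..n}"]) auto
  have "\<exists>Q'. Q' \<noteq> 0 \<and> Q' \<in> polys_in {Suc l..n} \<and> mpol_subst a Q' \<in> P'"
    if "Q \<noteq> 0" "Q \<in> polys_in {l..n}" "mpol_subst a Q \<in> P"
      "\<And>m. m \<in> Poly_Mapping.keys Q \<Longrightarrow> Poly_Mapping.lookup m l < N" for N Q
    using that
  proof (induction N arbitrary: Q)
    case 0
    then have "Poly_Mapping.keys Q = {}" by blast
    then show ?case using 0 by simp
  next
    case (Suc N)
    let ?V = "{l..n} - {l}"
    obtain R where R: "Q = restrict_vars ?V Q + mpol_var l * R" "R \<in> polys_in {l..n}"
      using split_variable[OF Suc.prems(2)] by blast
    have V: "?V = {Suc l..n}" using l by auto
    show ?case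
    proof (cases "restrict_vars ?V Q = 0")
      case False
      have "restrict_vars ?V Q = Q - mpol_var l * R" using R(1) by (metis add_diff_cancel_right')
      then have "mpol_subst a (restrict_vars ?V Q) = mpol_subst a Q - mpol_subst a R * a l"
        by (simp add: mpol_const_hom.eval_diff mpol_const_hom.eval_mult mult.commute)
      also have "\<dots> \<in> P'"
        using Suc.prems(3) \<open>P \<subseteq> P'\<close> ain[OF R(2)] al
        by (intro ideal_mpol_diff[OF P'] ideal_mpol_mult[OF P']) auto
      finally show ?thesis
        using False polys_in_restrict_vars[OF Suc.prems(2), of ?V] polys_in_mono[of _ "{l..n} \<inter> ?V" "{Suc l..n}"]
        unfolding V by (intro exI[of _ "restrict_vars {Suc l..n} Q"]) auto
    next
      case True
      then have Q: "Q = mpol_var l * R" using R(1) by simp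
      then have "a l * mpol_subst a R \<in> P" using Suc.prems(3) by (simp add: mpol_const_hom.eval_mult)
      then have "mpol_subst a R \<in> P" using I_prime[of "a l" "mpol_subst a R"] al(2) a[OF l] ain[OF R(2)] by auto
      moreover have "R \<noteq> 0" using Q Suc.prems(1) by auto
      moreover have "Poly_Mapping.lookup m l < N" if "m \<in> Poly_Mapping.keys R" for m
      proof -
        have "Poly_Mapping.lookup Q (m + Poly_Mapping.single l 1) = Poly_Mapping.lookup R m"
          unfolding Q using lookup_mult_single_add[of R "Poly_Mapping.single l 1" 1 m]
          by (simp add: mpol_var_def mult.commute)
        then have "m + Poly_Mapping.single l 1 \<in> Poly_Mapping.keys Q" using that by (simp add: in_keys_iff)
        then show ?thesis using Suc.prems(4) by (fastforce simp: lookup_add)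
      qed
      ultimately show ?thesis using Suc.IH[of R] R(2) by blast
    qed
  qed
  moreover have "Poly_Mapping.lookup m l < Suc (Max ((\<lambda>m. Poly_Mapping.lookup m l) ` Poly_Mapping.keys Q))"
    if "m \<in> Poly_Mapping.keys Q" for m
    using that by (simp add: less_Suc_eq_le)
  ultimately show ?thesis using Q by blast
qed

text \<open>If \<open>a\<^sub>i\<close> separates the \<open>i\<close>-th from the next prime, peeling off one variable at a time turns
  an algebraic relation between \<open>a\<^sub>0, \<dots>, a\<^sub>n\<close> into a nonzero constant inside a prime ideal.\<close>

lemma prime_chain_length:
  assumes prime: "\<And>i. i \<le> k \<Longrightarrow> primeideal (c i) (mpol_ring n)"
    and strict: "\<And>i. i < k \<Longrightarrow> c i \<subset> c (Suc i)"
  shows "k \<le> n"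
proof (rule ccontr)
  assume "\<not> k \<le> n"
  then have k: "n < k" by simp
  have id: "ideal (c i) (mpol_ring n)" if "i \<le> k" for i
    using prime[OF that] by (rule primeideal.axioms(1))
  define a where "a i = (SOME x. x \<in> c (Suc i) - c i)" for i
  have a: "a i \<in> c (Suc i) - c i" if "i \<le> n" for i
    unfolding a_def using strict[of i] that k by (intro someI_ex[of "\<lambda>x. x \<in> c (Suc i) - c i"]) auto
  have ac: "a i \<in> polys_in {1..n}" if "i \<le> n" for i
    using a[OF that] ideal_mpol_subset[OF id[of "Suc i"]] that k by auto
  have "\<exists>Q. Q \<noteq> 0 \<and> Q \<in> polys_in {l..n} \<and> mpol_subst a Q \<in> c l" if "l \<le> Suc n" for l
    using that
  proof (induction l)
    case 0
    have "{..n} = {0..n}" by auto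
    then show ?case using algebraically_dependent[of n a] ac ideal_mpol_0[OF id[of 0]] by auto
  next
    case (Suc l)
    then obtain Q where Q: "Q \<noteq> 0" "Q \<in> polys_in {l..n}" "mpol_subst a Q \<in> c l" by auto
    show ?case
      by (rule prime_chain_step[OF prime id _ ac _ _ _ Q]) (use Suc.prems k strict[of l] a[of l] in auto)
  qed
  from this[of "Suc n"] obtain Q where Q: "Q \<noteq> 0" "Q \<in> polys_in {}" "mpol_subst a Q \<in> c (Suc n)"
    by auto
  interpret primeideal "c (Suc n)" "mpol_ring n" using prime k by simp
  have "m = 0" if "m \<in> Poly_Mapping.keys Q" for m
    using Q(2) that by (auto simp: polys_in_def)
  then have "Q = mpol_const (Poly_Mapping.lookup Q 0)"
    unfolding mpol_const_def
    by (intro poly_mapping_eqI) (auto simp: lookup_single when_def in_keys_iff)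
  then obtain u where u: "Q = mpol_const u" "u \<noteq> 0" using Q(1) by (metis mpol_const_0)
  then have "mpol_const (1 / u) * mpol_const u \<in> c (Suc n)"
    using Q(3) k by (intro ideal_mpol_mult[OF id]) auto
  then have "1 \<in> c (Suc n)" using u(2) by (simp flip: mpol_const_mult)
  then show False using one_imp_carrier I_notcarr by simp
qed

section \<open>Triangular systems are complete intersections\<close>

text \<open>The ideal generated by x_1, ..., x_i, encoded as the kernel of setting these variables
  to 0, so that primality follows from the absence of zero divisors. For i = n it is the homogeneous
  maximal ideal.\<close>

definition lower_vars_ideal :: "nat \<Rightarrow> nat \<Rightarrow> 'k::field mpol set" where
  "lower_vars_ideal n i = {f \<in> polys_in {1..n}. restrict_vars {i<..n} f = 0}"

lemma lower_vars_ideal_prime: "primeideal (lower_vars_ideal n i :: 'k::field mpol set) (mpol_ring n)"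
proof (rule primeidealI)
  show "ideal (lower_vars_ideal n i :: 'k mpol set) (mpol_ring n)"
    by (rule ideal_mpol_ringI)
       (auto simp: lower_vars_ideal_def restrict_vars_def mpol_const_hom.eval_add mpol_const_hom.eval_mult
         polys_in_add polys_in_mult)
  show "cring (mpol_ring n)" by (rule cring_mpol_ring)
  have "1 \<in> polys_in {1..n} - (lower_vars_ideal n i :: 'k mpol set)"
    by (simp add: lower_vars_ideal_def restrict_vars_def)
  then show "carrier (mpol_ring n) \<noteq> (lower_vars_ideal n i :: 'k mpol set)" by auto
qed (auto simp: lower_vars_ideal_def restrict_vars_def mpol_const_hom.eval_mult)

lemma lower_vars_ideal_strict:
  assumes "i < n"
  shows "(lower_vars_ideal n i :: 'k::field mpol set) \<subset> lower_vars_ideal n (Suc i)"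
proof
  show "(lower_vars_ideal n i :: 'k::field mpol set) \<subseteq> lower_vars_ideal n (Suc i)"
  proof
    fix f :: "'k mpol" assume f: "f \<in> lower_vars_ideal n i"
    have "Poly_Mapping.lookup f m = 0" if "Poly_Mapping.keys m \<subseteq> {Suc i<..n}" for m
    proof -
      have "Poly_Mapping.keys m \<subseteq> {i<..n}" using that by fastforce
      then have "Poly_Mapping.lookup f m = Poly_Mapping.lookup (restrict_vars {i<..n} f) m"
        by (simp add: lookup_restrict_vars)
      then show ?thesis using f by (simp add: lower_vars_ideal_def)
    qed
    then have "restrict_vars {Suc i<..n} f = 0"
      by (intro poly_mapping_eqI) (simp add: lookup_restrict_vars)
    then show "f \<in> lower_vars_ideal n (Suc i)" using f by (simp add: lower_vars_ideal_def)
  qed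
  have "mpol_var (Suc i) \<noteq> (0 :: 'k mpol)"
    by (metis lookup_single_eq lookup_zero mpol_var_def zero_neq_one)
  then have "mpol_var (Suc i) \<in> lower_vars_ideal n (Suc i) - (lower_vars_ideal n i :: 'k mpol set)"
    using assms by (simp add: lower_vars_ideal_def restrict_vars_def)
  then show "(lower_vars_ideal n i :: 'k mpol set) \<noteq> lower_vars_ideal n (Suc i)" by blast
qed

text \<open>The coordinate flag of ideals is a chain of length n, and no chain of primes is
  longer.\<close>

lemma prime_height_lower_vars_ideal:
  "prime_height (mpol_ring n) (lower_vars_ideal n n :: 'k::field mpol set) = enat n"
proof (rule antisym)
  let ?S = "{k. \<exists>c :: nat \<Rightarrow> 'k mpol set. (\<forall>i \<le> k. primeideal (c i) (mpol_ring n)) \<and>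
                    (\<forall>i < k. c i \<subset> c (Suc i)) \<and> c k = lower_vars_ideal n n}"
  have "k \<le> n" if "k \<in> ?S" for k using that prime_chain_length by blast
  then show "prime_height (mpol_ring n) (lower_vars_ideal n n :: 'k mpol set) \<le> enat n"
    unfolding prime_height_def by (intro SUP_least) simp
  have "n \<in> ?S"
    using lower_vars_ideal_prime lower_vars_ideal_strict
    by (intro CollectI exI[of _ "lower_vars_ideal n"] conjI allI impI refl)
  then show "enat n \<le> prime_height (mpol_ring n) (lower_vars_ideal n n :: 'k mpol set)"
    unfolding prime_height_def by (rule SUP_upper)
qed

section \<open>Homogeneous triangular generators\<close>

locale triangular_system =
  fixes n :: nat and f :: "nat \<Rightarrow> 'k::field mpol" and q :: "nat \<Rightarrow> nat"
  assumes q_pos: "j \<in> {1..n} \<Longrightarrow> q j > 0"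
    and hom: "j \<in> {1..n} \<Longrightarrow> homogeneous_of_degree (q j) (f j)"
    and upto: "j \<in> {1..n} \<Longrightarrow> f j \<in> polys_in {1..j}"
    and lead: "j \<in> {1..n} \<Longrightarrow> Poly_Mapping.lookup (f j) (Poly_Mapping.single j (q j)) \<noteq> 0"
begin

text \<open>Without a lower variable the monomial would be a power of x_j, and homogeneity fixes its
  exponent to \<open>q j\<close>.\<close>

lemma other_monomials:
  assumes j: "j \<in> {1..n}" and m: "m \<in> Poly_Mapping.keys (f j)" "m \<noteq> Poly_Mapping.single j (q j)"
  shows "\<exists>i\<in>{1..<j}. i \<in> Poly_Mapping.keys m"
proof (rule ccontr)
  assume no: "\<not> ?thesis"
  have "Poly_Mapping.keys m \<subseteq> {1..j}" using upto[OF j] m(1) by (auto simp: polys_in_def)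
  then have "Poly_Mapping.keys m \<subseteq> {j}" using no by force
  then have eq: "m = Poly_Mapping.single j (Poly_Mapping.lookup m j)"
    by (intro poly_mapping_eqI) (auto simp: lookup_single when_def in_keys_iff)
  then have "mon_degree m = Poly_Mapping.lookup m j" by (metis mon_degree_single)
  then show False using eq m hom[OF j] by (simp add: homogeneous_of_degree_def)
qed

lemma f_in: "f ` {1..n} \<subseteq> polys_in {1..n}"
proof
  fix u assume "u \<in> f ` {1..n}"
  then obtain j where "j \<in> {1..n}" "u = f j" by blast
  then show "u \<in> polys_in {1..n}" using polys_in_mono[OF upto, of j "{1..n}"] by auto
qed

lemma ideal_subset_max: "genideal (mpol_ring n) (f ` {1..n}) \<subseteq> lower_vars_ideal n n"
proof (rule genideal_mpol(3)[OF f_in])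
  show "ideal (lower_vars_ideal n n :: 'k mpol set) (mpol_ring n)"
    using lower_vars_ideal_prime by (rule primeideal.axioms(1))
  show "f ` {1..n} \<subseteq> lower_vars_ideal n n"
  proof
    fix u assume u: "u \<in> f ` {1..n}"
    then obtain j where j: "j \<in> {1..n}" "u = f j" by blast
    then have "restrict_vars {n<..n} (f j) = 0"
      using restrict_vars_eq_0[OF upto[OF j(1)] _ hom[OF j(1)] q_pos[OF j(1)]] by simp
    then show "u \<in> lower_vars_ideal n n" using j u f_in by (auto simp: lower_vars_ideal_def)
  qed
qed

text \<open>By induction on j the prime contains x_j: modulo the lower variables \<open>f j\<close>
  is a nonzero multiple of a power of x_j. So it contains all variables.\<close>

lemma prime_eq_max:
  assumes P: "primeideal P (mpol_ring n)" and sub: "genideal (mpol_ring n) (f ` {1..n}) \<subseteq> P"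
  shows "P = lower_vars_ideal n n"
proof -
  interpret primeideal P "mpol_ring n" by fact
  note I = is_ideal
  have fP: "f j \<in> P" if "j \<in> {1..n}" for j
    using genideal_mpol(2)[OF f_in] sub that by blast
  have mono: "Poly_Mapping.single m c \<in> P"
    if "i \<in> Poly_Mapping.keys m" "mpol_var i \<in> P" "Poly_Mapping.keys m \<subseteq> {1..n}" for m c i
  proof -
    have "m = (m - Poly_Mapping.single i 1) + Poly_Mapping.single i 1"
      by (rule poly_mapping_eqI)
         (use that(1) in \<open>auto simp: lookup_add lookup_minus lookup_single when_def in_keys_iff\<close>)
    then have "Poly_Mapping.single m c = Poly_Mapping.single (m - Poly_Mapping.single i 1) c * mpol_var i"
      by (simp add: mpol_var_def mult_single)
    moreover have "Poly_Mapping.keys (m - Poly_Mapping.single i 1) \<subseteq> {1..n}"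
      using that(3) by (auto simp: in_keys_iff lookup_minus subset_iff)
    ultimately show ?thesis using ideal_mpol_mult[OF I polys_in_single that(2)] by metis
  qed
  have var: "mpol_var j \<in> P" if "j \<in> {1..n}" for j
    using that
  proof (induction j rule: less_induct)
    case (less j)
    let ?c = "Poly_Mapping.lookup (f j) (Poly_Mapping.single j (q j))"
    let ?K = "Poly_Mapping.keys (f j) - {Poly_Mapping.single j (q j)}"
    let ?r = "\<Sum>m\<in>?K. Poly_Mapping.single m (Poly_Mapping.lookup (f j) m)"
    have r: "?r \<in> P"
    proof (rule ideal_mpol_sum[OF I])
      fix m assume m: "m \<in> ?K"
      then obtain i where i: "i \<in> {1..<j}" "i \<in> Poly_Mapping.keys m"
        using other_monomials[OF less.prems] by blast
      have "f j \<in> polys_in {1..n}" using f_in less.prems by blast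
      then have "Poly_Mapping.keys m \<subseteq> {1..n}" using m by (auto simp: polys_in_def)
      moreover have "mpol_var i \<in> P" using less i by auto
      ultimately show "Poly_Mapping.single m (Poly_Mapping.lookup (f j) m) \<in> P" using mono i(2) by blast
    qed
    have "f j = Poly_Mapping.single (Poly_Mapping.single j (q j)) ?c + ?r"
    proof -
      have "Poly_Mapping.single j (q j) \<in> Poly_Mapping.keys (f j)"
        using lead[OF less.prems] by (simp add: in_keys_iff)
      then have "(\<Sum>m\<in>Poly_Mapping.keys (f j). Poly_Mapping.single m (Poly_Mapping.lookup (f j) m)) =
        Poly_Mapping.single (Poly_Mapping.single j (q j)) ?c + ?r"
        by (intro sum.remove) auto
      then show ?thesis by (simp flip: poly_mapping_sum_single)
    qed
    then have "f j - ?r = Poly_Mapping.single (Poly_Mapping.single j (q j)) ?c" by (rule diff_eq_eq[THEN iffD2])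
    then have "Poly_Mapping.single (Poly_Mapping.single j (q j)) ?c \<in> P"
      using ideal_mpol_diff[OF I fP[OF less.prems] r] by simp
    then have "mpol_const (1 / ?c) * Poly_Mapping.single (Poly_Mapping.single j (q j)) ?c \<in> P"
      by (rule ideal_mpol_mult[OF I polys_in_const])
    then have "mpol_var j ^ q j \<in> P"
      using lead[OF less.prems] by (simp add: mpol_const_mult_single mpol_var_power)
    then show ?case using primeideal_mpol_power[OF P] less.prems by simp
  qed
  have max: "lower_vars_ideal n n \<subseteq> P"
  proof
    fix u :: "'k mpol" assume u: "u \<in> lower_vars_ideal n n"
    have "(\<Sum>m\<in>Poly_Mapping.keys u. Poly_Mapping.single m (Poly_Mapping.lookup u m)) \<in> P"
    proof (rule ideal_mpol_sum[OF I])
      fix m assume m: "m \<in> Poly_Mapping.keys u"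
      have "Poly_Mapping.lookup (restrict_vars {n<..n} u) m = 0" using u by (simp add: lower_vars_ideal_def)
      then have "Poly_Mapping.keys m \<noteq> {}" using m by (auto simp: lookup_restrict_vars in_keys_iff)
      then obtain i where i: "i \<in> Poly_Mapping.keys m" by blast
      have "Poly_Mapping.keys m \<subseteq> {1..n}" using u m by (auto simp: lower_vars_ideal_def polys_in_def)
      then show "Poly_Mapping.single m (Poly_Mapping.lookup u m) \<in> P" using i var mono by blast
    qed
    then show "u \<in> P" by (simp flip: poly_mapping_sum_single)
  qed
  have "P \<subseteq> lower_vars_ideal n n"
  proof
    fix u assume u: "u \<in> P"
    let ?c = "Poly_Mapping.lookup u 0"
    have up: "u \<in> polys_in {1..n}" using u ideal_mpol_subset[OF I] by blast
    have "u - mpol_const ?c \<in> lower_vars_ideal n n"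
      using up by (auto simp: lower_vars_ideal_def polys_in_diff lookup_restrict_vars lookup_minus
          mpol_const_def lookup_single when_def intro!: poly_mapping_eqI polys_in_diff polys_in_single)
    then have "u - (u - mpol_const ?c) \<in> P" using ideal_mpol_diff[OF I u] max by blast
    then have cP: "mpol_const ?c \<in> P" by simp
    \<comment> \<open>A nonzero constant term would make a unit of the field lie in the proper ideal
      \<open>P\<close>.\<close>
    have "?c = 0"
    proof (rule ccontr)
      assume "?c \<noteq> 0"
      then have "1 = mpol_const (1 / ?c) * mpol_const ?c" by (simp flip: mpol_const_mult)
      then have "1 \<in> P" using ideal_mpol_mult[OF I _ cP, of "mpol_const (1 / ?c)"] by simp
      then show False using one_imp_carrier I_notcarr by simp
    qed
    then show "u \<in> lower_vars_ideal n n" using \<open>u - mpol_const ?c \<in> lower_vars_ideal n n\<close> by simp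
  qed
  with max show ?thesis by blast
qed

lemma ideal_height_eq: "ideal_height (mpol_ring n) (genideal (mpol_ring n) (f ` {1..n})) = enat n"
proof -
  have "{P. primeideal P (mpol_ring n) \<and> genideal (mpol_ring n) (f ` {1..n}) \<subseteq> P} = {lower_vars_ideal n n}"
    using prime_eq_max lower_vars_ideal_prime ideal_subset_max by blast
  then show ?thesis unfolding ideal_height_def using prime_height_lower_vars_ideal[of n] by simp
qed

lemma eval_zero_below:
  assumes "j \<in> {1..n}" "\<And>i. i < j \<Longrightarrow> \<phi> i = 0"
  shows "mpol_eval to_ac \<phi> (f j) =
    to_ac (Poly_Mapping.lookup (f j) (Poly_Mapping.single j (q j))) * \<phi> j ^ q j"
proof -
  let ?m = "Poly_Mapping.single j (q j)"
  have "?m \<in> Poly_Mapping.keys (f j)" using lead[OF assms(1)] by (simp add: in_keys_iff)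
  then have "mpol_eval to_ac \<phi> (f j) = to_ac (Poly_Mapping.lookup (f j) ?m) * monom_eval \<phi> ?m +
      (\<Sum>m\<in>Poly_Mapping.keys (f j) - {?m}. to_ac (Poly_Mapping.lookup (f j) m) * monom_eval \<phi> m)"
    unfolding mpol_eval_def by (intro sum.remove) auto
  moreover have "monom_eval \<phi> m = 0" if m: "m \<in> Poly_Mapping.keys (f j) - {?m}" for m
  proof -
    obtain i where "i \<in> {1..<j}" "i \<in> Poly_Mapping.keys m" using other_monomials[OF assms(1)] m by blast
    then show ?thesis
      unfolding monom_eval_def using assms(2) by (intro prod_zero) (auto simp: in_keys_iff intro!: bexI[of _ i])
  qed
  ultimately show ?thesis by simp
qed

text \<open>Over an algebraic closure all \<open>f i\<close> except \<open>f j\<close> have a common zero with \<open>x\<^sub>j = 1\<close>: put the lower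
  variables to 0 and solve successively for the higher ones.\<close>

lemma common_zero:
  assumes j: "j \<in> {1..n}"
  shows "\<exists>\<phi>. (\<forall>i<j. \<phi> i = 0) \<and> \<phi> j = 1 \<and> (\<forall>i\<in>{j<..n}. mpol_eval to_ac \<phi> (f i) = 0)"
proof -
  interpret ac: coeff_hom "to_ac :: 'k \<Rightarrow> _" by standard simp_all
  interpret acp: coeff_hom "\<lambda>c::'k. [:to_ac c:]" by standard (simp_all add: one_pCons)
  have "\<exists>\<phi>. (\<forall>i<j. \<phi> i = 0) \<and> \<phi> j = 1 \<and> (\<forall>i\<in>{j<..k}. mpol_eval to_ac \<phi> (f i) = 0)" if "k \<le> n" for k
    using that
  proof (induction k)
    case 0
    then show ?case by (intro exI[of _ "\<lambda>i. if i = j then 1 else 0"]) simp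
  next
    case (Suc k)
    then obtain \<phi> where \<phi>: "\<forall>i<j. \<phi> i = 0" "\<phi> j = 1" "\<forall>i\<in>{j<..k}. mpol_eval to_ac \<phi> (f i) = 0" by auto
    show ?case
    proof (cases "j \<le> k")
      case False
      then show ?thesis using \<phi> by (intro exI[of _ \<phi>]) auto
    next
      case True
      let ?N = "Suc k"
      have N: "?N \<in> {1..n}" using Suc.prems by simp
      \<comment> \<open>Only the next coordinate stays indeterminate. Every monomial of
        \<open>f ?N\<close> other than the leading one contains a lower variable and hence has
        degree below \<open>q ?N\<close> in x_N; so the leading coefficient survives in
        \<open>W\<close>, which is nonconstant and has a root.\<close>
      define \<psi> where "\<psi> i = (if i = ?N then [:0, 1:] else [:\<phi> i:])" for i
      define W where "W = mpol_eval (\<lambda>c. [:to_ac c:]) \<psi> (f ?N)"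
      have eval: "poly W z = mpol_eval to_ac (\<phi>(?N := z)) (f ?N)" for z
        unfolding W_def
        by (rule hom_eqI[where V = UNIV])
           (simp_all add: acp.eval_add acp.eval_mult ac.eval_add ac.eval_mult \<psi>_def polys_in_def)
      have deg: "degree (monom_eval \<psi> m) \<le> Poly_Mapping.lookup m ?N" for m
      proof -
        have "degree (monom_eval \<psi> m) \<le> sum (degree \<circ> (\<lambda>i. \<psi> i ^ Poly_Mapping.lookup m i)) (Poly_Mapping.keys m)"
          unfolding monom_eval_def by (rule degree_prod_sum_le) simp
        also have "\<dots> \<le> (\<Sum>i\<in>Poly_Mapping.keys m. if i = ?N then Poly_Mapping.lookup m ?N else 0)"
        proof (rule sum_mono)
          fix i
          show "(degree \<circ> (\<lambda>i. \<psi> i ^ Poly_Mapping.lookup m i)) i \<le> (if i = ?N then Poly_Mapping.lookup m ?N else 0)"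
            using degree_power_le[of "\<psi> i" "Poly_Mapping.lookup m i"] by (auto simp: \<psi>_def)
        qed
        also have "\<dots> \<le> Poly_Mapping.lookup m ?N" by simp
        finally show ?thesis .
      qed
      let ?m = "Poly_Mapping.single ?N (q ?N)"
      have "?m \<in> Poly_Mapping.keys (f ?N)" using lead[OF N] by (simp add: in_keys_iff)
      then have "W = [:to_ac (Poly_Mapping.lookup (f ?N) ?m):] * monom_eval \<psi> ?m +
          (\<Sum>m\<in>Poly_Mapping.keys (f ?N) - {?m}. [:to_ac (Poly_Mapping.lookup (f ?N) m):] * monom_eval \<psi> m)"
        unfolding W_def mpol_eval_def by (intro sum.remove) auto
      moreover have "Polynomial.coeff (monom_eval \<psi> m) (q ?N) = 0" if m: "m \<in> Poly_Mapping.keys (f ?N) - {?m}" for m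
      proof (rule coeff_eq_0)
        obtain i where i: "i \<in> {1..<?N}" "i \<in> Poly_Mapping.keys m" using other_monomials[OF N] m by blast
        have "mon_degree m = q ?N" using hom[OF N] m by (auto simp: homogeneous_of_degree_def)
        moreover have "Poly_Mapping.lookup m ?N + Poly_Mapping.lookup m i \<le> mon_degree m"
        proof -
          have "(\<Sum>l\<in>{?N, i}. Poly_Mapping.lookup m l) \<le> (\<Sum>l\<in>Poly_Mapping.keys m \<union> {?N, i}. Poly_Mapping.lookup m l)"
            by (rule sum_mono2) auto
          also have "\<dots> = mon_degree m" by (rule mon_degree_superset[symmetric]) auto
          finally show ?thesis using i by simp
        qed
        ultimately show "degree (monom_eval \<psi> m) < q ?N" using deg[of m] i(2) by (simp add: in_keys_iff)
      qed
      moreover have "Polynomial.coeff (monom_eval \<psi> ?m) (q ?N) = 1"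
        by (simp add: \<psi>_def coeff_linear_power)
      ultimately have "Polynomial.coeff W (q ?N) = to_ac (Poly_Mapping.lookup (f ?N) ?m)"
        by (simp add: coeff_sum)
      then have "degree W \<ge> q ?N" using lead[OF N] by (intro le_degree) simp
      then have "degree W > 0" using q_pos[OF N] by simp
      then obtain z where z: "poly W z = 0" using alg_closed_imp_poly_has_root by blast
      have "mpol_eval to_ac (\<phi>(?N := z)) (f i) = 0" if i: "i \<in> {j<..?N}" for i
      proof (cases "i = ?N")
        case True
        then show ?thesis using z eval by simp
      next
        case False
        \<comment> \<open>The equations solved earlier do not involve the new coordinate.\<close>
        have "mpol_eval to_ac (\<phi>(?N := z)) (f i) = mpol_eval to_ac \<phi> (f i)"
          by (rule mpol_eval_cong[OF upto]) (use i False N j in auto)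
        then show ?thesis using \<phi>(3) i False by simp
      qed
      moreover have "\<forall>i<j. (\<phi>(?N := z)) i = 0" "(\<phi>(?N := z)) j = 1" using \<phi>(1,2) True by auto
      ultimately show ?thesis by blast
    qed
  qed
  then show ?thesis by blast
qed

text \<open>Polynomials vanishing at the common zero form an ideal containing the other generators.
  The value of \<open>f j\<close> there is its leading coefficient, because x_j = 1 and the lower
  coordinates are 0.\<close>

lemma not_in_ideal_of_others:
  assumes j: "j \<in> {1..n}"
  shows "f j \<notin> genideal (mpol_ring n) (f ` ({1..n} - {j}))"
proof
  interpret ac: coeff_hom "to_ac :: 'k \<Rightarrow> _" by standard simp_all
  assume in_ideal: "f j \<in> genideal (mpol_ring n) (f ` ({1..n} - {j}))"
  obtain \<phi> where \<phi>: "\<And>i. i < j \<Longrightarrow> \<phi> i = 0" "\<phi> j = 1" "\<And>i. i \<in> {j<..n} \<Longrightarrow> mpol_eval to_ac \<phi> (f i) = 0"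
    using common_zero[OF j] by blast
  let ?Z = "{u \<in> polys_in {1..n}. mpol_eval to_ac \<phi> u = 0}"
  have "ideal ?Z (mpol_ring n)"
    by (rule ideal_mpol_ringI) (auto simp: ac.eval_add ac.eval_mult polys_in_add polys_in_mult)
  moreover have "f ` ({1..n} - {j}) \<subseteq> ?Z"
  proof
    fix u assume "u \<in> f ` ({1..n} - {j})"
    then obtain i where i: "i \<in> {1..n}" "i \<noteq> j" "u = f i" by blast
    have "mpol_eval to_ac \<phi> (f i) = 0"
    proof (cases "i < j")
      case True
      then show ?thesis using eval_zero_below[of i \<phi>] \<phi>(1) i q_pos by simp
    qed (use \<phi>(3) i in auto)
    then show "u \<in> ?Z" using i f_in by blast
  qed
  moreover have "f ` ({1..n} - {j}) \<subseteq> polys_in {1..n}" using f_in by blast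
  ultimately have "f j \<in> ?Z" using genideal_mpol(3) in_ideal by blast
  then show False using eval_zero_below[OF j \<phi>(1)] \<phi>(2) lead[OF j] by simp
qed

theorem complete_intersection_genideal:
  "complete_intersection n (genideal (mpol_ring n) (f ` {1..n}))"
proof -
  let ?I = "genideal (mpol_ring n) (f ` {1..n})"
  \<comment> \<open>Coinciding generators would put one into the ideal of the others; distinctness
    makes their number equal to the height.\<close>
  have inj: "inj_on f {1..n}"
  proof (rule inj_onI, rule ccontr)
    fix i j assume ij: "i \<in> {1..n}" "j \<in> {1..n}" "f i = f j" "i \<noteq> j"
    have "f i \<in> f ` ({1..n} - {j})" using ij by blast
    moreover have "f ` ({1..n} - {j}) \<subseteq> polys_in {1..n}" using f_in by blast
    ultimately have "f i \<in> genideal (mpol_ring n) (f ` ({1..n} - {j}))" using genideal_mpol(2) by blast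
    then show False using not_in_ideal_of_others[OF ij(2)] ij(3) by simp
  qed
  have "genideal (mpol_ring n) F' \<noteq> ?I" if F': "F' \<subset> f ` {1..n}" for F'
  proof
    assume eq: "genideal (mpol_ring n) F' = ?I"
    obtain j where j: "j \<in> {1..n}" "f j \<notin> F'" using F' by blast
    then have sub: "F' \<subseteq> f ` ({1..n} - {j})" using F' by blast
    have others: "f ` ({1..n} - {j}) \<subseteq> polys_in {1..n}" using f_in by blast
    have "F' \<subseteq> polys_in {1..n}" using F' f_in by blast
    then have "?I \<subseteq> genideal (mpol_ring n) (f ` ({1..n} - {j}))"
      using genideal_mpol(3)[of F' n "genideal (mpol_ring n) (f ` ({1..n} - {j}))"]
        genideal_mpol(1,2)[OF others] sub eq by auto
    then show False using not_in_ideal_of_others[OF j(1)] genideal_mpol(2)[OF f_in] j(1) by blast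
  qed
  then have "minimally_generates (mpol_ring n) (f ` {1..n}) ?I"
    using f_in by (auto simp: minimally_generates_def)
  moreover have "enat (card (f ` {1..n})) = ideal_height (mpol_ring n) ?I"
    using card_image[OF inj] ideal_height_eq by simp
  moreover have "homogeneous_ideal n ?I"
    unfolding homogeneous_ideal_def polys_upto_eq homogeneous_def using f_in hom by blast
  ultimately show ?thesis
    unfolding complete_intersection_def by (intro conjI exI[of _ "f ` {1..n}"]) auto
qed

end

section \<open>The dual representation\<close>

interpretation dual: vector_space "dual_scale :: 'k::field \<Rightarrow> ('v \<Rightarrow> 'k) \<Rightarrow> 'v \<Rightarrow> 'k"
  by standard (auto simp: dual_scale_def fun_eq_iff algebra_simps)

lemma GL_carrier: "g \<in> carrier (GL scale) \<longleftrightarrow> Vector_Spaces.linear scale scale g \<and> bij g"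
  by (simp add: GL_def)

lemma GL_simps [simp]:
  "monoid.mult (GL scale) = (\<circ>)" "one (GL scale) = id"
  by (simp_all add: GL_def)

lemma
  fixes scale :: "'k::field \<Rightarrow> 'v::ab_group_add \<Rightarrow> 'v"
  assumes "vector_space scale"
  shows group_GL: "group (GL scale)"
    and inv_GL: "g \<in> carrier (GL scale) \<Longrightarrow> inv\<^bsub>GL scale\<^esub> g = inv_into UNIV g"
proof -
  have inv: "inv_into UNIV g \<in> carrier (GL scale)" "inv_into UNIV g \<circ> g = id"
    if g: "g \<in> carrier (GL scale)" for g
  proof -
    have b: "bij g" and l: "Vector_Spaces.linear scale scale g" using g by (auto simp: GL_carrier)
    have gi: "g (inv_into UNIV g y) = y" and ig: "inv_into UNIV g (g y) = y" for y
      using b by (simp_all add: bij_def surj_f_inv_f)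
    have "inv_into UNIV g (u + v) = inv_into UNIV g u + inv_into UNIV g v" for u v
      using l ig[of "inv_into UNIV g u + inv_into UNIV g v"] by (simp add: Vector_Spaces.linear_iff gi)
    moreover have "inv_into UNIV g (scale c u) = scale c (inv_into UNIV g u)" for c u
      using l ig[of "scale c (inv_into UNIV g u)"] by (simp add: Vector_Spaces.linear_iff gi)
    ultimately show "inv_into UNIV g \<in> carrier (GL scale)"
      using assms bij_imp_bij_inv[OF b] by (simp add: GL_carrier Vector_Spaces.linear_iff)
    show "inv_into UNIV g \<circ> g = id" using ig by (simp add: fun_eq_iff)
  qed
  show grp: "group (GL scale)"
  proof (rule groupI)
    show "\<exists>h\<in>carrier (GL scale). h \<otimes>\<^bsub>GL scale\<^esub> g = \<one>\<^bsub>GL scale\<^esub>" if "g \<in> carrier (GL scale)" for g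
      using inv[OF that]by auto
  qed (use assms in \<open>auto simp: GL_carrier Vector_Spaces.linear_iff intro: bij_comp\<close>)
  show "inv\<^bsub>GL scale\<^esub> g = inv_into UNIV g" if "g \<in> carrier (GL scale)" for g
    using group.inv_equality[OF grp _ that inv(1)[OF that]] inv(2)[OF that] by simp
qed

lemma dual_act_id [simp]: "dual_act id \<phi> = \<phi>"
  by (simp add: dual_act_def)

lemma dual_act_comp: "bij g \<Longrightarrow> bij h \<Longrightarrow> dual_act (g \<circ> h) \<phi> = dual_act g (dual_act h \<phi>)"
  by (simp add: dual_act_def o_inv_distrib)

lemma dual_act_diff: "dual_act g (\<phi> - \<psi>) = dual_act g \<phi> - dual_act g \<psi>"
  by (simp add: dual_act_def fun_eq_iff)

lemma dual_act_scale: "dual_act g (dual_scale c \<phi>) = dual_scale c (dual_act g \<phi>)"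
  by (simp add: dual_act_def dual_scale_def)

lemma dual_act_sum: "dual_act g (\<Sum>i\<in>A. \<Phi> i) = (\<Sum>i\<in>A. dual_act g (\<Phi> i))"
  by (induction A rule: infinite_finite_induct) (simp_all add: dual_act_def fun_eq_iff)

locale dual_basis =
  fixes scale :: "'k::field \<Rightarrow> 'v::ab_group_add \<Rightarrow> 'v" and n :: nat and x :: "nat \<Rightarrow> 'v \<Rightarrow> 'k"
  assumes vs: "vector_space scale" and basis: "ordered_dual_basis scale n x"
begin

lemma inj: "inj_on x {1..n}" and indep: "dual.independent (x ` {1..n})"
  and span: "dual.span (x ` {1..n}) = dual_space scale"
  using basis by (auto simp: ordered_dual_basis_def)

lemma x_in: "i \<in> {1..n} \<Longrightarrow> x i \<in> dual_space scale"
  unfolding span[symmetric] by (rule dual.span_base) simp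

lemma dual_act_in:
  assumes "g \<in> carrier (GL scale)" "\<phi> \<in> dual_space scale"
  shows "dual_act g \<phi> \<in> dual_space scale"
proof -
  have "inv_into UNIV g \<in> carrier (GL scale)"
    using group.inv_closed[OF group_GL[OF vs] assms(1)] inv_GL[OF vs assms(1)] by simp
  then show ?thesis
    using assms(2) by (auto simp: GL_carrier dual_space_def dual_act_def Vector_Spaces.linear_iff)
qed

lemma expand:
  assumes "\<phi> \<in> dual_space scale"
  shows "(\<Sum>j = 1..n. dual_scale (dual_coeff n x \<phi> j) (x j)) = \<phi>"
  using dual.sum_representation_eq[OF indep, of \<phi> "x ` {1..n}"] assms span
  by (simp add: sum.reindex[OF inj] dual_coeff_def del: One_nat_def)

lemma linear_form_x: "i \<in> {1..n} \<Longrightarrow> linear_form n x (x i) = mpol_var i"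
proof -
  assume i: "i \<in> {1..n}"
  have "dual_coeff n x (x i) j = (if j = i then 1 else 0)" if "j \<in> {1..n}" for j
    using dual.representation_basis[OF indep imageI[OF i]] inj_on_eq_iff[OF inj that i]
    by (simp add: dual_coeff_def)
  then have "linear_form n x (x i) = (\<Sum>j = 1..n. if j = i then mpol_var j else 0)"
    unfolding linear_form_def by (intro sum.cong) auto
  then show ?thesis using i by simp
qed

lemma linear_form_diff:
  assumes "\<phi> \<in> dual_space scale" "\<psi> \<in> dual_space scale"
  shows "linear_form n x (\<phi> - \<psi>) = linear_form n x \<phi> - linear_form n x \<psi>"
proof -
  have "mpol_const (a - b) = mpol_const a - (mpol_const b :: 'k mpol)" for a b
    by (simp add: mpol_const_def single_diff)
  then show ?thesis
    using assms dual.representation_diff[OF indep, of \<psi> \<phi>] span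
    by (simp add: linear_form_def dual_coeff_def left_diff_distrib sum_subtractf)
qed

lemma linear_form_comb:
  assumes "\<And>i. i \<in> A \<Longrightarrow> \<Phi> i \<in> dual_space scale"
  shows "linear_form n x (\<Sum>i\<in>A. dual_scale (c i) (\<Phi> i)) = (\<Sum>i\<in>A. mpol_const (c i) * linear_form n x (\<Phi> i))"
proof -
  have const_sum: "mpol_const (sum h A) = (\<Sum>i\<in>A. mpol_const (h i) :: 'k mpol)" for h
    by (induction A rule: infinite_finite_induct) (simp_all add: mpol_const_add)
  have coeff: "dual_coeff n x (\<Sum>i\<in>A. dual_scale (c i) (\<Phi> i)) j = (\<Sum>i\<in>A. c i * dual_coeff n x (\<Phi> i) j)" for j
  proof -
    have in_span: "\<Phi> i \<in> dual.span (x ` {1..n})" if "i \<in> A" for i using assms that span by simp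
    have "dual_coeff n x (\<Sum>i\<in>A. dual_scale (c i) (\<Phi> i)) j =
        (\<Sum>i\<in>A. dual.representation (x ` {1..n}) (dual_scale (c i) (\<Phi> i)) (x j))"
      unfolding dual_coeff_def
      by (subst dual.representation_sum[OF indep]) (use in_span dual.span_scale in auto)
    also have "\<dots> = (\<Sum>i\<in>A. c i * dual_coeff n x (\<Phi> i) j)"
      unfolding dual_coeff_def
      by (rule sum.cong[OF refl]) (subst dual.representation_scale[OF indep in_span], auto)
    finally show ?thesis .
  qed
  have "linear_form n x (\<Sum>i\<in>A. dual_scale (c i) (\<Phi> i)) =
      (\<Sum>j = 1..n. \<Sum>i\<in>A. mpol_const (c i) * (mpol_const (dual_coeff n x (\<Phi> i) j) * mpol_var j))"
    unfolding linear_form_def coeff const_sum mpol_const_mult sum_distrib_right mult.assoc ..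
  also have "\<dots> = (\<Sum>i\<in>A. \<Sum>j = 1..n. mpol_const (c i) * (mpol_const (dual_coeff n x (\<Phi> i) j) * mpol_var j))"
    by (rule sum.swap)
  finally show ?thesis unfolding linear_form_def[of n x "\<Phi> _"] sum_distrib_left .
qed

lemma linear_form_homogeneous: "homogeneous_of_degree 1 (linear_form n x \<phi>)"
  unfolding linear_form_def
  using homogeneous_mult[OF homogeneous_const homogeneous_var] by (intro homogeneous_sum) simp

text \<open>Coordinates with respect to x_1, ..., x_m agree with those in the full basis, so the
  ones beyond m vanish.\<close>

lemma linear_form_polys_in:
  assumes "\<phi> \<in> dual.span (x ` {1..m})" "m \<le> n"
  shows "linear_form n x \<phi> \<in> polys_in {1..m}"
  unfolding linear_form_def
proof (rule polys_in_sum)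
  fix j assume j: "j \<in> {1..n}"
  have sub: "x ` {1..m} \<subseteq> x ` {1..n}" using assms(2) by auto
  have "dual_coeff n x \<phi> j = 0" if "\<not> j \<le> m"
  proof -
    have "x j \<notin> x ` {1..m}" using inj_on_image_mem_iff[OF inj j, of "{1..m}"] that assms(2) by auto
    then show ?thesis
      unfolding dual_coeff_def dual.representation_extend[OF indep assms(1) sub]
      using dual.representation_ne_zero by blast
  qed
  then show "mpol_const (dual_coeff n x \<phi> j) * mpol_var j \<in> polys_in {1..m}"
    using j by (cases "j \<le> m") (auto intro: polys_in_mult)
qed

section \<open>The action as a substitution\<close>

definition act :: "('v \<Rightarrow> 'v) \<Rightarrow> nat \<Rightarrow> 'k mpol" where
  "act g i = linear_form n x (dual_act g (x i))"

lemma sym_act_eq: "sym_act n x g = mpol_subst (act g)"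
  by (simp add: fun_eq_iff sym_act_def mpol_eval_def monom_eval_def act_def)

text \<open>Expanding \<phi> in the basis and using linearity of the dual action shows that the
  substitution, given by its values on basis vectors, induces the action on all of the dual space.
  Compatibility with composition follows.\<close>

lemma subst_linear_form:
  assumes "g \<in> carrier (GL scale)" "\<phi> \<in> dual_space scale"
  shows "mpol_subst (act g) (linear_form n x \<phi>) = linear_form n x (dual_act g \<phi>)"
proof -
  have "mpol_subst (act g) (linear_form n x \<phi>) =
      (\<Sum>j = 1..n. mpol_const (dual_coeff n x \<phi> j) * linear_form n x (dual_act g (x j)))"
    by (simp add: linear_form_def[of n x \<phi>] mpol_const_hom.eval_sum mpol_const_hom.eval_mult act_def)
  also have "\<dots> = linear_form n x (\<Sum>j = 1..n. dual_scale (dual_coeff n x \<phi> j) (dual_act g (x j)))"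
    using dual_act_in[OF assms(1) x_in] by (intro linear_form_comb[symmetric]) auto
  also have "(\<Sum>j = 1..n. dual_scale (dual_coeff n x \<phi> j) (dual_act g (x j))) = dual_act g \<phi>"
    using arg_cong[OF expand[OF assms(2)], of "dual_act g"] by (simp add: dual_act_sum dual_act_scale)
  finally show ?thesis .
qed

lemma act_comp:
  assumes "g \<in> carrier (GL scale)" "h \<in> carrier (GL scale)" "i \<in> {1..n}"
  shows "mpol_subst (act g) (act h i) = act (g \<circ> h) i"
  using subst_linear_form[OF assms(1) dual_act_in[OF assms(2) x_in[OF assms(3)]]] assms
  by (simp add: act_def dual_act_comp GL_carrier)

lemma subst_act_comp:
  assumes "g \<in> carrier (GL scale)" "h \<in> carrier (GL scale)" "f \<in> polys_in {1..n}"
  shows "mpol_subst (act (g \<circ> h)) f = mpol_subst (act g) (mpol_subst (act h) f)"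
  by (rule hom_eqI[OF _ _ _ _ _ _ _ _ assms(3)])
     (simp_all only: mpol_const_hom.eval_add mpol_const_hom.eval_mult mpol_const_hom.eval_var
       mpol_const_hom.eval_const mpol_const_hom.eval_1 act_comp[OF assms(1,2)])

lemma act_id: "i \<in> {1..n} \<Longrightarrow> act id i = mpol_var i"
  by (simp add: act_def linear_form_x)

text \<open>Lets invariance under generators pass to all of \<open>G\<close>.\<close>

lemma stabilizer_subgroup:
  assumes G: "subgroup G (GL scale)" and f: "f \<in> polys_in {1..n}"
  shows "subgroup {g \<in> G. mpol_subst (act g) f = f} (GL scale)"
proof -
  interpret GL: group "GL scale" by (rule group_GL[OF vs])
  interpret subgroup G "GL scale" by fact
  have fid: "mpol_subst (act id) f = f" using f act_id by (rule mpol_subst_fixes)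
  show ?thesis
  proof (rule GL.subgroupI)
    show "{g \<in> G. mpol_subst (act g) f = f} \<noteq> {}" using fid one_closed by auto
    fix g assume "g \<in> {g \<in> G. mpol_subst (act g) f = f}"
    then have g: "g \<in> G" "mpol_subst (act g) f = f" by auto
    have i: "inv\<^bsub>GL scale\<^esub> g \<in> G" using g(1) by (rule m_inv_closed)
    have "inv\<^bsub>GL scale\<^esub> g \<circ> g = id" using GL.l_inv[of g] g(1) by simp
    then have "f = mpol_subst (act (inv\<^bsub>GL scale\<^esub> g \<circ> g)) f" using fid by simp
    also have "\<dots> = mpol_subst (act (inv\<^bsub>GL scale\<^esub> g)) (mpol_subst (act g) f)"
      using i g(1) f by (intro subst_act_comp) auto
    finally show "inv\<^bsub>GL scale\<^esub> g \<in> {g \<in> G. mpol_subst (act g) f = f}" using i g(2) by simp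
    fix h assume "h \<in> {g \<in> G. mpol_subst (act g) f = f}"
    then have h: "h \<in> G" "mpol_subst (act h) f = f" by auto
    have "mpol_subst (act (g \<circ> h)) f = f" using subst_act_comp[of g h f] g h f by simp
    moreover have "g \<circ> h \<in> G" using m_closed[OF g(1) h(1)] by simp
    ultimately show "g \<otimes>\<^bsub>GL scale\<^esub> h \<in> {g \<in> G. mpol_subst (act g) f = f}" by simp
  qed auto
qed

end

section \<open>Generalised Nakajima groups\<close>

locale nakajima = dual_basis scale n x
  for scale :: "'k::field \<Rightarrow> 'v::ab_group_add \<Rightarrow> 'v" and n :: nat and x :: "nat \<Rightarrow> 'v \<Rightarrow> 'k" +
  fixes G :: "('v \<Rightarrow> 'v) set" and r :: nat and s :: "nat \<Rightarrow> nat"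
  assumes G: "subgroup G (GL scale)" and seq: "gen_nakajima_sequence scale n G x r s"
begin

sublocale GL: group "GL scale" by (rule group_GL[OF vs])
sublocale G: subgroup G "GL scale" by (rule G)

text \<open>The variables up to \<open>i\<^sub>0\<close> and those above \<open>i\<^sub>r\<close>, all fixed by \<open>G\<close>, form two
  additional blocks.\<close>

definition t :: "nat \<Rightarrow> nat" where
  "t k = (if k = 0 then 0 else if k \<le> Suc r then s (k - 1) else n)"

text \<open>The set of generators of \<open>nakajima_part\<close>, before closing under
  products.\<close>

definition elem :: "nat \<Rightarrow> ('v \<Rightarrow> 'v) set" where
  "elem k = {g \<in> G. \<forall>i \<in> {1..n}. dual_act g (x i) \<noteq> x i \<longrightarrow>
                 s (k - 1) < i \<and> i \<le> s k \<and> beta n x g \<le> s (k - 1)}"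

lemma elem_subset: "elem k \<subseteq> G"
  by (auto simp: elem_def)

lemma s_mono: "i \<le> j \<Longrightarrow> j \<le> r \<Longrightarrow> s i \<le> s j"
proof (induction j)
  case (Suc j)
  have "s j < s (Suc j)" using seq Suc.prems by (auto simp: gen_nakajima_sequence_def)
  then show ?case using Suc by (cases "i = Suc j") auto
qed simp

lemma t_mono: "k \<le> k' \<Longrightarrow> k' \<le> Suc (Suc r) \<Longrightarrow> t k \<le> t k'"
proof -
  assume k: "k \<le> k'" "k' \<le> Suc (Suc r)"
  have "s r \<le> n" using seq by (simp add: gen_nakajima_sequence_def)
  moreover have "s (k - 1) \<le> s r" if "k \<le> Suc r" using that by (intro s_mono) auto
  moreover have "s (k - 1) \<le> s (k' - 1)" if "k' \<le> Suc r" using that k(1) by (intro s_mono) auto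
  ultimately show ?thesis using k by (auto simp: t_def)
qed

lemma t_0: "t 0 = 0" and t_last: "t (Suc (Suc r)) = n"
  by (simp_all add: t_def)

text \<open>Index shift: block 0 holds the variables up to \<open>s 0\<close>, so block
  \<open>k\<close> is the k-th interval of the sequence, and there are r+2 blocks in all.\<close>

lemma t_elem: "k \<in> {1..r} \<Longrightarrow> t k = s (k - 1) \<and> t (Suc k) = s k"
  by (auto simp: t_def)

lemma t_le: "k \<le> Suc (Suc r) \<Longrightarrow> t k \<le> n"
  using t_mono[of k "Suc (Suc r)"] t_last by simp

text \<open>Collapses the two layers of generation: a subgroup containing the sets
  \<open>elem k\<close> contains every part and then the group generated by the parts.\<close>

lemma G_subset_if:
  assumes "subgroup H (GL scale)" "\<And>k. k \<in> {1..r} \<Longrightarrow> elem k \<subseteq> H"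
  shows "G \<subseteq> H"
proof -
  have "nakajima_part scale n G x s k \<subseteq> H" if "k \<in> {1..r}" for k
    unfolding nakajima_part_def
    using GL.generate_subgroup_incl[OF assms(2)[OF that] assms(1)] by (simp add: elem_def)
  then have "(\<Union>k\<in>{1..r}. nakajima_part scale n G x s k) \<subseteq> H" by blast
  then have "generate (GL scale) (\<Union>k\<in>{1..r}. nakajima_part scale n G x s k) \<subseteq> H"
    using assms(1) by (rule GL.generate_subgroup_incl)
  then show ?thesis using seq by (simp add: gen_nakajima_sequence_def)
qed

text \<open>Condition (a) makes every step of the coordinate flag stable under
  \<open>G\<close>.\<close>

lemma dual_act_span:
  assumes g: "g \<in> G" and m: "m \<le> n" and \<phi>: "\<phi> \<in> dual.span (x ` {1..m})"
  shows "dual_act g \<phi> \<in> dual.span (x ` {1..m})"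
proof -
  have *: "dual_act g (x i) \<in> dual.span (x ` {1..m})" if "i \<in> {1..m}" for i
  proof -
    have "dual_act g (x i) - x i \<in> dual.span (x ` {1..<i})"
      using seq g that m by (auto simp: gen_nakajima_sequence_def)
    moreover have "x ` {1..<i} \<subseteq> x ` {1..m}" using that by auto
    ultimately have "dual_act g (x i) - x i \<in> dual.span (x ` {1..m})" using dual.span_mono by blast
    then have "(dual_act g (x i) - x i) + x i \<in> dual.span (x ` {1..m})"
      by (rule dual.span_add) (use that in \<open>auto intro: dual.span_base\<close>)
    then show ?thesis by simp
  qed
  show ?thesis
    using \<phi>
  proof (induction rule: dual.span_induct_alt)
    case base
    have "dual_act g 0 = (0 :: 'v \<Rightarrow> 'k)" by (simp add: dual_act_def fun_eq_iff)
    then show ?case using dual.span_zero[of "x ` {1..m}"] by (simp only:)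
  next
    case (step c b y)
    have "dual_act g (dual_scale c b + y) = dual_scale c (dual_act g b) + dual_act g y"
      by (simp add: dual_act_def dual_scale_def fun_eq_iff)
    moreover have "dual_act g b \<in> dual.span (x ` {1..m})" using step(1) * by blast
    ultimately show ?case
      using dual.span_add[OF dual.span_scale step(2), of "dual_act g b" c] by (simp only:)
  qed
qed

text \<open>Stronger than condition (a): a variable is displaced into the blocks strictly below its
  own, not merely into preceding variables. This set turns out to be all of
  \<open>G\<close>.\<close>

definition lowering :: "('v \<Rightarrow> 'v) set" where
  "lowering = {g \<in> G. \<forall>k<Suc (Suc r). \<forall>i\<in>{t k<..t (Suc k)}.
     dual_act g (x i) - x i \<in> dual.span (x ` {1..t k})}"

text \<open>For products, ghx - x = g(hx - x) + (gx - x); for inverses, applying the inverse h of g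
  to gx - x gives x - hx. Both stay in the span of the lower blocks, which \<open>G\<close>
  preserves.\<close>

lemma lowering_subgroup: "subgroup lowering (GL scale)"
proof (rule GL.subgroupI)
  show "lowering \<subseteq> carrier (GL scale)" using G.subset by (auto simp: lowering_def)
  have "id \<in> G" using G.one_closed by simp
  then show "lowering \<noteq> {}" by (auto simp: lowering_def dual.span_zero intro!: exI[of _ id])
  fix g assume g: "g \<in> lowering"
  then have gG: "g \<in> G" by (simp add: lowering_def)
  then have gc: "g \<in> carrier (GL scale)" by (rule G.mem_carrier)
  have iG: "inv\<^bsub>GL scale\<^esub> g \<in> G" using gG by (rule G.m_inv_closed)
  then have ic: "inv\<^bsub>GL scale\<^esub> g \<in> carrier (GL scale)" by (rule G.mem_carrier)
  have bij: "bij g" "bij (inv\<^bsub>GL scale\<^esub> g)" using gc ic by (simp_all add: GL_carrier)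
  have inv_id: "inv\<^bsub>GL scale\<^esub> g \<circ> g = id" using GL.l_inv[OF gc] by simp
  have "dual_act (inv\<^bsub>GL scale\<^esub> g) (x i) - x i \<in> dual.span (x ` {1..t k})"
    if k: "k < Suc (Suc r)" "i \<in> {t k<..t (Suc k)}" for k i
  proof -
    let ?h = "inv\<^bsub>GL scale\<^esub> g"
    have "dual_act ?h (dual_act g (x i) - x i) \<in> dual.span (x ` {1..t k})"
      using g k t_le[of k] iG by (intro dual_act_span) (auto simp: lowering_def)
    also have "dual_act ?h (dual_act g (x i) - x i) = x i - dual_act ?h (x i)"
      using dual_act_comp[OF bij(2,1), of "x i"] inv_id by (simp add: dual_act_diff)
    finally have "- (x i - dual_act ?h (x i)) \<in> dual.span (x ` {1..t k})" by (rule dual.span_neg)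
    then show ?thesis by simp
  qed
  then show "inv\<^bsub>GL scale\<^esub> g \<in> lowering" using iG by (simp add: lowering_def)
  fix h assume h: "h \<in> lowering"
  then have hG: "h \<in> G" by (simp add: lowering_def)
  have hb: "bij h" using G.mem_carrier[OF hG] by (simp add: GL_carrier)
  have "dual_act (g \<circ> h) (x i) - x i \<in> dual.span (x ` {1..t k})"
    if k: "k < Suc (Suc r)" "i \<in> {t k<..t (Suc k)}" for k i
  proof -
    have "dual_act g (dual_act h (x i) - x i) \<in> dual.span (x ` {1..t k})"
      using h k t_le[of k] gG by (intro dual_act_span) (auto simp: lowering_def)
    moreover have "dual_act g (x i) - x i \<in> dual.span (x ` {1..t k})"
      using g k by (auto simp: lowering_def)
    ultimately have "dual_act g (dual_act h (x i) - x i) + (dual_act g (x i) - x i) \<in> dual.span (x ` {1..t k})"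
      by (rule dual.span_add)
    then show ?thesis by (simp add: dual_act_diff dual_act_comp[OF bij(1) hb])
  qed
  moreover have "g \<circ> h \<in> G" using G.m_closed[OF gG hG] by simp
  ultimately show "g \<otimes>\<^bsub>GL scale\<^esub> h \<in> lowering" by (simp add: lowering_def)
qed

lemma coeff_le_beta:
  assumes "i \<in> {1..n}" "j \<in> {1..n}" "dual_act g (x i) \<noteq> x i"
    and "dual_coeff n x (dual_act g (x i) - x i) j \<noteq> 0"
  shows "j \<le> beta n x g"
proof -
  have "g \<noteq> id" using assms(3) by auto
  moreover have "j \<le> Max {j \<in> {1..n}. \<exists>i \<in> {1..n}. dual_coeff n x (dual_act g (x i) - x i) j \<noteq> 0}"
    by (rule Max_ge) (use assms in auto)
  ultimately show ?thesis by (simp add: beta_def)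
qed

text \<open>A moved variable has index above \<open>s (k - 1)\<close>, so it lies in block
  \<open>k\<close> or higher. The displacement involves only indices up to
  \<open>beta n x g\<close>, hence up to \<open>s (k - 1)\<close>, the lower end of block
  \<open>k\<close>.\<close>

lemma elem_lowering:
  assumes k: "k \<in> {1..r}"
  shows "elem k \<subseteq> lowering"
proof
  fix g assume g: "g \<in> elem k"
  then have gG: "g \<in> G" by (simp add: elem_def)
  have "dual_act g (x i) - x i \<in> dual.span (x ` {1..t l})"
    if l: "l < Suc (Suc r)" and i: "i \<in> {t l<..t (Suc l)}" for l i
  proof (cases "dual_act g (x i) = x i")
    case True
    then show ?thesis by (simp add: dual.span_zero)
  next
    case False
    have inn: "i \<in> {1..n}" using i l t_le[of "Suc l"] by auto
    have gi: "s (k - 1) < i" "i \<le> s k" "beta n x g \<le> s (k - 1)"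
      using g inn False by (auto simp: elem_def)
    have "k \<le> l" using t_mono[of "Suc l" k] gi(1) i t_elem[OF k] k by (cases "k \<le> l") auto
    then have tl: "s (k - 1) \<le> t l" using t_mono[of k l] l t_elem[OF k] by simp
    let ?\<phi> = "dual_act g (x i) - x i"
    have "?\<phi> \<in> dual.span (x ` {1..n})"
      using dual_act_in[OF G.mem_carrier[OF gG] x_in[OF inn]] x_in[OF inn] dual.span_diff
      unfolding span[symmetric] by blast
    then have eq: "(\<Sum>j = 1..n. dual_scale (dual_coeff n x ?\<phi> j) (x j)) = ?\<phi>"
      using expand span by blast
    have "(\<Sum>j = 1..n. dual_scale (dual_coeff n x ?\<phi> j) (x j)) \<in> dual.span (x ` {1..t l})"
    proof (rule dual.span_sum)
      fix j assume j: "j \<in> {1..n}"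
      show "dual_scale (dual_coeff n x ?\<phi> j) (x j) \<in> dual.span (x ` {1..t l})"
      proof (cases "dual_coeff n x ?\<phi> j = 0")
        case True
        then show ?thesis by (simp add: dual.span_zero)
      next
        case nz: False
        have "j \<le> t l" using coeff_le_beta[OF inn j False nz] gi(3) tl by simp
        then show ?thesis using j by (intro dual.span_scale dual.span_base) auto
      qed
    qed
    then show ?thesis unfolding eq .
  qed
  then show "g \<in> lowering" using gG by (simp add: lowering_def)
qed

lemma block_action:
  assumes p: "Factorial_Ring.prime p" "CHAR('k) = p" and fin: "finite G" and card: "card G = p ^ e"
  shows "block_action n (Suc (Suc r)) t G (\<Union>k\<in>{1..r}. elem k) act p e"
proof
  fix g k i assume g: "g \<in> G" and k: "k < Suc (Suc r)" and i: "i \<in> {t k<..t (Suc k)}"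
  have inn: "i \<in> {1..n}" using i k t_le[of "Suc k"] by auto
  have "G \<subseteq> lowering" by (rule G_subset_if[OF lowering_subgroup elem_lowering])
  then have "dual_act g (x i) - x i \<in> dual.span (x ` {1..t k})" using g k i by (auto simp: lowering_def)
  then have "linear_form n x (dual_act g (x i) - x i) \<in> polys_in {1..t k}"
    using t_le[of k] k by (intro linear_form_polys_in) auto
  then show "act g i - mpol_var i \<in> polys_in {1..t k}"
    using linear_form_diff[OF dual_act_in[OF G.mem_carrier[OF g] x_in[OF inn]] x_in[OF inn]] linear_form_x[OF inn]
    by (simp add: act_def)
next
  fix h assume h: "h \<in> G"
  \<comment> \<open>Left multiplication by \<open>h\<close> is the permutation of \<open>G\<close>
    behind the invariance of norms.\<close>
  have "inj_on (\<lambda>g. h \<circ> g) G"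
    using G.mem_carrier[OF h] by (auto simp: inj_on_def GL_carrier bij_def fun.inj_map_strong fun_eq_iff)
  moreover have "(\<lambda>g. h \<circ> g) ` G \<subseteq> G" using G.m_closed[OF h] by auto
  ultimately have "bij_betw (\<lambda>g. h \<circ> g) G G" using fin by (simp add: bij_betw_def endo_inj_surj)
  then show "\<exists>\<sigma>. bij_betw \<sigma> G G \<and> (\<forall>g\<in>G. \<forall>i\<in>{1..n}. mpol_subst (act h) (act g i) = act (\<sigma> g) i)"
    using act_comp[OF G.mem_carrier[OF h] G.mem_carrier] by blast
next
  fix f g assume f: "f \<in> polys_in {1..n}" and g: "g \<in> G"
    and E: "\<And>g. g \<in> (\<Union>k\<in>{1..r}. elem k) \<Longrightarrow> mpol_subst (act g) f = f"
  have "G \<subseteq> {g \<in> G. mpol_subst (act g) f = f}"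
  proof (rule G_subset_if[OF stabilizer_subgroup[OF G f]])
    show "elem k \<subseteq> {g \<in> G. mpol_subst (act g) f = f}" if "k \<in> {1..r}" for k
      using E that by (blast intro: elem_subset[THEN subsetD])
  qed
  then show "mpol_subst (act g) f = f" using g by blast
next
  fix g assume "g \<in> (\<Union>k\<in>{1..r}. elem k)"
  then obtain k where k: "k \<in> {1..r}" "g \<in> elem k" by blast
  have "i \<in> {t k<..t (Suc k)}" if i: "i \<in> {1..n}" "act g i \<noteq> mpol_var i" for i
  proof -
    have "dual_act g (x i) \<noteq> x i" using i linear_form_x[of i] by (auto simp: act_def)
    then show ?thesis using k i t_elem[OF k(1)] by (simp add: elem_def)
  qed
  then show "\<exists>l<Suc (Suc r). \<forall>i\<in>{1..n}. act g i \<noteq> mpol_var i \<longrightarrow> i \<in> {t l<..t (Suc l)}"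
    using k(1) by (intro exI[of _ k]) auto
qed (use p fin card t_0 t_last t_mono linear_form_homogeneous in \<open>auto simp: act_def elem_def\<close>)

end

lemma total_degree_homogeneous:
  assumes "homogeneous_of_degree d f" "f \<noteq> 0"
  shows "total_degree f = d"
proof -
  have "mon_degree ` Poly_Mapping.keys f = {d}"
    using assms by (auto simp: homogeneous_of_degree_def image_def simp flip: keys_eq_empty)
  then show ?thesis by (simp add: total_degree_def)
qed

theorem theorem1p2:
  fixes scale :: "'k::field \<Rightarrow> 'v::ab_group_add \<Rightarrow> 'v"
    and Basis :: "'v set"
    and p n :: nat
    and G :: "('v \<Rightarrow> 'v) set"
    and x :: "nat \<Rightarrow> 'v \<Rightarrow> 'k"
  assumes "CHAR('k) = p" and "p > 0"
    and "finite_dimensional_vector_space scale Basis"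
    and "vector_space.dim scale (UNIV :: 'v set) = n"
    and "subgroup G (GL scale)"
    and "finite G"
    and "\<exists>e. card G = p ^ e"
    and "gen_nakajima_basis scale n G x"
  shows "complete_intersection n (hilbert_ideal n x G) \<and>
    (\<exists>f :: nat \<Rightarrow> 'k mpol.
       hilbert_ideal n x G = genideal (mpol_ring n) (f ` {1..n}) \<and>
       (\<forall>j \<in> {1..n}.
          homogeneous (f j) \<and>
          f j \<in> polys_upto j \<and>
          total_degree (f j) \<le> card G \<and>
          Poly_Mapping.lookup (f j) (Poly_Mapping.single j (total_degree (f j))) \<noteq> 0))"
proof -
  \<comment> \<open>The characteristic of a field is prime once it is positive.\<close>
  have prime: "Factorial_Ring.prime p" using prime_CHAR_semidom[where ?'a = 'k] assms(1,2) by simp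
  obtain e where e: "card G = p ^ e" using assms(7) by blast
  obtain r s where "ordered_dual_basis scale n x" "gen_nakajima_sequence scale n G x r s"
    using assms(8) by (auto simp: gen_nakajima_basis_def)
  then interpret nakajima scale n x G r s
    using assms(3,5) by (intro nakajima.intro dual_basis.intro nakajima_axioms.intro)
      (auto simp: finite_dimensional_vector_space_def)
  interpret B: block_action n "Suc (Suc r)" t G "\<Union>k\<in>{1..r}. elem k" act p e
    by (rule block_action) fact+
  have hilb: "B.hilb = hilbert_ideal n x G"
    by (simp add: B.hilb_def hilbert_ideal_def B.invs_def invariants_def polys_upto_eq sym_act_eq)
  obtain f a where gen: "B.hilb = genideal (mpol_ring n) (f ` {1..n})"
    and f: "\<And>j. j \<in> {1..n} \<Longrightarrow> a j \<le> e \<and> homogeneous_of_degree (p ^ a j) (f j) \<and> f j \<in> polys_in {1..j} \<and>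
        Poly_Mapping.lookup (f j) (Poly_Mapping.single j (p ^ a j)) \<noteq> 0"
    using B.hilb_generators by blast
  interpret T: triangular_system n f "\<lambda>j. p ^ a j"
    using f assms(2) by unfold_locales auto
  \<comment> \<open>The nonzero leading coefficient excludes the zero polynomial, whose total degree
    is 0 by convention.\<close>
  have deg: "total_degree (f j) = p ^ a j" if "j \<in> {1..n}" for j
    using f[OF that] by (intro total_degree_homogeneous) auto
  have "total_degree (f j) \<le> card G" if "j \<in> {1..n}" for j
    using f[OF that] assms(2) unfolding deg[OF that] e by (intro power_increasing) auto
  then have "\<forall>j \<in> {1..n}. homogeneous (f j) \<and> f j \<in> polys_upto j \<and> total_degree (f j) \<le> card G \<and>
      Poly_Mapping.lookup (f j) (Poly_Mapping.single j (total_degree (f j))) \<noteq> 0"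
    using f deg unfolding homogeneous_def polys_upto_eq by metis
  then show ?thesis
    using T.complete_intersection_genideal gen hilb by auto
qed

end
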